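(* Let $\rho:\Gamma\to GL_5(\mathbb{C})$ be a $T$-unitarizable, $T$-determined representation and $\upsilon$ a multiplier system with cusp parameter $m$. Let $\widetilde{\lambda_1},\dots,\widetilde{\lambda_5}$ and $\lambda_0$ be as in the context, and assume $\frac{12\lambda_0}{5}-m\in\mathbb{Z}$. Put $k_0=\frac{12}{5}\lambda_0-4$, and let $F_0\in\mathcal{H}(k_0,\rho,\upsilon)$ be a nonzero vector whose components form a fundamental system of solutions of a fifth order MLDE in weight $k_0$. Then: (i) $\mathcal{H}(\rho,\upsilon)$ is a free $\mathcal{M}$-module of rank 5 with basis $\{F_0,DF_0,D^2F_0,D^3F_0,D^4F_0\}$; (ii) for all integers $k\ge0$, $\dim\mathcal{H}(k_0+2k,\rho,\upsilon)=\left[\frac{5k}{6}\right]$ if $k\equiv5\pmod 6$ and $=\left[\frac{5k}{6}\right]+1$ if $k\not\equiv5\pmod6$; (iii) $\mathcal{H}(\rho,\upsilon)=\mathcal{R}F_0$ is a cyclic $\mathcal{R}$-module.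
   Context: $\Gamma=SL(2,\mathbb{Z})$ acts on the upper half-plane $\mathbb{H}$ by Möbius transformations; $T=\begin{pmatrix}1&1\\0&1\end{pmatrix}$; $q=e^{2\pi iz}$, $\mathbf{e}(r)=e^{2\pi ir}$; $[x]$ is the greatest integer $\le x$. Complex powers use the principal branch of $\log$. For $k\in\mathbb{R}$, a multiplier system of weight $k$ is a map $\upsilon:\Gamma\to\{|w|=1\}$ such that $\nu(\gamma,z)=\upsilon(\gamma)(cz+d)^k$ satisfies $\nu(\gamma\sigma,z)=\nu(\gamma,\sigma z)\nu(\sigma,z)$; it is also one of weight $k+n$, $n\in\mathbb{Z}$. Cusp parameter: the $m\in[0,12)$ with $\upsilon(T)=\mathbf{e}(m/12)$. Slash: $(f|_k^\upsilon\gamma)(z)=\upsilon(\gamma)^{-1}(cz+d)^{-k}f(\gamma z)$. Moderate growth: $|f(x+iy)|\le y^N$ for $y>c$. $\mathcal{H}(k,\rho,\upsilon)$: column vectors $F$ of holomorphic moderate-growth functions on $\mathbb{H}$ with $F|_k^\upsilon\gamma=\rho(\gamma)F$ for all $\gamma$; $\mathcal{H}(\rho,\upsilon)=\bigoplus_{n\in\mathbb{Z}}\mathcal{H}(k+n,\rho,\upsilon)$. $\mathcal{M}=\mathbb{C}[E_4,E_6]$ is the graded ring of holomorphic integral-weight modular forms for $\Gamma$ with trivial multiplier, acting by multiplication. $T$-unitarizable: $\rho(T)$ conjugate to a unitary matrix. An irreducible $\rho$ of dimension $d$ is $T$-determined if every indecomposable $\rho':\Gamma\to GL_d(\mathbb{C})$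 with $\rho'(T)$ having the same eigenvalues as $\rho(T)$ is irreducible. $\eta=q^{1/24}\prod_{n\ge1}(1-q^n)$, $P=\frac{i}{\pi}\frac{\eta'}{\eta}$, $D_kf=\frac{1}{2\pi i}\frac{df}{dz}+kPf$; $D$ acts on $\mathcal{H}(k,\rho,\upsilon)$ componentwise as $D_k$, $D^n=D_{k+2(n-1)}\circ\cdots\circ D_k$. An MLDE of order $n$ in weight $k$ is $D_k^nf+M_4D_k^{n-2}f+\cdots+M_{2n}f=0$, $M_{2j}\in\mathcal{M}_{2j}$; a fundamental system is a basis of its solution space. $\mathcal{R}=\mathcal{M}[d]$ with $dM=Md+DM$ acts by $d\cdot F=DF$; $\mathcal{R}F_0$ = all finite sums $\sum M_jD^jF_0$. Setting: write the eigenvalues of $\rho(T)$ as $\mathbf{e}(r_1),\dots,\mathbf{e}(r_5)$, $0\le r_1<\dots<r_5<1$; $\widetilde{\lambda_j}\in[0,1)$ with $\widetilde{\lambda_j}\equiv r_j+\frac{m}{12}\pmod{\mathbb{Z}}$; $\lambda_0=\sum_j\widetilde{\lambda_j}$. *)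

theory Defs
  imports "HOL-Analysis.Analysis" "HOL-Library.Function_Algebras"
begin

type_synonym sl2 = "int \<times> int \<times> int \<times> int"  (* (a,b,c,d) = matrix [[a,b],[c,d]] *)

definition SL2Z :: "sl2 set" where
  "SL2Z = {(a,b,c,d). a*d - b*c = 1}"

definition mmul :: "sl2 \<Rightarrow> sl2 \<Rightarrow> sl2" where
  "mmul g h = (case g of (a,b,c,d) \<Rightarrow> case h of (a',b',c',d') \<Rightarrow>
      (a*a' + b*c', a*b' + b*d', c*a' + d*c', c*b' + d*d'))"

definition Tmat :: sl2 where "Tmat = (1,1,0,1)"

definition HH :: "complex set" where "HH = {z. 0 < Im z}"

definition moeb :: "sl2 \<Rightarrow> complex \<Rightarrow> complex" where
  "moeb g z = (case g of (a,b,c,d) \<Rightarrow> (of_int a * z + of_int b) / (of_int c * z + of_int d))"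

definition jfac :: "sl2 \<Rightarrow> complex \<Rightarrow> complex" where
  "jfac g z = (case g of (a,b,c,d) \<Rightarrow> of_int c * z + of_int d)"

definition ee :: "real \<Rightarrow> complex" where
  "ee r = exp (2 * of_real pi * \<i> * of_real r)"

section \<open>Multiplier systems (complex powers: principal branch, Isabelle's powr)\<close>

definition multiplier_system :: "real \<Rightarrow> (sl2 \<Rightarrow> complex) \<Rightarrow> bool" where
  "multiplier_system k v \<longleftrightarrow>
     (\<forall>g\<in>SL2Z. cmod (v g) = 1) \<and>
     (\<forall>g\<in>SL2Z. \<forall>s\<in>SL2Z. \<forall>z\<in>HH.
        v (mmul g s) * jfac (mmul g s) z powr of_real k
        = (v g * jfac g (moeb s z) powr of_real k) * (v s * jfac s z powr of_real k))"

definition representation :: "(sl2 \<Rightarrow> complex^'n^'n) \<Rightarrow> bool" where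
  "representation r \<longleftrightarrow> (\<forall>g\<in>SL2Z. invertible (r g)) \<and>
     (\<forall>g\<in>SL2Z. \<forall>h\<in>SL2Z. r (mmul g h) = r g ** r h)"

definition csubspace :: "(complex^'n) set \<Rightarrow> bool" where
  "csubspace W \<longleftrightarrow> 0 \<in> W \<and> (\<forall>x\<in>W. \<forall>y\<in>W. x + y \<in> W) \<and> (\<forall>c. \<forall>x\<in>W. c *s x \<in> W)"

definition invariant_sub :: "(sl2 \<Rightarrow> complex^'n^'n) \<Rightarrow> (complex^'n) set \<Rightarrow> bool" where
  "invariant_sub r W \<longleftrightarrow> csubspace W \<and> (\<forall>g\<in>SL2Z. \<forall>x\<in>W. r g *v x \<in> W)"

definition irreducible_rep :: "(sl2 \<Rightarrow> complex^'n^'n) \<Rightarrow> bool" where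
  "irreducible_rep r \<longleftrightarrow> representation r \<and>
     (\<forall>W. invariant_sub r W \<longrightarrow> W = {0} \<or> W = UNIV)"

definition indecomposable_rep :: "(sl2 \<Rightarrow> complex^'n^'n) \<Rightarrow> bool" where
  "indecomposable_rep r \<longleftrightarrow> representation r \<and>
     \<not> (\<exists>W1 W2. invariant_sub r W1 \<and> invariant_sub r W2 \<and> W1 \<noteq> {0} \<and> W2 \<noteq> {0} \<and>
            W1 \<inter> W2 = {0} \<and> (\<forall>x. \<exists>y\<in>W1. \<exists>z\<in>W2. x = y + z))"

definition eigenvalues :: "complex^'n^'n \<Rightarrow> complex set" where
  "eigenvalues A = {c. \<exists>v. v \<noteq> 0 \<and> A *v v = c *s v}"

definition unitary_mat :: "complex^'n^'n \<Rightarrow> bool" where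
  "unitary_mat U \<longleftrightarrow> (\<chi> i j. cnj (U $ j $ i)) ** U = mat 1"

definition T_unitarizable :: "(sl2 \<Rightarrow> complex^'n^'n) \<Rightarrow> bool" where
  "T_unitarizable r \<longleftrightarrow> (\<exists>P U :: complex^'n^'n. invertible P \<and> unitary_mat U \<and> r Tmat ** P = P ** U)"

definition T_determined :: "(sl2 \<Rightarrow> complex^'n^'n) \<Rightarrow> bool" where
  "T_determined r \<longleftrightarrow> irreducible_rep r \<and>
     (\<forall>r'::sl2 \<Rightarrow> complex^'n^'n. indecomposable_rep r' \<and> eigenvalues (r' Tmat) = eigenvalues (r Tmat)
          \<longrightarrow> irreducible_rep r')"

text \<open>Convention: functions on the upper half-plane are represented as functions
  on all of C that vanish outside HH.\<close>

definition eta :: "complex \<Rightarrow> complex" where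
  "eta z = exp (2 * of_real pi * \<i> * z / 24) * prodinf (\<lambda>n. 1 - exp (2 * of_real pi * \<i> * z) ^ Suc n)"

definition Pfun :: "complex \<Rightarrow> complex" where
  "Pfun z = \<i> / of_real pi * deriv eta z / eta z"

definition Dsc :: "real \<Rightarrow> (complex \<Rightarrow> complex) \<Rightarrow> complex \<Rightarrow> complex" where
  "Dsc k f z = (if z \<in> HH then deriv f z / (2 * of_real pi * \<i>) + of_real k * Pfun z * f z else 0)"

fun Dscpow :: "real \<Rightarrow> nat \<Rightarrow> (complex \<Rightarrow> complex) \<Rightarrow> complex \<Rightarrow> complex" where
  "Dscpow k 0 f = f"
| "Dscpow k (Suc n) f = Dsc (k + 2 * real n) (Dscpow k n f)"

definition Dv :: "real \<Rightarrow> (complex \<Rightarrow> complex^'n) \<Rightarrow> complex \<Rightarrow> complex^'n" where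
  "Dv k F z = (\<chi> i. Dsc k (\<lambda>w. F w $ i) z)"

fun Dvpow :: "real \<Rightarrow> nat \<Rightarrow> (complex \<Rightarrow> complex^'n) \<Rightarrow> complex \<Rightarrow> complex^'n" where
  "Dvpow k 0 F = F"
| "Dvpow k (Suc n) F = Dv (k + 2 * real n) (Dvpow k n F)"

definition moderate_growth :: "(complex \<Rightarrow> complex) \<Rightarrow> bool" where
  "moderate_growth f \<longleftrightarrow> (\<exists>N::nat. \<exists>c::real. \<forall>z. Im z > c \<longrightarrow> cmod (f z) \<le> Im z ^ N)"

definition Hsp :: "real \<Rightarrow> (sl2 \<Rightarrow> complex^'n^'n) \<Rightarrow> (sl2 \<Rightarrow> complex) \<Rightarrow> (complex \<Rightarrow> complex^'n) set" where
  "Hsp k r v = {F. (\<forall>i. (\<lambda>z. F z $ i) holomorphic_on HH \<and> moderate_growth (\<lambda>z. F z $ i)) \<and>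
      (\<forall>z. z \<notin> HH \<longrightarrow> F z = 0) \<and>
      (\<forall>g\<in>SL2Z. \<forall>z\<in>HH.
         (inverse (v g) * jfac g z powr (- of_real k)) *s F (moeb g z) = r g *v F z)}"

definition MF :: "int \<Rightarrow> (complex \<Rightarrow> complex) set" where
  "MF k = {f. f holomorphic_on HH \<and> moderate_growth f \<and> (\<forall>z. z \<notin> HH \<longrightarrow> f z = 0) \<and>
      (\<forall>g\<in>SL2Z. \<forall>z\<in>HH. f (moeb g z) = jfac g z powi k * f z)}"

text \<open>The graded ring M = direct sum of the M_k, realised as functions.\<close>
definition Mring :: "(complex \<Rightarrow> complex) set" where
  "Mring = {f. \<exists>S::int set. \<exists>g. finite S \<and> (\<forall>k\<in>S. g k \<in> MF k) \<and> f = (\<lambda>z. \<Sum>k\<in>S. g k z)}"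

text \<open>H(rho,upsilon) = direct sum over n in Z of H(k+n,rho,upsilon), realised as functions.\<close>
definition Htot :: "real \<Rightarrow> (sl2 \<Rightarrow> complex^'n^'n) \<Rightarrow> (sl2 \<Rightarrow> complex) \<Rightarrow> (complex \<Rightarrow> complex^'n) set" where
  "Htot k r v = {F. \<exists>S::int set. \<exists>G. finite S \<and> (\<forall>n\<in>S. G n \<in> Hsp (k + of_int n) r v) \<and>
      F = (\<lambda>z. \<Sum>n\<in>S. G n z)}"

definition MLDE5_sols :: "real \<Rightarrow> (nat \<Rightarrow> complex \<Rightarrow> complex) \<Rightarrow> (complex \<Rightarrow> complex) set" where
  "MLDE5_sols k M = {f. f holomorphic_on HH \<and> (\<forall>z. z \<notin> HH \<longrightarrow> f z = 0) \<and>
      (\<forall>z\<in>HH. Dscpow k 5 f z + M 4 z * Dscpow k 3 f z + M 6 z * Dscpow k 2 f z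
                + M 8 z * Dscpow k 1 f z + M 10 z * f z = 0)}"

definition fundamental_system_MLDE5 :: "real \<Rightarrow> (complex \<Rightarrow> complex^'n) \<Rightarrow> bool" where
  "fundamental_system_MLDE5 k F \<longleftrightarrow>
     (\<exists>M. M 4 \<in> MF 4 \<and> M 6 \<in> MF 6 \<and> M 8 \<in> MF 8 \<and> M 10 \<in> MF 10 \<and>
        (\<forall>i. (\<lambda>z. F z $ i) \<in> MLDE5_sols k M) \<and>
        (\<forall>c::'n \<Rightarrow> complex. (\<forall>z\<in>HH. (\<Sum>i\<in>UNIV. c i * F z $ i) = 0) \<longrightarrow> (\<forall>i. c i = 0)) \<and>
        (\<forall>f\<in>MLDE5_sols k M. \<exists>c::'n \<Rightarrow> complex. \<forall>z\<in>HH. f z = (\<Sum>i\<in>UNIV. c i * F z $ i)))"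

definition vscale :: "complex \<Rightarrow> (complex \<Rightarrow> complex^'n) \<Rightarrow> complex \<Rightarrow> complex^'n" where
  "vscale c F = (\<lambda>z. c *s F z)"

end

theory Submission
  imports Defs "HOL-Real_Asymp.Real_Asymp" "HOL-Complex_Analysis.Complex_Analysis"
begin

text \<open>
  Let \<open>W\<close> be the determinant of the matrix with rows \<open>F\<^sub>0, D F\<^sub>0, \<dots>, D\<^sup>4 F\<^sub>0\<close>. The differential equation has no
  fourth order term, so \<open>D W = 0\<close> in weight \<open>12 \<lambda>\<^sub>0\<close>, hence \<open>W\<close> is a nonzero multiple of \<open>\<eta>\<close> to the power
  \<open>24 \<lambda>\<^sub>0\<close> and vanishes nowhere. By Cramer's rule every \<open>F\<close> is a combination of the rows. Its coefficients are
  modular of integral weight, and they are bounded at infinity: after diagonalising \<open>\<rho>(T)\<close>, the numerators vanish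
  there to the order \<open>\<lambda>\<^sub>0\<close> of \<open>W\<close>.

  The classical facts about modular forms are also extracted from \<open>W\<close>. As \<open>W\<close> does not depend on the connection
  term of \<open>D\<close>, it is modular for trivial reasons, and since \<open>\<lambda>\<^sub>0 > 0\<close>, its logarithmic derivative yields the
  quasi-modularity of \<open>P\<close>. This gives the modularity of \<open>\<eta>\<close> to the power 24 and, by Ramanujan's differential
  equations read as definitions, the forms \<open>E\<^sub>4\<close> and \<open>E\<^sub>6\<close>. The dimensions follow by dividing cusp forms by \<open>\<Delta>\<close>.
\<close>

no_notation fps_nth (infixl "$" 75)

subsection \<open>The nome and the eta function\<close>

text \<open>The rows \<open>F0\<close>, ..., \<open>D^4 F0\<close> have weights \<open>k0\<close>,
  ..., \<open>k0 + 8\<close>, so W has weight \<open>5 * k0 + 20\<close>. The value 12/5 lambda0 - 4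
  of \<open>k0\<close> turns this into 12 lambda0, the weight of the power of eta with order lambda0
  at infinity. The determinant of any five forms in H(rho, v) has at least that order, because
  exponents in [0, 1) are the least ones compatible with rho(T); so Cramer's quotients have no pole
  at infinity. The obstacle is a circle: the \<open>D^j F0\<close> are known to be forms only once P
  is quasi-modular, and that law is usually read off from modular forms already constructed. The
  Wronskian breaks it, since its transformation can be computed while the connection term is itself
  moved by the group. Positivity of lambda0 comes from the distinct r_j: at most one exponent can be
  0 modulo 1. Once the expansion is known weight by weight, (ii) is a count: in weight
  \<open>k0 + 2 * k\<close> the coefficient of \<open>D^j F0\<close> runs over M_(2k-2j).\<close>

definition qexp :: "complex \<Rightarrow> complex" where
  "qexp z = exp (2 * of_real pi * \<i> * z)"

text \<open>Holomorphy of \<open>g\<close> at 0 is included, so the predicate expresses holomorphy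
  of \<open>f\<close> at the cusp, with constant term \<open>g 0\<close>. The function on the disc
  stands in for the power series.\<close>

definition q_expansion :: "(complex \<Rightarrow> complex) \<Rightarrow> (complex \<Rightarrow> complex) \<Rightarrow> bool" where
  "q_expansion f g \<longleftrightarrow> g holomorphic_on ball 0 1 \<and> (\<forall>z\<in>HH. f z = g (qexp z))"

lemma open_HH: "open HH"
  unfolding HH_def by (rule open_halfspace_Im_gt)

lemma convex_HH: "convex HH"
  unfolding HH_def by (rule convex_halfspace_Im_gt)

lemma connected_HH: "connected HH"
  using convex_HH convex_connected by blast

lemma norm_qexp: "norm (qexp z) = exp (- 2 * pi * Im z)"
  by (simp add: qexp_def norm_exp_eq_Re)

lemma qexp_nonzero [simp]: "qexp z \<noteq> 0"
  by (simp add: qexp_def)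

lemma qexp_in_disc: "z \<in> HH \<Longrightarrow> qexp z \<in> ball 0 1"
  by (simp add: norm_qexp HH_def)

lemma qexp_has_derivative [derivative_intros]:
  "(f has_field_derivative f') (at z within A) \<Longrightarrow>
   ((\<lambda>z. qexp (f z)) has_field_derivative 2 * of_real pi * \<i> * f' * qexp (f z)) (at z within A)"
  unfolding qexp_def by (auto intro!: derivative_eq_intros)

lemma qexp_holomorphic [holomorphic_intros]: "f holomorphic_on A \<Longrightarrow> (\<lambda>z. qexp (f z)) holomorphic_on A"
  unfolding qexp_def by (intro holomorphic_intros)

lemma qexp_add: "qexp (z + w) = qexp z * qexp w"
  by (simp add: qexp_def exp_add ring_distribs)

lemma qexp_plus_1: "qexp (z + 1) = qexp z"
  using exp_two_pi_i by (simp add: qexp_add) (simp add: qexp_def mult_ac)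

lemma holomorphic_on_comp_qexp:
  assumes "g holomorphic_on ball 0 1"
  shows "(\<lambda>z. g (qexp z)) holomorphic_on HH"
proof -
  have "(g \<circ> qexp) holomorphic_on HH"
    by (intro holomorphic_on_compose_gen[OF _ assms] holomorphic_intros) (use qexp_in_disc in auto)
  then show ?thesis by (simp add: o_def)
qed

lemma q_expansion_holomorphic:
  assumes "q_expansion f g"
  shows "f holomorphic_on HH"
  using holomorphic_on_comp_qexp[of g] assms
  by (auto simp: q_expansion_def intro: holomorphic_transform)

lemma q_expansion_mult:
  "q_expansion f g \<Longrightarrow> q_expansion f' g' \<Longrightarrow> q_expansion (\<lambda>z. f z * f' z) (\<lambda>z. g z * g' z)"
  by (auto simp: q_expansion_def intro!: holomorphic_intros)

lemma q_expansion_add: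
  "q_expansion f g \<Longrightarrow> q_expansion f' g' \<Longrightarrow> q_expansion (\<lambda>z. f z + f' z) (\<lambda>z. g z + g' z)"
  by (auto simp: q_expansion_def intro!: holomorphic_intros)

lemma q_expansion_cmult:
  "q_expansion f g \<Longrightarrow> q_expansion (\<lambda>z. c * f z) (\<lambda>z. c * g z)"
  by (auto simp: q_expansion_def intro!: holomorphic_intros)

lemma q_expansion_power:
  "q_expansion f g \<Longrightarrow> q_expansion (\<lambda>z. f z ^ n) (\<lambda>z. g z ^ n)"
  by (auto simp: q_expansion_def intro!: holomorphic_intros)

lemma q_expansion_has_derivative:
  assumes "q_expansion f g" "z \<in> HH"
  shows "(f has_field_derivative 2 * of_real pi * \<i> * qexp z * deriv g (qexp z)) (at z)"
proof -
  have g: "(g has_field_derivative deriv g (qexp z)) (at (qexp z))"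
    using assms qexp_in_disc by (intro holomorphic_derivI[of g "ball 0 1"]) (auto simp: q_expansion_def)
  have "((g \<circ> qexp) has_field_derivative (deriv g (qexp z) * (2 * of_real pi * \<i> * 1 * qexp z))) (at z)"
    using g by (rule DERIV_chain) (auto intro!: derivative_eq_intros)
  moreover have "(g \<circ> qexp) w = f w" if "w \<in> HH" for w
    using assms that by (simp add: q_expansion_def)
  ultimately show ?thesis
    using has_field_derivative_transform_within_open[OF _ open_HH assms(2), of "g \<circ> qexp" _ f]
    by (simp add: mult_ac)
qed

lemma q_expansion_deriv:
  assumes "q_expansion f g"
  shows "q_expansion (\<lambda>z. deriv f z / (2 * of_real pi * \<i>)) (\<lambda>w. w * deriv g w)"
  using assms DERIV_imp_deriv[OF q_expansion_has_derivative[OF assms]]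
  by (auto simp: q_expansion_def intro!: holomorphic_intros)

lemma q_expansion_bounded_at_infinity:
  assumes "q_expansion f g"
  shows "\<exists>B. \<forall>z. Im z > 1 \<longrightarrow> norm (f z) \<le> B"
proof -
  have "cball 0 (exp (- 2 * pi)) \<subseteq> ball (0::complex) 1"
    by (simp add: cball_subset_ball_iff)
  then have "continuous_on (cball 0 (exp (- 2 * pi))) g"
    using assms unfolding q_expansion_def
    by (meson holomorphic_on_imp_continuous_on holomorphic_on_subset)
  then have "bounded (g ` cball 0 (exp (- 2 * pi)))"
    using compact_cball compact_continuous_image compact_imp_bounded by blast
  then obtain B where "\<forall>y\<in>g ` cball 0 (exp (- 2 * pi)). norm y \<le> B"
    by (auto simp only: bounded_iff)
  then have B: "norm (g w) \<le> B" if "w \<in> cball 0 (exp (- 2 * pi))" for w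
    using that by blast
  have "norm (f z) \<le> B" if "Im z > 1" for z
  proof -
    have "z \<in> HH" using that by (simp add: HH_def)
    moreover have "qexp z \<in> cball 0 (exp (- 2 * pi))"
      using that by (simp add: norm_qexp)
    ultimately show ?thesis using B assms by (simp add: q_expansion_def)
  qed
  then show ?thesis by blast
qed

lemma bounded_at_infinity_imp_moderate_growth:
  assumes "\<And>z. Im z > c \<Longrightarrow> norm (f z) \<le> B"
  shows "moderate_growth f"
  unfolding moderate_growth_def
proof (intro exI allI impI)
  fix z :: complex
  assume z: "Im z > max (max c B) 1"
  have "norm (f z) \<le> B" using assms z by simp
  also have "B \<le> Im z ^ 1" using z by simp
  finally show "norm (f z) \<le> Im z ^ 1" .
qed

lemma q_expansion_moderate_growth: "q_expansion f g \<Longrightarrow> moderate_growth f"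
  using q_expansion_bounded_at_infinity bounded_at_infinity_imp_moderate_growth by blast

section \<open>Euler's product, its logarithm, and the expansion of P\<close>

definition euler_phi :: "complex \<Rightarrow> complex" where
  "euler_phi w = prodinf (\<lambda>n. 1 - w ^ Suc n)"

lemma euler_phi_convergent:
  fixes w :: complex
  assumes "norm w < 1"
  shows "convergent_prod (\<lambda>n. 1 - w ^ Suc n)"
proof -
  have "summable (\<lambda>n. norm w ^ n * norm w)"
    using assms by (intro summable_mult2 summable_geometric) auto
  then have "summable (\<lambda>n. norm (- (w ^ Suc n)))"
    by (simp only: norm_minus_cancel norm_power norm_mult power_Suc2)
  moreover have "- (w ^ Suc n) \<noteq> -1" for n
  proof
    assume "- (w ^ Suc n) = -1"
    then have "norm w ^ Suc n = 1" by (metis neg_equal_iff_equal norm_one norm_power)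
    moreover have "norm w ^ Suc n < 1" using assms by (simp add: power_less_one_iff del: power_Suc)
    ultimately show False by linarith
  qed
  ultimately show ?thesis
    using summable_imp_convergent_prod_complex[of "\<lambda>n. - (w ^ Suc n)"] by simp
qed

lemma one_minus_power_nonzero:
  fixes w :: complex
  assumes "norm w < 1"
  shows "1 - w ^ Suc n \<noteq> 0"
proof
  assume "1 - w ^ Suc n = 0"
  then have "norm w ^ Suc n = 1" by (metis eq_iff_diff_eq_0 norm_one norm_power)
  moreover have "norm w ^ Suc n < 1" using assms by (simp add: power_less_one_iff del: power_Suc)
  ultimately show False by linarith
qed

lemma euler_phi_nonzero: "norm w < 1 \<Longrightarrow> euler_phi w \<noteq> 0"
  unfolding euler_phi_def
  by (intro prodinf_nonzero euler_phi_convergent one_minus_power_nonzero)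

lemma euler_phi_holomorphic: "euler_phi holomorphic_on ball 0 1"
proof (rule holomorphic_uniform_sequence[where f = "\<lambda>N w. \<Prod>n<N. 1 + (- (w ^ Suc n))"])
  show "open (ball (0::complex) 1)" by simp
  show "(\<lambda>w. \<Prod>n<N. 1 + (- (w ^ Suc n))) holomorphic_on ball 0 1" for N
    by (intro holomorphic_intros)
  fix x :: complex
  assume x: "x \<in> ball 0 1"
  \<comment> \<open>Midway between \<open>norm x\<close> and 1: the disc of radius
    \<open>r - norm x\<close> about \<open>x\<close> stays in \<open>cball 0 r\<close>, where a
    geometric series in \<open>r\<close> dominates.\<close>
  define r where "r = (1 + norm x) / 2"
  have r: "norm x < r" "r < 1" "0 < r" using x by (auto simp: r_def add_pos_nonneg)
  have sub: "cball x (r - norm x) \<subseteq> cball 0 r"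
  proof
    fix y assume "y \<in> cball x (r - norm x)"
    then have "norm (y - x) \<le> r - norm x" by (simp add: dist_norm norm_minus_commute)
    moreover have "norm y \<le> norm (y - x) + norm x" by (metis diff_add_cancel norm_triangle_ineq)
    ultimately show "y \<in> cball 0 r" by simp
  qed
  have "uniformly_convergent_on (cball x (r - norm x)) (\<lambda>N w. \<Prod>n<N. 1 + (- (w ^ Suc n)))"
  proof (rule uniformly_convergent_on_prod)
    show "uniformly_convergent_on (cball x (r - norm x)) (\<lambda>N w. \<Sum>n<N. norm (- (w ^ Suc n)))"
    proof (rule Weierstrass_m_test')
      fix n w assume "w \<in> cball x (r - norm x)"
      then have "norm w \<le> r" using sub by force
      then have "norm w ^ Suc n \<le> r ^ Suc n" by (rule power_mono) simp
      then show "norm (norm (- (w ^ Suc n))) \<le> r * r ^ n" by (simp add: norm_mult norm_power)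
    next
      show "summable (\<lambda>n. r * r ^ n)" using r by (intro summable_mult summable_geometric) auto
    qed
  qed (auto intro!: continuous_intros)
  then have lim: "uniform_limit (cball x (r - norm x)) (\<lambda>N w. \<Prod>n<N. 1 + (- (w ^ Suc n)))
      (\<lambda>w. lim (\<lambda>N. \<Prod>n<N. 1 + (- (w ^ Suc n)))) sequentially"
    by (simp add: uniformly_convergent_uniform_limit_iff)
  have lim_eq: "lim (\<lambda>N. \<Prod>n<N. 1 + (- (w ^ Suc n))) = euler_phi w" if "w \<in> cball x (r - norm x)" for w
  proof -
    have "norm w < 1" using that sub r by force
    then show ?thesis
      using prodinf_eq_lim'[OF euler_phi_convergent one_minus_power_nonzero, of w]
      by (simp add: euler_phi_def)
  qed
  have "uniform_limit (cball x (r - norm x)) (\<lambda>N w. \<Prod>n<N. 1 + (- (w ^ Suc n))) euler_phi sequentially"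
    using lim by (rule uniform_limit_cong'[THEN iffD1, rotated 2]) (simp_all only: lim_eq)
  moreover have "cball x (r - norm x) \<subseteq> ball 0 1" using sub r by force
  ultimately show "\<exists>d>0. cball x d \<subseteq> ball 0 1 \<and>
      uniform_limit (cball x d) (\<lambda>N w. \<Prod>n<N. 1 + (- (w ^ Suc n))) euler_phi sequentially"
    using r by (intro exI[of _ "r - norm x"]) auto
qed

text \<open>A logarithm on the disc makes real powers of eta available. The choice of branch is
  harmless: it shifts \<open>log_phi\<close> by a multiple of 2 pi i, so
  \<open>exp (s * log_phi w)\<close> changes by a constant factor.\<close>

definition log_phi :: "complex \<Rightarrow> complex" where
  "log_phi = (SOME L. L holomorphic_on ball 0 1 \<and> (\<forall>w\<in>ball 0 1. exp (L w) = euler_phi w))"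

lemma log_phi: "log_phi holomorphic_on ball 0 1" "norm w < 1 \<Longrightarrow> exp (log_phi w) = euler_phi w"
proof -
  have "\<exists>L. L holomorphic_on ball 0 1 \<and> (\<forall>w\<in>ball 0 1. exp (L w) = euler_phi w)"
    by (rule holomorphic_logarithm_exists[of "ball 0 1" euler_phi 0])
       (use euler_phi_holomorphic euler_phi_nonzero in auto)
  then have "log_phi holomorphic_on ball 0 1 \<and> (\<forall>w\<in>ball 0 1. exp (log_phi w) = euler_phi w)"
    unfolding log_phi_def by (rule someI_ex)
  then show "log_phi holomorphic_on ball 0 1" "norm w < 1 \<Longrightarrow> exp (log_phi w) = euler_phi w"
    by auto
qed

lemma eta_eq_exp:
  assumes "z \<in> HH"
  shows "eta z = exp (2 * of_real pi * \<i> * z / 24 + log_phi (qexp z))"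
  using log_phi(2)[of "qexp z"] qexp_in_disc[OF assms]
  by (simp add: eta_def exp_add euler_phi_def qexp_def)

lemma eta_has_derivative:
  assumes "z \<in> HH"
  shows "(eta has_field_derivative
    (2 * of_real pi * \<i> * (1 / 24 + qexp z * deriv log_phi (qexp z))) * eta z) (at z)"
proof -
  have "q_expansion (\<lambda>z. log_phi (qexp z)) log_phi"
    by (simp add: q_expansion_def log_phi)
  note [derivative_intros] = q_expansion_has_derivative[OF this assms]
  have "((\<lambda>z. exp (2 * of_real pi * \<i> * z / 24 + log_phi (qexp z))) has_field_derivative
     (2 * of_real pi * \<i> * (1 / 24 + qexp z * deriv log_phi (qexp z))) * eta z) (at z)"
    by (auto intro!: derivative_eq_intros simp: eta_eq_exp[OF assms] algebra_simps)
  then show ?thesis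
    using has_field_derivative_transform_within_open[OF _ open_HH assms] eta_eq_exp by fastforce
qed

text \<open>This is -E_2/12: \<open>w * deriv log_phi w\<close> is minus the sum of sigma(n)
  w^n.\<close>

definition P_exp :: "complex \<Rightarrow> complex" where
  "P_exp w = - 1 / 12 - 2 * w * deriv log_phi w"

lemma Pfun_expansion: "q_expansion Pfun P_exp"
proof -
  have "P_exp holomorphic_on ball 0 1"
    unfolding P_exp_def using log_phi(1) by (intro holomorphic_intros) auto
  moreover have "Pfun z = P_exp (qexp z)" if "z \<in> HH" for z
  proof -
    have "eta z \<noteq> 0" using that by (simp add: eta_eq_exp)
    then show ?thesis
      unfolding Pfun_def DERIV_imp_deriv[OF eta_has_derivative[OF that]] P_exp_def
      by (simp add: field_simps)
  qed
  ultimately show ?thesis by (simp add: q_expansion_def)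
qed

lemma Pfun_holomorphic: "Pfun holomorphic_on HH"
  using Pfun_expansion by (rule q_expansion_holomorphic)

lemma P_exp_0: "P_exp 0 = - 1 / 12"
  by (simp add: P_exp_def)

subsection \<open>Periodic functions of moderate growth\<close>

lemma periodic_int:
  assumes per: "\<And>z. z \<in> HH \<Longrightarrow> f (z + 1) = f z"
  assumes "z \<in> HH"
  shows "f (z + of_int n) = f z"
proof -
  have nat: "f (w + of_nat n) = f w" if "w \<in> HH" for w n
  proof (induction n)
    case (Suc n)
    have "w + of_nat n \<in> HH" using that by (simp add: HH_def)
    from per[OF this] show ?case using Suc by (simp add: add_ac)
  qed simp
  show ?thesis
  proof (cases "n \<ge> 0")
    case True
    then show ?thesis using nat[OF assms(2), of "nat n"] by simp
  next
    case False
    have "z + of_int n \<in> HH" using assms(2) by (simp add: HH_def)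
    from nat[OF this, of "nat (-n)"] False show ?thesis by simp
  qed
qed

text \<open>The growth hypothesis makes \<open>w * g w\<close> tend to 0 at the puncture, so the singularity of \<open>g\<close> is removable.\<close>

lemma periodic_imp_q_expansion:
  assumes holo: "f holomorphic_on HH"
    and per: "\<And>z. z \<in> HH \<Longrightarrow> f (z + 1) = f z"
    and growth: "\<And>z. Im z > c \<Longrightarrow> norm (f z) \<le> Im z ^ N * exp (2 * pi * l * Im z)"
    and l: "l < 1"
  obtains g where "q_expansion f g"
proof -
  \<comment> \<open>Across the cut of \<open>Ln\<close> the argument of \<open>f\<close> jumps by 1,
    which periodicity hides. Holomorphy is therefore checked with a local logarithm \<open>L\<close>
    in place of \<open>Ln\<close>.\<close>
  define g where "g w = f (Ln w / (2 * of_real pi * \<i>))" for w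
  have g_qexp: "g (qexp z) = f z" if "z \<in> HH" for z
  proof -
    have "exp (Ln (qexp z)) = exp (2 * of_real pi * \<i> * z)"
      by (simp add: qexp_def)
    then obtain n where n: "Ln (qexp z) = 2 * of_real pi * \<i> * z + of_int (2 * n) * pi * \<i>"
      unfolding exp_eq by blast
    have "Ln (qexp z) / (2 * of_real pi * \<i>) = z + of_int n"
      unfolding n by (simp add: field_simps)
    then show ?thesis using periodic_int[of f z n, OF per that] by (simp add: g_def)
  qed
  have surj: "\<exists>z\<in>HH. w = qexp z" if "w \<in> ball 0 1 - {0}" for w
  proof (intro bexI)
    show "w = qexp (Ln w / (2 * of_real pi * \<i>))" using that by (simp add: qexp_def)
    have "ln (norm w) < 0" using that by simp
    then show "Ln w / (2 * of_real pi * \<i>) \<in> HH"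
      using that by (simp add: HH_def Im_divide power2_eq_square field_simps)
  qed
  have "g holomorphic_on ball 0 1 - {0}"
  proof (rule holomorphic_onI)
    fix w assume w: "w \<in> ball (0::complex) 1 - {0}"
    then obtain z where z: "z \<in> HH" "w = qexp z" using surj by blast
    have "open (ball (0::complex) 1 - {0})" by (intro open_delete open_ball)
    then obtain d where d: "d > 0" "ball w d \<subseteq> ball 0 1 - {0}"
      using w by (rule openE)
    have nz: "0 \<notin> ball w d" using d(2) by blast
    obtain L where L: "L holomorphic_on ball w d" "\<And>u. u \<in> ball w d \<Longrightarrow> exp (L u) = u"
      by (rule holomorphic_logarithm_exists[of "ball w d" "\<lambda>u. u" w])
         (use d nz in \<open>auto intro: holomorphic_intros simp del: mem_ball\<close>)
    have q: "qexp (L u / (2 * of_real pi * \<i>)) = u" if "u \<in> ball w d" for u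
      using L(2)[OF that] by (simp add: qexp_def)
    have inHH: "L u / (2 * of_real pi * \<i>) \<in> HH" if "u \<in> ball w d" for u
    proof -
      have "u \<in> ball 0 1" using d(2) that by blast
      then have "norm (qexp (L u / (2 * of_real pi * \<i>))) < 1" using q[OF that] by simp
      then show ?thesis by (simp add: norm_qexp HH_def zero_less_mult_iff)
    qed
    have "(f \<circ> (\<lambda>u. L u / (2 * of_real pi * \<i>))) holomorphic_on ball w d"
      by (intro holomorphic_on_compose_gen[OF _ holo] holomorphic_intros L) (use inHH in auto)
    then have "g holomorphic_on ball w d"
      by (rule holomorphic_transform) (use g_qexp[OF inHH] q in auto)
    then have "g field_differentiable at w"
      by (rule holomorphic_on_imp_differentiable_at) (use d in auto)
    then show "g field_differentiable at w within ball 0 1 - {0}"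
      by (rule field_differentiable_at_within)
  qed
  moreover have "((\<lambda>w. (w - 0) * g w) \<longlongrightarrow> 0) (at 0)"
  proof (rule Lim_null_comparison)
    \<comment> \<open>The growth bound rewritten in \<open>r = norm w\<close> through
      \<open>Im z = - ln r / (2 * pi)\<close>. Up to a power of \<open>ln r\<close> it is
      \<open>r\<close> to the exponent \<open>1 - l\<close>, so \<open>l < 1\<close> makes it tend
      to 0.\<close>
    define h where "h r = r * (((- ln r) / (2 * pi)) ^ N * exp (- l * ln r))" for r :: real
    show "\<forall>\<^sub>F w in at 0. norm ((w - 0) * g w) \<le> h (norm w)"
      unfolding eventually_at
    proof (intro exI[of _ "min 1 (exp (- 2 * pi * c))"] conjI ballI impI)
      fix w :: complex assume "w \<noteq> 0 \<and> dist w 0 < min 1 (exp (- 2 * pi * c))"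
      then have w: "w \<noteq> 0" "norm w < 1" "norm w < exp (- 2 * pi * c)" by auto
      obtain z where z: "z \<in> HH" "w = qexp z" using surj[of w] w by auto
      have "Im z > c" using w(3) z by (simp add: norm_qexp)
      from growth[OF this] have "norm (g w) \<le> Im z ^ N * exp (2 * pi * l * Im z)"
        using g_qexp z by simp
      moreover have "ln (norm w) = - 2 * pi * Im z" by (simp add: z norm_qexp)
      ultimately show "norm ((w - 0) * g w) \<le> h (norm w)"
        by (simp add: h_def norm_mult mult_left_mono mult_ac)
    qed auto
    have "(h \<longlongrightarrow> 0) (at_right 0)"
      unfolding h_def using l by real_asymp
    moreover have "filterlim norm (at_right 0) (at (0::complex))"
      by (auto simp: filterlim_at eventually_at_filter intro!: tendsto_eq_intros)
    ultimately show "((\<lambda>w. h (norm w)) \<longlongrightarrow> 0) (at (0::complex))"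
      by (rule filterlim_compose)
  qed
  ultimately obtain g' where "g' holomorphic_on ball 0 1" "\<forall>w\<in>ball 0 1 - {0}. g' w = g w"
    using holomorphic_on_extend_lim[of g "ball 0 1" 0] by (auto simp: interior_open)
  then have "q_expansion f g'"
    using g_qexp qexp_in_disc by (auto simp: q_expansion_def)
  then show ?thesis by (rule that)
qed

lemma periodic_moderate_imp_q_expansion:
  assumes "f holomorphic_on HH" "\<And>z. z \<in> HH \<Longrightarrow> f (z + 1) = f z" "moderate_growth f"
  obtains g where "q_expansion f g"
proof -
  obtain N c where "\<And>z. Im z > c \<Longrightarrow> norm (f z) \<le> Im z ^ N"
    using assms(3) by (auto simp: moderate_growth_def)
  then show ?thesis
    using periodic_imp_q_expansion[of f c N 0] assms that by auto
qed

subsection \<open>The action of the modular group\<close>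

fun lower_left :: "sl2 \<Rightarrow> int" where
  "lower_left (a, b, c, d) = c"

definition Smat :: sl2 where "Smat = (0, -1, 1, 0)"

lemma Tmat_in: "Tmat \<in> SL2Z" and Smat_in: "Smat \<in> SL2Z"
  by (simp_all add: Tmat_def Smat_def SL2Z_def)

lemma moeb_T: "moeb Tmat z = z + 1" and jfac_T: "jfac Tmat z = 1"
  by (simp_all add: moeb_def Tmat_def jfac_def)

lemma moeb_S: "moeb Smat z = - 1 / z" and jfac_S: "jfac Smat z = z"
  by (simp_all add: moeb_def Smat_def jfac_def)

lemma jfac_nonzero:
  assumes "g \<in> SL2Z" "z \<in> HH"
  shows "jfac g z \<noteq> 0"
proof -
  obtain a b c d where g: "g = (a, b, c, d)" by (cases g)
  show ?thesis
  proof
    assume *: "jfac g z = 0"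
    have "Im (jfac g z) = of_int c * Im z" by (simp add: g jfac_def)
    then have c: "c = 0" using * assms(2) by (simp add: HH_def)
    then have "d = 0" using * by (simp add: g jfac_def)
    then show False using assms(1) c by (simp add: g SL2Z_def)
  qed
qed

lemma Im_moeb:
  assumes "g \<in> SL2Z" "z \<in> HH"
  shows "Im (moeb g z) = Im z / (norm (jfac g z))\<^sup>2"
proof -
  obtain a b c d where g: "g = (a, b, c, d)" by (cases g)
  have det: "real_of_int a * real_of_int d - real_of_int b * real_of_int c = 1"
    using assms(1) by (simp add: g SL2Z_def flip: of_int_mult of_int_diff)
  have "Im (moeb g z) = ((a * Im z) * (c * Re z + d) - (a * Re z + b) * (c * Im z)) / (norm (jfac g z))\<^sup>2"
    by (simp add: g moeb_def jfac_def Im_divide cmod_power2)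
  also have "(a * Im z) * (c * Re z + d) - (a * Re z + b) * (c * Im z) = Im z * (a * d - b * c)"
    by (simp add: algebra_simps)
  also have "\<dots> = Im z" using det by simp
  finally show ?thesis .
qed

lemma moeb_in_HH: "g \<in> SL2Z \<Longrightarrow> z \<in> HH \<Longrightarrow> moeb g z \<in> HH"
  using jfac_nonzero[of g z] by (simp add: HH_def Im_moeb)

lemma jfac_has_derivative: "(jfac g has_field_derivative of_int (lower_left g)) (at z)"
  by (cases g) (auto simp: jfac_def [abs_def] intro!: derivative_eq_intros)

lemma moeb_has_derivative:
  assumes "g \<in> SL2Z" "z \<in> HH"
  shows "(moeb g has_field_derivative 1 / (jfac g z)\<^sup>2) (at z)"
proof -
  obtain a b c d where g: "g = (a, b, c, d)" by (cases g)
  have nz: "of_int c * z + of_int d \<noteq> 0"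
    using jfac_nonzero[OF assms] by (simp add: g jfac_def)
  have det: "of_int a * of_int d - of_int b * of_int c = (1 :: complex)"
    using assms(1) by (simp add: g SL2Z_def flip: of_int_mult of_int_diff)
  have "of_int a * (of_int c * z + of_int d) - (of_int a * z + of_int b) * of_int c
      = (of_int a * of_int d - of_int b * of_int c :: complex)"
    by (simp add: algebra_simps)
  then have eq: "of_int a * (of_int c * z + of_int d) - (of_int a * z + of_int b) * of_int c = 1"
    using det by simp
  show ?thesis
    unfolding g moeb_def [abs_def] jfac_def prod.case
    by (rule derivative_eq_intros refl nz | simp add: eq power2_eq_square nz)+
qed

lemma moeb_holomorphic: "g \<in> SL2Z \<Longrightarrow> moeb g holomorphic_on HH"
  using moeb_has_derivative holomorphic_on_open[OF open_HH] by blast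

text \<open>For lower left entry 0, \<open>jfac\<close> is a constant that may lie on the branch
  cut, but then nothing has to be differentiated. Otherwise its imaginary part is nonzero on
  \<open>HH\<close>, so the cut is never met.\<close>

lemma jfac_powr_has_derivative:
  assumes "g \<in> SL2Z" "z \<in> HH"
  shows "((\<lambda>z. jfac g z powr s) has_field_derivative
           s * of_int (lower_left g) / jfac g z * jfac g z powr s) (at z)"
proof (cases "lower_left g = 0")
  case True
  then have "jfac g w = jfac g z" for w by (cases g) (simp add: jfac_def)
  then have "(\<lambda>z. jfac g z powr s) = (\<lambda>_. jfac g z powr s)" by metis
  then show ?thesis using True by simp
next
  case False
  have "Im (jfac g z) = of_int (lower_left g) * Im z" by (cases g) (simp add: jfac_def)
  then have "jfac g z \<notin> \<real>\<^sub>\<le>\<^sub>0"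
    using False assms(2) by (auto simp: complex_nonpos_Reals_iff HH_def)
  from DERIV_chain2[OF has_field_derivative_powr[OF this] jfac_has_derivative]
  show ?thesis using jfac_nonzero[OF assms] by (simp add: powr_diff field_simps)
qed

lemma jfac_powr_int:
  assumes "g \<in> SL2Z" "z \<in> HH"
  shows "jfac g z powr of_int k = jfac g z powi k"
  using jfac_nonzero[OF assms] by (simp add: powr_of_int power_int_def power_inverse)

lemma jfac_powr_plus_2:
  assumes "g \<in> SL2Z" "z \<in> HH"
  shows "jfac g z powr (s + 2) = jfac g z powr s * (jfac g z)\<^sup>2"
  using jfac_powr_int[OF assms, of 2] by (simp add: powr_add power_int_def)

subsection \<open>Connections\<close>

text \<open>\<open>D\<^sub>k\<close> is the case \<open>\<phi> = Pfun\<close>. Allowing any \<open>\<phi>\<close> lets one transform \<open>D\<^sub>k\<close> by the modular group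
  before the transformation law of \<open>Pfun\<close> is known.\<close>

definition conn :: "(complex \<Rightarrow> complex) \<Rightarrow> real \<Rightarrow> (complex \<Rightarrow> complex) \<Rightarrow> complex \<Rightarrow> complex" where
  "conn \<phi> k f z = deriv f z / (2 * of_real pi * \<i>) + of_real k * \<phi> z * f z"

text \<open>The gauge transform of the connection: the first term is the pullback of the
  differential \<open>\<phi> dz\<close>, the second is the logarithmic derivative of
  \<open>jfac g\<close> over 2 pi i. The equation \<open>pull g \<phi> z = \<phi> z\<close> is the
  quasi-modular law of weight 2.\<close>

definition pull :: "sl2 \<Rightarrow> (complex \<Rightarrow> complex) \<Rightarrow> complex \<Rightarrow> complex" where
  "pull g \<phi> z = \<phi> (moeb g z) / (jfac g z)\<^sup>2 + of_int (lower_left g) / (2 * of_real pi * \<i> * jfac g z)"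

lemma Dsc_eq_conn: "z \<in> HH \<Longrightarrow> Dsc k f z = conn Pfun k f z"
  by (simp add: Dsc_def conn_def)

lemma conn_holomorphic:
  assumes "\<phi> holomorphic_on HH" "f holomorphic_on HH"
  shows "conn \<phi> k f holomorphic_on HH"
  unfolding conn_def [abs_def] using assms open_HH by (intro holomorphic_intros) auto

lemma conn_cong:
  assumes "z \<in> HH" "\<And>z. z \<in> HH \<Longrightarrow> f z = g z"
  shows "conn \<phi> k f z = conn \<phi> k g z"
proof -
  have "eventually (\<lambda>w. w \<in> HH) (nhds z)"
    using open_HH assms(1) by (rule eventually_nhds_in_open)
  then have "deriv f z = deriv g z"
    by (intro deriv_cong_ev refl) (auto elim!: eventually_mono simp: assms(2))
  then show ?thesis by (simp add: conn_def assms)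
qed

lemma pull_holomorphic:
  assumes "\<phi> holomorphic_on HH" "g \<in> SL2Z"
  shows "pull g \<phi> holomorphic_on HH"
proof -
  have "(\<phi> \<circ> moeb g) holomorphic_on HH"
    using moeb_in_HH[OF assms(2)] assms(2)
    by (intro holomorphic_on_compose_gen[OF moeb_holomorphic assms(1)]) auto
  moreover have "jfac g holomorphic_on HH"
    using jfac_has_derivative holomorphic_on_open[OF open_HH] by blast
  ultimately show ?thesis
    unfolding pull_def [abs_def] using jfac_nonzero[OF assms(2)]
    by (intro holomorphic_intros) (auto simp: o_def)
qed

lemma holomorphic_HH_deriv:
  "f holomorphic_on HH \<Longrightarrow> z \<in> HH \<Longrightarrow> (f has_field_derivative deriv f z) (at z)"
  by (rule holomorphic_derivI[OF _ open_HH])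

text \<open>Differentiating the automorphy factor produces an extra term proportional to
  \<open>k\<close>, exactly like the connection term that absorbs it. Hence
  \<open>pull g \<phi>\<close> is the same for all weights and the law can be iterated.\<close>

lemma conn_slash:
  assumes g: "g \<in> SL2Z" and z: "z \<in> HH"
    and holo: "f holomorphic_on HH" "h holomorphic_on HH"
    and eq: "\<And>z. z \<in> HH \<Longrightarrow> f (moeb g z) = jfac g z powr of_real k * h z"
  shows "conn \<phi> k f (moeb g z) = jfac g z powr of_real (k + 2) * conn (pull g \<phi>) k h z"
proof -
  let ?J = "jfac g z" and ?c = "of_int (lower_left g) :: complex" and ?K = "of_real k :: complex"
  have J: "?J \<noteq> 0" using jfac_nonzero[OF g z] .
  have "((\<lambda>z. jfac g z powr ?K * h z) has_field_derivative
      (?K * ?c / ?J * ?J powr ?K * h z + deriv h z * ?J powr ?K)) (at z)"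
    by (rule DERIV_mult[OF jfac_powr_has_derivative[OF g z] holomorphic_HH_deriv[OF holo(2) z]])
  then have d1: "((\<lambda>z. f (moeb g z)) has_field_derivative
      (?K * ?c / ?J * ?J powr ?K * h z + deriv h z * ?J powr ?K)) (at z)"
    by (rule has_field_derivative_transform_within_open[OF _ open_HH z]) (simp add: eq)
  have d2: "((\<lambda>z. f (moeb g z)) has_field_derivative deriv f (moeb g z) * (1 / ?J\<^sup>2)) (at z)"
    by (rule DERIV_chain2[OF holomorphic_HH_deriv[OF holo(1) moeb_in_HH[OF g z]] moeb_has_derivative[OF g z]])
  have dF: "deriv f (moeb g z) = ?J\<^sup>2 * (?K * ?c / ?J * ?J powr ?K * h z + deriv h z * ?J powr ?K)"
    using DERIV_unique[OF d1 d2] J by (simp add: field_simps)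
  have pw: "?J powr of_real (k + 2) = ?J powr ?K * ?J\<^sup>2"
    using jfac_powr_plus_2[OF g z, of ?K] by simp
  show ?thesis
    unfolding conn_def pull_def eq[OF z] dF pw using J
    by (simp add: field_simps power2_eq_square)
qed

lemma conn_linear:
  assumes z: "z \<in> HH" and holo: "\<And>j. j \<in> A \<Longrightarrow> h j holomorphic_on HH"
  shows "conn \<phi> k (\<lambda>z. \<Sum>j\<in>A. c j * h j z) z = (\<Sum>j\<in>A. c j * conn \<phi> k (h j) z)"
proof -
  have "((\<lambda>z. \<Sum>j\<in>A. c j * h j z) has_field_derivative (\<Sum>j\<in>A. c j * deriv (h j) z)) (at z)"
    by (intro DERIV_sum DERIV_cmult holomorphic_HH_deriv holo z)
  then show ?thesis
    unfolding conn_def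
    by (simp add: DERIV_imp_deriv sum.distrib sum_distrib_left sum_divide_distrib algebra_simps)
qed

section \<open>Iterated connections\<close>

primrec conn_pow :: "(complex \<Rightarrow> complex) \<Rightarrow> real \<Rightarrow> nat \<Rightarrow> (complex \<Rightarrow> complex^'n) \<Rightarrow> complex \<Rightarrow> complex^'n" where
  "conn_pow \<phi> k 0 F = F"
| "conn_pow \<phi> k (Suc n) F = (\<lambda>z. \<chi> i. conn \<phi> (k + 2 * real n) (\<lambda>w. conn_pow \<phi> k n F w $ i) z)"

definition vholo :: "(complex \<Rightarrow> complex^'n) \<Rightarrow> bool" where
  "vholo F \<longleftrightarrow> (\<forall>i. (\<lambda>z. F z $ i) holomorphic_on HH)"

lemma conn_pow_vholo:
  assumes "vholo F" "\<phi> holomorphic_on HH"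
  shows "vholo (conn_pow \<phi> k n F)"
proof (induction n)
  case (Suc n)
  then show ?case using conn_holomorphic[OF assms(2)] by (simp add: vholo_def)
qed (simp add: assms)

lemma Dvpow_eq_conn_pow:
  "z \<in> HH \<Longrightarrow> Dvpow k n F z = conn_pow Pfun k n F z"
proof (induction n arbitrary: z)
  case (Suc n)
  show ?case
    using Suc conn_cong[OF Suc.prems, of "\<lambda>w. Dvpow k n F w $ i" "\<lambda>w. conn_pow Pfun k n F w $ i" for i]
    by (simp add: Dv_def Dsc_eq_conn vec_eq_iff)
qed simp

lemma conn_pow_slash:
  fixes F G :: "complex \<Rightarrow> complex^'n"
  assumes g: "g \<in> SL2Z" and \<phi>: "\<phi> holomorphic_on HH" and F: "vholo F" and G: "vholo G"
    and eq: "\<And>z. z \<in> HH \<Longrightarrow> F (moeb g z) = (a * jfac g z powr of_real k) *s (R *v G z)"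
    and z: "z \<in> HH"
  shows "conn_pow \<phi> k n F (moeb g z) =
      (a * jfac g z powr of_real (k + 2 * real n)) *s (R *v conn_pow (pull g \<phi>) k n G z)"
  using z
proof (induction n arbitrary: z)
  case 0
  then show ?case by (simp add: eq)
next
  case (Suc n)
  let ?F = "conn_pow \<phi> k n F" and ?G = "conn_pow (pull g \<phi>) k n G" and ?k = "k + 2 * real n"
  have hF: "(\<lambda>w. ?F w $ i) holomorphic_on HH" and hG: "(\<lambda>w. ?G w $ i) holomorphic_on HH" for i
    using conn_pow_vholo[OF F \<phi>] conn_pow_vholo[OF G pull_holomorphic[OF \<phi> g]] by (auto simp: vholo_def)
  have c1: "conn \<phi> ?k (\<lambda>w. ?F w $ i) (moeb g z) =
      jfac g z powr of_real (?k + 2) * conn (pull g \<phi>) ?k (\<lambda>w. \<Sum>j\<in>UNIV. (a * R $ i $ j) * ?G w $ j) z" for i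
  proof (rule conn_slash[OF g Suc.prems hF])
    show "(\<lambda>w. \<Sum>j\<in>UNIV. (a * R $ i $ j) * ?G w $ j) holomorphic_on HH"
      by (intro holomorphic_intros hG)
    show "?F (moeb g w) $ i = jfac g w powr of_real ?k * (\<Sum>j\<in>UNIV. (a * R $ i $ j) * ?G w $ j)"
      if "w \<in> HH" for w
      using Suc.IH[OF that] by (simp add: matrix_vector_mult_def sum_distrib_left mult_ac)
  qed
  have c2: "conn (pull g \<phi>) ?k (\<lambda>w. \<Sum>j\<in>UNIV. (a * R $ i $ j) * ?G w $ j) z =
     (\<Sum>j\<in>UNIV. (a * R $ i $ j) * conn (pull g \<phi>) ?k (\<lambda>w. ?G w $ j) z)" for i
    by (rule conn_linear[OF Suc.prems hG])
  have k: "?k + 2 = k + 2 * real (Suc n)" by simp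
  show ?case
  proof (rule vec_eq_iff[THEN iffD2], rule allI)
    fix i
    have "conn_pow \<phi> k (Suc n) F (moeb g z) $ i = conn \<phi> ?k (\<lambda>w. ?F w $ i) (moeb g z)" by simp
    also have "\<dots> = jfac g z powr of_real (?k + 2) *
        (\<Sum>j\<in>UNIV. (a * R $ i $ j) * conn (pull g \<phi>) ?k (\<lambda>w. ?G w $ j) z)"
      unfolding c1 c2 ..
    also have "\<dots> = ((a * jfac g z powr of_real (k + 2 * real (Suc n))) *s
        (R *v conn_pow (pull g \<phi>) k (Suc n) G z)) $ i"
      unfolding k by (simp add: matrix_vector_mult_def sum_distrib_left mult_ac del: of_nat_Suc)
    finally show "conn_pow \<phi> k (Suc n) F (moeb g z) $ i = ((a * jfac g z powr of_real (k + 2 * real (Suc n))) *s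
        (R *v conn_pow (pull g \<phi>) k (Suc n) G z)) $ i" .
  qed
qed

text \<open>Two connections of the same weight differ by multiplication with a function, so their
  iterates differ only by terms of lower order.\<close>

lemma conn_pow_compare:
  fixes F :: "complex \<Rightarrow> complex^'n"
  assumes \<phi>: "\<phi> holomorphic_on HH" and \<psi>: "\<psi> holomorphic_on HH" and F: "vholo F"
  shows "\<exists>b. (\<forall>j. b j holomorphic_on HH) \<and> (\<forall>z\<in>HH. conn_pow \<phi> k n F z =
      conn_pow \<psi> k n F z + (\<Sum>j<n. b j z *s conn_pow \<psi> k j F z))"
proof (induction n)
  case 0
  then show ?case by (intro exI[of _ "\<lambda>_ _. 0"]) auto
next
  case (Suc n)
  then obtain b where b: "\<And>j. b j holomorphic_on HH"
    and eq: "\<And>z. z \<in> HH \<Longrightarrow> conn_pow \<phi> k n F z =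
      conn_pow \<psi> k n F z + (\<Sum>j<n. b j z *s conn_pow \<psi> k j F z)" by blast
  let ?k = "k + 2 * real n" and ?p = "2 * of_real pi * \<i>"
  \<comment> \<open>Applying the connection of \<open>\<phi>\<close> to \<open>b j * e j\<close>
    gives \<open>b1 j * e j + b j * e (Suc j)\<close>; two weights occur because \<open>e j\<close>
    lives in weight \<open>k + 2 * j\<close> while the operator acts in weight
    \<open>k + 2 * n\<close>. The leading term contributes \<open>b2\<close> at index
    \<open>n\<close>, and \<open>b'\<close> collects everything after the index shift.\<close>
  define b1 where "b1 j z = deriv (b j) z / ?p + b j z * (of_real ?k * \<phi> z - of_real (k + 2 * real j) * \<psi> z)" for j z
  define b2 where "b2 z = of_real ?k * (\<phi> z - \<psi> z)" for z
  define b' where "b' j z = (if j < n then b1 j z else b2 z) + (if j = 0 then 0 else b (j - 1) z)" for j z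
  have "b1 j holomorphic_on HH" "b2 holomorphic_on HH" for j
    unfolding b1_def [abs_def] b2_def [abs_def]
    using b \<phi> \<psi> open_HH by (auto intro!: holomorphic_intros)
  then have "b' j holomorphic_on HH" for j
    unfolding b'_def [abs_def] using b
    by (cases "j < n"; cases "j = 0") (auto intro!: holomorphic_intros)
  moreover have "conn_pow \<phi> k (Suc n) F z =
      conn_pow \<psi> k (Suc n) F z + (\<Sum>j<Suc n. b' j z *s conn_pow \<psi> k j F z)" if z: "z \<in> HH" for z
  proof (rule vec_eq_iff[THEN iffD2], rule allI)
    fix i
    define e where "e j w = conn_pow \<psi> k j F w $ i" for j w
    have e: "e j holomorphic_on HH" for j
      using conn_pow_vholo[OF F \<psi>] by (simp add: vholo_def e_def [abs_def])
    have e_Suc: "deriv (e j) z / ?p = e (Suc j) z - of_real (k + 2 * real j) * \<psi> z * e j z" for j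
      by (simp add: e_def [abs_def] conn_def)
    let ?f = "\<lambda>w. e n w + (\<Sum>j<n. b j w * e j w)"
    have "(?f has_field_derivative deriv (e n) z + (\<Sum>j<n. deriv (b j) z * e j z + deriv (e j) z * b j z)) (at z)"
      by (intro DERIV_add DERIV_sum DERIV_mult holomorphic_HH_deriv e b z)
    then have d: "deriv ?f z = deriv (e n) z + (\<Sum>j<n. deriv (b j) z * e j z + deriv (e j) z * b j z)"
      by (rule DERIV_imp_deriv)
    have "conn_pow \<phi> k (Suc n) F z $ i = conn \<phi> ?k (\<lambda>w. conn_pow \<phi> k n F w $ i) z" by simp
    also have "\<dots> = conn \<phi> ?k ?f z"
      by (rule conn_cong[OF z]) (simp add: eq e_def)
    also have "\<dots> = deriv (e n) z / ?p + (\<Sum>j<n. deriv (b j) z / ?p * e j z + deriv (e j) z / ?p * b j z)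
         + of_real ?k * \<phi> z * (e n z + (\<Sum>j<n. b j z * e j z))"
      by (simp add: conn_def d add_divide_distrib sum_divide_distrib)
    also have "\<dots> = e (Suc n) z + b2 z * e n z + (\<Sum>j<n. b1 j z * e j z) + (\<Sum>j<n. b j z * e (Suc j) z)"
      unfolding e_Suc b1_def b2_def by (simp add: algebra_simps sum.distrib sum_distrib_left sum_subtractf)
    also have "\<dots> = e (Suc n) z + (\<Sum>j<Suc n. b' j z * e j z)"
    proof -
      have "(\<Sum>j<Suc n. b' j z * e j z) = (\<Sum>j<Suc n. (if j < n then b1 j z else b2 z) * e j z)
          + (\<Sum>j<Suc n. (if j = 0 then 0 else b (j - 1) z) * e j z)"
        unfolding b'_def by (simp add: ring_distribs sum.distrib)
      moreover have "(\<Sum>j<Suc n. (if j = 0 then 0 else b (j - 1) z) * e j z) = (\<Sum>j<n. b j z * e (Suc j) z)"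
        by (subst sum.lessThan_Suc_shift) simp
      ultimately show ?thesis by simp
    qed
    finally show "conn_pow \<phi> k (Suc n) F z $ i =
        (conn_pow \<psi> k (Suc n) F z + (\<Sum>j<Suc n. b' j z *s conn_pow \<psi> k j F z)) $ i"
      by (simp add: e_def)
  qed
  ultimately show ?case by blast
qed

subsection \<open>Determinants\<close>

text \<open>The index type carries no order, so \<open>h\<close> provides one. A permutation with a
  nonzero product never raises \<open>h\<close>; as the sum of \<open>h\<close> is preserved, it
  preserves \<open>h\<close> everywhere and is the identity.\<close>

lemma det_unitriangular:
  fixes U :: "'a::comm_ring_1^'n^'n" and h :: "'n \<Rightarrow> nat"
  assumes h: "inj h" and diag: "\<And>i. U $ i $ i = 1"
    and tri: "\<And>i j. i \<noteq> j \<Longrightarrow> \<not> h j < h i \<Longrightarrow> U $ i $ j = 0"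
  shows "det U = 1"
proof -
  let ?p = "{p. p permutes (UNIV :: 'n set)}"
  have "(\<Prod>i\<in>UNIV. U $ i $ p i) = 0" if p: "p \<in> ?p - {id}" for p
  proof -
    have "\<exists>i. U $ i $ p i = 0"
    proof (rule ccontr)
      assume "\<nexists>i. U $ i $ p i = 0"
      then have le: "h (p i) \<le> h i" for i
        using tri[of i "p i"] by (metis le_refl less_imp_le)
      have "(\<Sum>i\<in>UNIV. h (p i)) = (\<Sum>i\<in>UNIV. h i)"
        using p by (intro sum.permute[symmetric, unfolded o_def]) auto
      then have "h (p i) = h i" for i
        by (rule sum_mono_inv) (use le in auto)
      then have "p = id" using h by (auto simp: inj_def)
      then show False using p by simp
    qed
    then show ?thesis by (simp add: prod_zero)
  qed
  moreover have "det U = (\<Sum>p\<in>{id}. of_int (sign p) * (\<Prod>i\<in>UNIV. U $ i $ p i))"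
    unfolding det_def
    by (rule sum.mono_neutral_right) (use calculation in \<open>auto simp: permutes_id\<close>)
  ultimately show ?thesis by (simp add: diag sign_id)
qed

lemma det_has_derivative:
  fixes A :: "complex \<Rightarrow> complex^'n^'n" and A' :: "complex^'n^'n"
  assumes "\<And>i j. ((\<lambda>w. A w $ i $ j) has_field_derivative A' $ i $ j) (at z)"
  shows "((\<lambda>w. det (A w)) has_field_derivative
    (\<Sum>i\<in>UNIV. det (\<chi> k. if k = i then A' $ i else A z $ k))) (at z)"
proof -
  let ?p = "{p. p permutes (UNIV :: 'n set)}"
  have "((\<lambda>w. det (A w)) has_field_derivative
     (\<Sum>p\<in>?p. of_int (sign p) * (\<Sum>i\<in>UNIV. A' $ i $ p i * (\<Prod>k\<in>UNIV-{i}. A z $ k $ p k)))) (at z)"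
    unfolding det_def
    by (intro DERIV_sum DERIV_cmult has_field_derivative_prod assms)
  also have "(\<Sum>p\<in>?p. of_int (sign p) * (\<Sum>i\<in>UNIV. A' $ i $ p i * (\<Prod>k\<in>UNIV-{i}. A z $ k $ p k)))
     = (\<Sum>p\<in>?p. \<Sum>i\<in>UNIV. of_int (sign p) *
          (\<Prod>k\<in>UNIV. (\<chi> k. if k = i then A' $ i else A z $ k) $ k $ p k))"
  proof (intro sum.cong refl)
    fix p
    have "(\<Prod>k\<in>UNIV. (\<chi> k. if k = i then A' $ i else A z $ k) $ k $ p k)
        = A' $ i $ p i * (\<Prod>k\<in>UNIV-{i}. A z $ k $ p k)" for i
      by (subst prod.remove[of _ i]) (auto intro!: prod.cong)
    then show "of_int (sign p) * (\<Sum>i\<in>UNIV. A' $ i $ p i * (\<Prod>k\<in>UNIV-{i}. A z $ k $ p k))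
       = (\<Sum>i\<in>UNIV. of_int (sign p) * (\<Prod>k\<in>UNIV. (\<chi> k. if k = i then A' $ i else A z $ k) $ k $ p k))"
      by (simp add: sum_distrib_left)
  qed
  also have "\<dots> = (\<Sum>i\<in>UNIV. det (\<chi> k. if k = i then A' $ i else A z $ k))"
    unfolding det_def by (rule sum.swap)
  finally show ?thesis .
qed

text \<open>Row \<open>i\<close> of \<open>X ** A z\<close> is a combination of the rows of
  \<open>A z\<close>; once it replaces row \<open>i\<close> in the determinant, only its diagonal
  coefficient survives. No inverse of \<open>A z\<close> is involved.\<close>

lemma liouville_formula:
  fixes A :: "complex \<Rightarrow> complex^'n^'n" and X :: "complex^'n^'n"
  assumes "\<And>i j. ((\<lambda>w. A w $ i $ j) has_field_derivative (X ** A z) $ i $ j) (at z)"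
  shows "((\<lambda>w. det (A w)) has_field_derivative trace X * det (A z)) (at z)"
proof -
  have "det (\<chi> k. if k = i then (X ** A z) $ i else A z $ k) = X $ i $ i * det (A z)" for i
  proof -
    have "(X ** A z) $ i = (\<Sum>j\<in>UNIV. (X $ i) $ j *s row j (A z))"
      by (simp add: vec_eq_iff matrix_matrix_mult_def row_def)
    then have "(\<chi> k. if k = i then (X ** A z) $ i else A z $ k) =
       (\<chi> k. if k = i then \<Sum>j\<in>UNIV. (X $ i) $ j *s row j (A z) else row k (A z))"
      by (simp add: vec_eq_iff row_def)
    then show ?thesis by (simp only: cramer_lemma_transpose)
  qed
  then show ?thesis
    using det_has_derivative[of A "X ** A z", OF assms] by (simp add: trace_def sum_distrib_right)
qed

text \<open>All derivatives of a solution vanish at a common zero, so that no existence theory is needed.\<close>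

lemma linear_ode_unique:
  fixes u :: "'n::finite \<Rightarrow> complex \<Rightarrow> complex"
  assumes u: "\<And>i. u i holomorphic_on HH" and X: "\<And>i j. X i j holomorphic_on HH"
    and ode: "\<And>i z. z \<in> HH \<Longrightarrow> deriv (u i) z = (\<Sum>j\<in>UNIV. X i j z * u j z)"
    and z0: "z0 \<in> HH" "\<And>i. u i z0 = 0" and z: "z \<in> HH"
  shows "u i z = 0"
proof -
  \<comment> \<open>All orders up to \<open>n\<close> are carried along because the Leibniz rule for
    \<open>X i j * u j\<close> involves every one of them.\<close>
  have "\<forall>m\<le>n. \<forall>i. (deriv ^^ m) (u i) z0 = 0" for n
  proof (induction n)
    case 0
    then show ?case using z0 by simp
  next
    case (Suc n)
    have "(deriv ^^ Suc n) (u i) z0 = 0" for i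
    proof -
      have "(deriv ^^ Suc n) (u i) z0 = (deriv ^^ n) (deriv (u i)) z0"
        by (simp only: funpow_Suc_right o_def)
      also have "\<dots> = (deriv ^^ n) (\<lambda>w. \<Sum>j\<in>UNIV. X i j w * u j w) z0"
        by (rule higher_deriv_transform_within_open[where S = HH])
           (use u X z0 open_HH ode in \<open>auto intro!: holomorphic_intros\<close>)
      also have "\<dots> = (\<Sum>j\<in>UNIV. (deriv ^^ n) (\<lambda>w. X i j w * u j w) z0)"
      proof -
        have "(deriv ^^ n) (\<lambda>w. \<Sum>j\<in>A. X i j w * u j w) z0 = (\<Sum>j\<in>A. (deriv ^^ n) (\<lambda>w. X i j w * u j w) z0)"
          if "finite A" for A
          using that
        proof induction
          case (insert a A)
          have "(deriv ^^ n) (\<lambda>w. X i a w * u a w + (\<Sum>j\<in>A. X i j w * u j w)) z0 =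
             (deriv ^^ n) (\<lambda>w. X i a w * u a w) z0 + (deriv ^^ n) (\<lambda>w. \<Sum>j\<in>A. X i j w * u j w) z0"
            by (rule higher_deriv_add[where S = HH])
               (use u X z0 open_HH in \<open>auto intro!: holomorphic_intros\<close>)
          then show ?case using insert by simp
        qed simp
        then show ?thesis by simp
      qed
      also have "\<dots> = 0"
      proof (rule sum.neutral, rule ballI)
        fix j
        show "(deriv ^^ n) (\<lambda>w. X i j w * u j w) z0 = 0"
          using Suc.IH by (simp add: higher_deriv_mult[OF X u open_HH z0(1)])
      qed
      finally show ?thesis .
    qed
    then show ?case using Suc.IH by (metis le_Suc_eq)
  qed
  then have "(deriv ^^ n) (u i) z0 = 0" for n by blast
  then show ?thesis
    by (rule holomorphic_fun_eq_0_on_connected[OF u open_HH connected_HH _ z0(1) z])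
qed

subsection \<open>The Wronskian\<close>

text \<open>Rows are indexed by the type \<open>'n\<close> of the components, so that
  \<open>det\<close> applies; \<open>h\<close> tells which order of derivative stands in which
  row.\<close>

definition wmat :: "(complex \<Rightarrow> complex) \<Rightarrow> real \<Rightarrow> ('n \<Rightarrow> nat) \<Rightarrow> (complex \<Rightarrow> complex^'n) \<Rightarrow> complex \<Rightarrow> complex^'n^'n" where
  "wmat \<phi> k h F z = (\<chi> j. conn_pow \<phi> k (h j) F z)"

text \<open>By \<open>conn_pow_compare\<close> a change of connection adds to each row a combination
  of rows of lower order, that is, multiplies from the left by a unitriangular matrix.\<close>

lemma wmat_det_independent:
  fixes F :: "complex \<Rightarrow> complex^'n"
  assumes h: "bij_betw h UNIV {..<CARD('n)}"
    and \<phi>: "\<phi> holomorphic_on HH" and \<psi>: "\<psi> holomorphic_on HH" and F: "vholo F" and z: "z \<in> HH"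
  shows "det (wmat \<phi> k h F z) = det (wmat \<psi> k h F z)"
proof -
  have "\<exists>b. \<forall>n. \<forall>z\<in>HH. conn_pow \<phi> k n F z =
      conn_pow \<psi> k n F z + (\<Sum>j<n. b n j z *s conn_pow \<psi> k j F z)"
    using conn_pow_compare[OF \<phi> \<psi> F] by metis
  then obtain b where b: "\<And>n. conn_pow \<phi> k n F z =
      conn_pow \<psi> k n F z + (\<Sum>j<n. b n j z *s conn_pow \<psi> k j F z)"
    using z by blast
  define U :: "complex^'n^'n" where
    "U = (\<chi> i j. if i = j then 1 else if h j < h i then b (h i) (h j) z else 0)"
  have "wmat \<phi> k h F z = U ** wmat \<psi> k h F z"
  proof -
    have "conn_pow \<phi> k (h i) F z $ l = (U ** wmat \<psi> k h F z) $ i $ l" for i l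
    proof -
      have bij: "bij_betw h {j. h j < h i} {..<h i}"
        unfolding bij_betw_def
      proof
        show "inj_on h {j. h j < h i}" using h inj_on_subset by (auto simp: bij_betw_def)
        show "h ` {j. h j < h i} = {..<h i}"
        proof (intro equalityI subsetI)
          fix m assume m: "m \<in> {..<h i}"
          have "h i < CARD('n)" using h by (auto simp: bij_betw_def)
          then have "m \<in> h ` UNIV" using m h by (auto simp: bij_betw_def)
          then show "m \<in> h ` {j. h j < h i}" using m by auto
        qed auto
      qed
      have "(\<Sum>j\<in>UNIV. U $ i $ j * conn_pow \<psi> k (h j) F z $ l)
          = conn_pow \<psi> k (h i) F z $ l + (\<Sum>j\<in>UNIV-{i}. U $ i $ j * conn_pow \<psi> k (h j) F z $ l)"
        by (subst sum.remove[of _ i]) (auto simp: U_def)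
      also have "(\<Sum>j\<in>UNIV-{i}. U $ i $ j * conn_pow \<psi> k (h j) F z $ l)
          = (\<Sum>j\<in>{j. h j < h i}. b (h i) (h j) z * conn_pow \<psi> k (h j) F z $ l)"
        by (rule sum.mono_neutral_cong_right) (auto simp: U_def)
      also have "\<dots> = (\<Sum>j<h i. b (h i) j z * conn_pow \<psi> k j F z $ l)"
        by (rule sum.reindex_bij_betw[OF bij])
      finally show ?thesis
        by (simp add: b[of "h i"] matrix_matrix_mult_def wmat_def)
    qed
    then show ?thesis by (simp add: vec_eq_iff wmat_def)
  qed
  moreover have "det U = 1"
    by (rule det_unitriangular[of h]) (use h in \<open>auto simp: U_def bij_betw_def\<close>)
  ultimately show ?thesis by (simp add: det_mul)
qed

lemma det_rows_image:
  fixes R :: "'a::comm_ring_1^'n^'n" and X :: "'n \<Rightarrow> 'a^'n"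
  shows "det (\<chi> j. c j *s (R *v X j)) = (\<Prod>j\<in>UNIV. c j) * det R * det (\<chi> j. X j)"
proof -
  have "(\<chi> j. R *v X j) = (\<chi> j. X j) ** transpose R"
    by (simp add: vec_eq_iff matrix_matrix_mult_def matrix_vector_mult_def transpose_def mult.commute)
  then show ?thesis
    by (simp add: det_rows_mul det_mul mult_ac)
qed

lemma wmat_det_slash:
  fixes F :: "complex \<Rightarrow> complex^'n"
  assumes h: "bij_betw h UNIV {..<CARD('n)}" and g: "g \<in> SL2Z"
    and \<phi>: "\<phi> holomorphic_on HH" and F: "vholo F" and z: "z \<in> HH"
    and eq: "\<And>z. z \<in> HH \<Longrightarrow> F (moeb g z) = (a * jfac g z powr of_real k) *s (R *v F z)"
  shows "det (wmat \<phi> k h F (moeb g z)) =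
    jfac g z powr of_real (\<Sum>j\<in>UNIV. k + 2 * real (h j)) * (a ^ CARD('n) * det R * det (wmat \<phi> k h F z))"
proof -
  have "det (wmat \<phi> k h F (moeb g z)) =
      det (\<chi> j. (a * jfac g z powr of_real (k + 2 * real (h j))) *s (R *v conn_pow (pull g \<phi>) k (h j) F z))"
    unfolding wmat_def using conn_pow_slash[OF g \<phi> F F eq z] by simp
  also have "\<dots> = (\<Prod>j\<in>UNIV. a * jfac g z powr of_real (k + 2 * real (h j))) * det R * det (wmat (pull g \<phi>) k h F z)"
    unfolding wmat_def by (rule det_rows_image)
  also have "det (wmat (pull g \<phi>) k h F z) = det (wmat \<phi> k h F z)"
    by (rule wmat_det_independent[OF h pull_holomorphic[OF \<phi> g] \<phi> F z])
  also have "(\<Prod>j\<in>UNIV. a * jfac g z powr of_real (k + 2 * real (h j)))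
      = a ^ CARD('n) * jfac g z powr of_real (\<Sum>j\<in>UNIV. k + 2 * real (h j))"
    unfolding prod.distrib of_real_sum powr_sum[OF jfac_nonzero[OF g z]] by simp
  finally show ?thesis by (simp add: mult_ac)
qed

definition mlde_system :: "(complex \<Rightarrow> complex) \<Rightarrow> real \<Rightarrow> (nat \<Rightarrow> complex \<Rightarrow> complex) \<Rightarrow> (complex \<Rightarrow> complex^'n) \<Rightarrow> bool" where
  "mlde_system \<phi> k C F \<longleftrightarrow> vholo F \<and> \<phi> holomorphic_on HH \<and> (\<forall>m. C m holomorphic_on HH) \<and>
     (\<forall>z\<in>HH. C (CARD('n) - 1) z = 0) \<and>
     (\<forall>z\<in>HH. conn_pow \<phi> k CARD('n) F z = (\<Sum>m<CARD('n). C m z *s conn_pow \<phi> k m F z))"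

text \<open>The companion matrix for the plain derivative rather than for D: solving
  \<open>D e = ...\<close> for \<open>deriv e\<close> brings in the factor 2 pi i and moves the
  connection terms to the diagonal.\<close>

definition companion :: "(complex \<Rightarrow> complex) \<Rightarrow> real \<Rightarrow> (nat \<Rightarrow> complex \<Rightarrow> complex) \<Rightarrow> ('n \<Rightarrow> nat) \<Rightarrow> complex \<Rightarrow> complex^'n^'n" where
  "companion \<phi> k C h z = (\<chi> i j. 2 * of_real pi * \<i> *
     ((if h j = Suc (h i) then 1 else 0) + (if Suc (h i) = CARD('n) then C (h j) z else 0)
       - (if i = j then of_real (k + 2 * real (h i)) * \<phi> z else 0)))"

lemma wmat_ode:
  fixes F :: "complex \<Rightarrow> complex^'n"
  assumes h: "bij_betw h UNIV {..<CARD('n)}" and sys: "mlde_system \<phi> k C F" and z: "z \<in> HH"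
  shows "((\<lambda>w. wmat \<phi> k h F w $ i $ l) has_field_derivative
     (companion \<phi> k C h z ** wmat \<phi> k h F z) $ i $ l) (at z)"
proof -
  let ?p = "2 * of_real pi * \<i> :: complex"
  define e where "e m w = conn_pow \<phi> k m F w $ l" for m w
  have e: "e m holomorphic_on HH" for m
    using sys conn_pow_vholo[of F \<phi> k m] unfolding e_def [abs_def] mlde_system_def vholo_def by blast
  have e_Suc: "deriv (e m) z = ?p * (e (Suc m) z - of_real (k + 2 * real m) * \<phi> z * e m z)" for m
    by (simp add: e_def [abs_def] conn_def)
  have top: "e CARD('n) z = (\<Sum>m<CARD('n). C m z * e m z)"
    using sys z by (simp add: mlde_system_def e_def)
  have inj: "inj h" using h by (simp add: bij_betw_def)
  have hi: "h i < CARD('n)" using h by (auto simp: bij_betw_def)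
  have s1: "(\<Sum>j\<in>UNIV. (if h j = Suc (h i) then 1 else 0) * e (h j) z)
        + (\<Sum>j\<in>UNIV. (if Suc (h i) = CARD('n) then C (h j) z else 0) * e (h j) z) = e (Suc (h i)) z"
  proof (cases "Suc (h i) = CARD('n)")
    case True
    have "h j < CARD('n)" for j using h by (auto simp: bij_betw_def)
    then have "h j \<noteq> CARD('n)" for j using less_irrefl by metis
    moreover have "(\<Sum>j\<in>UNIV. C (h j) z * e (h j) z) = (\<Sum>m<CARD('n). C m z * e m z)"
      by (rule sum.reindex_bij_betw[OF h])
    ultimately show ?thesis using True top by simp
  next
    case False
    then have "Suc (h i) \<in> h ` UNIV" using hi h by (auto simp: bij_betw_def)
    then obtain i' where i': "h i' = Suc (h i)" by auto
    have "(\<Sum>j\<in>UNIV. (if h j = Suc (h i) then 1 else 0) * e (h j) z) = (\<Sum>j\<in>UNIV. if j = i' then e (h i') z else 0)"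
      by (rule sum.cong) (use i' inj in \<open>auto simp: inj_def\<close>)
    then show ?thesis using False i' by simp
  qed
  have "(companion \<phi> k C h z ** wmat \<phi> k h F z) $ i $ l
      = (\<Sum>j\<in>UNIV. ?p * ((if h j = Suc (h i) then 1 else 0) * e (h j) z
          + (if Suc (h i) = CARD('n) then C (h j) z else 0) * e (h j) z
          - (if j = i then of_real (k + 2 * real (h i)) * \<phi> z * e (h i) z else 0)))"
    unfolding matrix_matrix_mult_def companion_def wmat_def e_def
    by (auto intro!: sum.cong simp: algebra_simps)
  also have "\<dots> = ?p * (e (Suc (h i)) z - of_real (k + 2 * real (h i)) * \<phi> z * e (h i) z)"
    unfolding sum_distrib_left[symmetric] sum_subtractf sum.distrib s1 by simp
  finally have "(companion \<phi> k C h z ** wmat \<phi> k h F z) $ i $ l = deriv (e (h i)) z"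
    by (simp add: e_Suc)
  moreover have "(\<lambda>w. wmat \<phi> k h F w $ i $ l) = e (h i)"
    by (simp add: wmat_def e_def fun_eq_iff)
  ultimately show ?thesis using holomorphic_HH_deriv[OF e z] by simp
qed

text \<open>In the trace of the companion matrix the shift entries are off the diagonal and the last
  coefficient is \<open>C (CARD('n) - 1) = 0\<close>, so only the connection terms remain and their
  weights add up.\<close>

lemma wmat_det_ode:
  fixes F :: "complex \<Rightarrow> complex^'n"
  assumes h: "bij_betw h UNIV {..<CARD('n)}" and sys: "mlde_system \<phi> k C F" and z: "z \<in> HH"
  shows "((\<lambda>w. det (wmat \<phi> k h F w)) has_field_derivative
     - (2 * of_real pi * \<i> * of_real (\<Sum>j\<in>UNIV. k + 2 * real (h j)) * \<phi> z) * det (wmat \<phi> k h F z)) (at z)"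
proof -
  have "trace (companion \<phi> k C h z) = - (2 * of_real pi * \<i> * of_real (\<Sum>j\<in>UNIV. k + 2 * real (h j)) * \<phi> z)"
  proof -
    have "(if Suc (h i) = CARD('n) then C (h i) z else 0) = 0" for i
    proof (cases "Suc (h i) = CARD('n)")
      case True
      then have "h i = CARD('n) - 1" by simp
      then show ?thesis using sys z by (simp add: mlde_system_def)
    qed simp
    then have "trace (companion \<phi> k C h z) =
        (\<Sum>i\<in>UNIV. - (2 * of_real pi * \<i> * \<phi> z) * of_real (k + 2 * real (h i)))"
      unfolding trace_def companion_def by (intro sum.cong) (auto simp: mult_ac)
    also have "\<dots> = - (2 * of_real pi * \<i> * \<phi> z) * of_real (\<Sum>i\<in>UNIV. k + 2 * real (h i))"
      by (simp only: sum_distrib_left of_real_sum)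
    finally show ?thesis by (simp only: mult_ac mult_minus_left mult_minus_right)
  qed
  then show ?thesis
    using liouville_formula[of "wmat \<phi> k h F" "companion \<phi> k C h z" z, OF wmat_ode[OF h sys z]] by simp
qed

text \<open>A kernel vector at one point is a combination of the components of \<open>F\<close>
  whose derivatives of all orders below \<open>CARD('n)\<close> vanish there. They solve the
  companion system, hence vanish identically, against independence.\<close>

lemma wmat_det_nonzero:
  fixes F :: "complex \<Rightarrow> complex^'n"
  assumes h: "bij_betw h UNIV {..<CARD('n)}" and sys: "mlde_system \<phi> k C F"
    and indep: "\<And>c. (\<And>z. z \<in> HH \<Longrightarrow> (\<Sum>i\<in>UNIV. c i * F z $ i) = 0) \<Longrightarrow> (\<forall>i. c i = 0)"
    and z: "z \<in> HH"
  shows "det (wmat \<phi> k h F z) \<noteq> 0"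
proof
  assume "det (wmat \<phi> k h F z) = 0"
  then have "\<not> invertible (wmat \<phi> k h F z)" by (simp add: invertible_det_nz)
  then obtain c where c: "c \<noteq> 0" "wmat \<phi> k h F z *v c = 0"
    using matrix_left_invertible_ker[of "wmat \<phi> k h F z"] invertible_left_inverse by blast
  define u where "u j w = (wmat \<phi> k h F w *v c) $ j" for j w
  have C: "C m holomorphic_on HH" for m using sys by (simp add: mlde_system_def)
  have \<phi>: "\<phi> holomorphic_on HH" using sys by (simp add: mlde_system_def)
  have der: "(u j has_field_derivative (\<Sum>i\<in>UNIV. companion \<phi> k C h w $ j $ i * u i w)) (at w)"
    if w: "w \<in> HH" for j w
  proof -
    have "(u j has_field_derivative ((companion \<phi> k C h w ** wmat \<phi> k h F w) *v c) $ j) (at w)"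
      unfolding u_def [abs_def] matrix_vector_mult_def vec_lambda_beta
      by (intro DERIV_sum DERIV_cmult_right wmat_ode[OF h sys w])
    also have "((companion \<phi> k C h w ** wmat \<phi> k h F w) *v c) $ j
        = (companion \<phi> k C h w *v (wmat \<phi> k h F w *v c)) $ j"
      by (simp add: matrix_vector_mul_assoc)
    also have "\<dots> = (\<Sum>i\<in>UNIV. companion \<phi> k C h w $ j $ i * u i w)"
      by (simp add: u_def matrix_vector_mult_def)
    finally show ?thesis .
  qed
  have u0: "u j w = 0" if w: "w \<in> HH" for j w
  proof (rule linear_ode_unique[where X = "\<lambda>i j z. companion \<phi> k C h z $ i $ j" and z = w and ?z0.0 = z])
    show "u i holomorphic_on HH" for i
      using der holomorphic_on_open[OF open_HH] by blast
    show "(\<lambda>z. companion \<phi> k C h z $ i $ j) holomorphic_on HH" for i j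
      unfolding companion_def vec_lambda_beta
      by (cases "i = j"; cases "h j = Suc (h i)"; cases "Suc (h i) = CARD('n)")
         (auto intro!: holomorphic_intros C \<phi>)
    show "deriv (u i) w = (\<Sum>j\<in>UNIV. companion \<phi> k C h w $ i $ j * u j w)" if "w \<in> HH" for i w
      using DERIV_imp_deriv[OF der[OF that]] .
    show "u i z = 0" for i using c by (simp add: u_def)
  qed (use z w in auto)
  have "0 \<in> h ` UNIV" using h by (auto simp: bij_betw_def)
  then obtain j where j: "h j = 0" by auto
  have "(\<Sum>i\<in>UNIV. c $ i * F w $ i) = 0" if "w \<in> HH" for w
    using u0[OF that, of j] by (simp add: u_def wmat_def matrix_vector_mult_def j mult.commute)
  then have "\<forall>i. c $ i = 0" by (rule indep[of "\<lambda>i. c $ i"])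
  then show False using c by (simp add: vec_eq_iff)
qed

text \<open>The Wronskian is modular of weight \<open>\<kappa> = \<Sum>\<^sub>j (k + 2 j)\<close> up to a constant, and its logarithmic derivative is
  proportional to \<open>\<phi>\<close>. This forces the quasi-modular transformation law of \<open>\<phi>\<close>.\<close>

lemma pull_eq_self:
  fixes F :: "complex \<Rightarrow> complex^'n" and h :: "'n \<Rightarrow> nat"
  assumes h: "bij_betw h UNIV {..<CARD('n)}" and sys: "mlde_system \<phi> k C F"
    and indep: "\<And>c. (\<And>z. z \<in> HH \<Longrightarrow> (\<Sum>i\<in>UNIV. c i * F z $ i) = 0) \<Longrightarrow> (\<forall>i. c i = 0)"
    and g: "g \<in> SL2Z" and z: "z \<in> HH" and \<kappa>: "(\<Sum>j\<in>UNIV. k + 2 * real (h j)) \<noteq> 0"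
    and eq: "\<And>z. z \<in> HH \<Longrightarrow> F (moeb g z) = (a * jfac g z powr of_real k) *s (R *v F z)"
    and a: "a \<noteq> 0" and R: "invertible R"
  shows "pull g \<phi> z = \<phi> z"
proof -
  let ?W = "\<lambda>z. det (wmat \<phi> k h F z)" and ?K = "\<Sum>j\<in>UNIV. k + 2 * real (h j)"
  define A where "A = a ^ CARD('n) * det R"
  have A: "A \<noteq> 0" using a R by (simp add: A_def invertible_det_nz)
  have F: "vholo F" and \<phi>: "\<phi> holomorphic_on HH" using sys by (auto simp: mlde_system_def)
  have W: "?W holomorphic_on HH"
    using wmat_det_ode[OF h sys] holomorphic_on_open[OF open_HH] by blast
  have c0: "conn \<phi> ?K ?W w = 0" if "w \<in> HH" for w
    using DERIV_imp_deriv[OF wmat_det_ode[OF h sys that]] by (simp add: conn_def)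
  have "conn \<phi> ?K ?W (moeb g z) = jfac g z powr of_real (?K + 2) * conn (pull g \<phi>) ?K (\<lambda>z. A * ?W z) z"
    by (rule conn_slash[OF g z W])
       (use W wmat_det_slash[OF h g \<phi> F _ eq] in \<open>auto intro!: holomorphic_intros simp: A_def\<close>)
  also have "conn \<phi> ?K ?W (moeb g z) = 0" by (rule c0[OF moeb_in_HH[OF g z]])
  also have "conn (pull g \<phi>) ?K (\<lambda>z. A * ?W z) z = A * conn (pull g \<phi>) ?K ?W z"
    using conn_linear[OF z, of "{()}" "\<lambda>_. ?W" _ _ "\<lambda>_. A"] W by simp
  finally have "conn (pull g \<phi>) ?K ?W z = conn \<phi> ?K ?W z"
    using A jfac_nonzero[OF g z] c0[OF z] by simp
  \<comment> \<open>The two connections applied to the Wronskian differ by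
    \<open>?K * (pull g \<phi> z - \<phi> z) * ?W z\<close>, and neither \<open>?K\<close> nor
    \<open>?W z\<close> is zero.\<close>
  then show ?thesis
    using \<kappa> wmat_det_nonzero[OF h sys indep z] by (simp add: conn_def flip: of_real_sum)
qed

subsection \<open>Moderate growth\<close>

lemma moderate_growth_ex:
  assumes "moderate_growth f"
  shows "\<exists>c N. c \<ge> 1 \<and> (\<forall>z. Im z > c \<longrightarrow> norm (f z) \<le> Im z ^ N)"
proof -
  obtain N c where "\<And>z. Im z > c \<Longrightarrow> norm (f z) \<le> Im z ^ N"
    using assms by (auto simp: moderate_growth_def)
  then show ?thesis by (intro exI[of _ "max c 1"] exI[of _ N]) auto
qed

lemma moderate_growth_mult:
  assumes "moderate_growth f" "moderate_growth g"
  shows "moderate_growth (\<lambda>z. f z * g z)"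
proof -
  obtain c N where f: "c \<ge> 1" "\<And>z. Im z > c \<Longrightarrow> norm (f z) \<le> Im z ^ N"
    using moderate_growth_ex[OF assms(1)] by blast
  obtain d M where g: "d \<ge> 1" "\<And>z. Im z > d \<Longrightarrow> norm (g z) \<le> Im z ^ M"
    using moderate_growth_ex[OF assms(2)] by blast
  show ?thesis
    unfolding moderate_growth_def
  proof (intro exI allI impI)
    fix z assume "max c d < Im z"
    then show "norm (f z * g z) \<le> Im z ^ (N + M)"
      using f g by (auto simp: norm_mult power_add intro!: mult_mono)
  qed
qed

lemma moderate_growth_cmult:
  assumes "moderate_growth f"
  shows "moderate_growth (\<lambda>z. a * f z)"
  using bounded_at_infinity_imp_moderate_growth[of 0 "\<lambda>_. a" "norm a"] assms
  by (intro moderate_growth_mult) auto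

lemma moderate_growth_add:
  assumes "moderate_growth f" "moderate_growth g"
  shows "moderate_growth (\<lambda>z. f z + g z)"
proof -
  obtain c N where f: "c \<ge> 1" "\<And>z. Im z > c \<Longrightarrow> norm (f z) \<le> Im z ^ N"
    using moderate_growth_ex[OF assms(1)] by blast
  obtain d M where g: "d \<ge> 1" "\<And>z. Im z > d \<Longrightarrow> norm (g z) \<le> Im z ^ M"
    using moderate_growth_ex[OF assms(2)] by blast
  show ?thesis
    unfolding moderate_growth_def
  proof (intro exI allI impI)
    fix z assume z: "max (max c d) 2 < Im z"
    have "norm (f z + g z) \<le> Im z ^ N + Im z ^ M"
      using f(2)[of z] g(2)[of z] z norm_triangle_ineq[of "f z" "g z"] by simp
    also have "\<dots> \<le> 2 * Im z ^ (N + M)"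
    proof -
      have "Im z ^ N \<le> Im z ^ (N + M)" "Im z ^ M \<le> Im z ^ (N + M)"
        using z by (auto intro!: power_increasing)
      then show ?thesis by linarith
    qed
    also have "\<dots> \<le> Im z * Im z ^ (N + M)"
      using z by (intro mult_right_mono) auto
    finally show "norm (f z + g z) \<le> Im z ^ Suc (N + M)" by simp
  qed
qed

lemma moderate_growth_sum:
  assumes "\<And>i. i \<in> A \<Longrightarrow> moderate_growth (f i)"
  shows "moderate_growth (\<lambda>z. \<Sum>i\<in>A. f i z)"
  using assms
proof (induction A rule: infinite_finite_induct)
  case (insert x A)
  then show ?case by (auto intro!: moderate_growth_add)
qed (use bounded_at_infinity_imp_moderate_growth[of 0 "\<lambda>_. 0" 0] in auto)

lemma moderate_growth_cong:
  assumes "\<And>z. z \<in> HH \<Longrightarrow> f z = g z" "moderate_growth f"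
  shows "moderate_growth g"
proof -
  obtain c N where f: "c \<ge> 1" "\<And>z. Im z > c \<Longrightarrow> norm (f z) \<le> Im z ^ N"
    using moderate_growth_ex[OF assms(2)] by blast
  have "norm (g z) \<le> Im z ^ N" if "Im z > c" for z
    using assms(1)[of z] f(1) f(2)[of z] that by (simp add: HH_def)
  then show ?thesis unfolding moderate_growth_def by blast
qed

text \<open>Cauchy's inequality on the disc of radius 1, on which imaginary parts at most double.
  Since \<open>Im z > 2\<close>, the factor 2 is absorbed by doubling the exponent.\<close>

lemma moderate_growth_deriv:
  assumes holo: "f holomorphic_on HH" and "moderate_growth f"
  shows "moderate_growth (deriv f)"
proof -
  obtain c N where f: "c \<ge> 1" "\<And>z. Im z > c \<Longrightarrow> norm (f z) \<le> Im z ^ N"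
    using moderate_growth_ex[OF assms(2)] by blast
  show ?thesis
    unfolding moderate_growth_def
  proof (intro exI allI impI)
    fix z assume z: "c + 1 < Im z"
    have near: "Im w > c \<and> Im w < 2 * Im z" if "norm (z - w) \<le> 1" for w
      using abs_Im_le_cmod[of "z - w"] that z f(1) by auto
    have sub: "cball z 1 \<subseteq> HH"
      using near f(1) by (force simp: HH_def dist_norm)
    have "norm ((deriv ^^ 1) f z) \<le> fact 1 * (2 * Im z) ^ N / 1 ^ 1"
    proof (rule Cauchy_inequality)
      show "f holomorphic_on ball z 1" using holo sub holomorphic_on_subset ball_subset_cball by blast
      show "continuous_on (cball z 1) f"
        using holo sub holomorphic_on_subset holomorphic_on_imp_continuous_on by blast
      fix w assume "norm (z - w) = 1"
      with near[of w] have w: "Im w > c" "Im w < 2 * Im z" by auto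
      have "norm (f w) \<le> Im w ^ N" using f(2) w by simp
      also have "\<dots> \<le> (2 * Im z) ^ N" using w f(1) by (intro power_mono) auto
      finally show "norm (f w) \<le> (2 * Im z) ^ N" .
    qed simp
    also have "fact 1 * (2 * Im z) ^ N / 1 ^ 1 = (2 * Im z) ^ N" by simp
    also have "\<dots> \<le> (Im z * Im z) ^ N"
      using z f(1) by (intro power_mono mult_right_mono) auto
    finally show "norm (deriv f z) \<le> Im z ^ (2 * N)"
      by (simp add: power_mult power2_eq_square)
  qed
qed

subsection \<open>Spaces of modular forms\<close>

lemma MF_I:
  assumes "q_expansion f g" "\<And>z. z \<notin> HH \<Longrightarrow> f z = 0"
    and "\<And>g z. g \<in> SL2Z \<Longrightarrow> z \<in> HH \<Longrightarrow> f (moeb g z) = jfac g z powi k * f z"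
  shows "f \<in> MF k"
  using assms q_expansion_holomorphic q_expansion_moderate_growth by (auto simp: MF_def)

lemma MF_D:
  assumes "f \<in> MF k"
  shows "f holomorphic_on HH" "moderate_growth f" "\<And>z. z \<notin> HH \<Longrightarrow> f z = 0"
    "\<And>g z. g \<in> SL2Z \<Longrightarrow> z \<in> HH \<Longrightarrow> f (moeb g z) = jfac g z powi k * f z"
  using assms by (auto simp: MF_def)

lemma MF_q_expansion:
  assumes "f \<in> MF k"
  obtains g where "q_expansion f g"
proof (rule periodic_moderate_imp_q_expansion)
  show "f (z + 1) = f z" if "z \<in> HH" for z
    using MF_D(4)[OF assms Tmat_in that] by (simp add: moeb_T jfac_T)
qed (use MF_D[OF assms] that in auto)

lemma MF_mult:
  assumes "f \<in> MF j" "g \<in> MF k"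
  shows "(\<lambda>z. f z * g z) \<in> MF (j + k)"
  using MF_D[OF assms(1)] MF_D[OF assms(2)] jfac_nonzero
  by (auto simp: MF_def power_int_add mult_ac intro!: holomorphic_intros moderate_growth_mult)

lemma MF_add:
  assumes "f \<in> MF k" "g \<in> MF k"
  shows "(\<lambda>z. f z + g z) \<in> MF k"
  using MF_D[OF assms(1)] MF_D[OF assms(2)]
  by (auto simp: MF_def ring_distribs intro!: holomorphic_intros moderate_growth_add)

lemma MF_cmult:
  assumes "f \<in> MF k"
  shows "(\<lambda>z. a * f z) \<in> MF k"
  using MF_D[OF assms]
  by (auto simp: MF_def intro!: holomorphic_intros moderate_growth_cmult)

lemma MF_0: "(\<lambda>z. 0) \<in> MF k"
proof -
  have "moderate_growth (\<lambda>z. 0)"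
    by (rule bounded_at_infinity_imp_moderate_growth[of 0 _ 0]) simp
  then show ?thesis by (simp add: MF_def)
qed

lemma MF_sum:
  "(\<And>i. i \<in> A \<Longrightarrow> f i \<in> MF k) \<Longrightarrow> (\<lambda>z. \<Sum>i\<in>A. f i z) \<in> MF k"
  by (induction A rule: infinite_finite_induct) (auto intro: MF_0 MF_add)

lemma MF_power:
  assumes "f \<in> MF k"
  shows "(\<lambda>z. f z ^ Suc n) \<in> MF (int (Suc n) * k)"
proof (induction n)
  case (Suc n)
  then show ?case using MF_mult[OF assms Suc] by (simp add: algebra_simps)
qed (simp add: assms)

text \<open>The unit of the ring of modular forms, under the convention that forms vanish outside
  \<open>HH\<close>.\<close>

definition one_HH :: "complex \<Rightarrow> complex" where
  "one_HH z = (if z \<in> HH then 1 else 0)"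

lemma one_HH_expansion: "q_expansion one_HH (\<lambda>_. 1)"
  by (simp add: q_expansion_def one_HH_def)

lemma one_HH_MF: "one_HH \<in> MF 0"
  by (rule MF_I[OF one_HH_expansion]) (auto simp: one_HH_def moeb_in_HH)

subsection \<open>Generators and reduction theory of the modular group\<close>

lemma moeb_mmul:
  assumes "g \<in> SL2Z" "s \<in> SL2Z" "z \<in> HH"
  shows "moeb (mmul g s) z = moeb g (moeb s z)" "jfac (mmul g s) z = jfac g (moeb s z) * jfac s z"
proof -
  obtain a b c d where g: "g = (a, b, c, d)" by (cases g)
  obtain a' b' c' d' where s: "s = (a', b', c', d')" by (cases s)
  have nz: "of_int c' * z + of_int d' \<noteq> 0"
    using jfac_nonzero[OF assms(2,3)] by (simp add: s jfac_def)
  have nz2: "of_int c * ((of_int a' * z + of_int b') / (of_int c' * z + of_int d')) + of_int d \<noteq> 0"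
    using jfac_nonzero[OF assms(1) moeb_in_HH[OF assms(2,3)]] by (simp add: g s jfac_def moeb_def)
  show j: "jfac (mmul g s) z = jfac g (moeb s z) * jfac s z"
    using nz by (simp add: g s jfac_def mmul_def moeb_def field_simps)
  have "moeb g (moeb s z) = (of_int a * ((of_int a' * z + of_int b') / (of_int c' * z + of_int d')) + of_int b)
      / (of_int c * ((of_int a' * z + of_int b') / (of_int c' * z + of_int d')) + of_int d)"
    by (simp add: g s moeb_def)
  also have "\<dots> = ((of_int a * ((of_int a' * z + of_int b') / (of_int c' * z + of_int d')) + of_int b) * (of_int c' * z + of_int d'))
      / ((of_int c * ((of_int a' * z + of_int b') / (of_int c' * z + of_int d')) + of_int d) * (of_int c' * z + of_int d'))"
    using nz by simp
  also have "(of_int a * ((of_int a' * z + of_int b') / (of_int c' * z + of_int d')) + of_int b) * (of_int c' * z + of_int d')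
      = of_int (a * a' + b * c') * z + of_int (a * b' + b * d')"
    using nz by (simp add: field_simps)
  also have "(of_int c * ((of_int a' * z + of_int b') / (of_int c' * z + of_int d')) + of_int d) * (of_int c' * z + of_int d')
      = of_int (c * a' + d * c') * z + of_int (c * b' + d * d')"
    using nz by (simp add: field_simps)
  finally show "moeb (mmul g s) z = moeb g (moeb s z)"
    by (simp add: g s moeb_def mmul_def)
qed

lemma mmul_in_SL2Z:
  assumes "g \<in> SL2Z" "s \<in> SL2Z"
  shows "mmul g s \<in> SL2Z"
proof -
  obtain a b c d where g: "g = (a, b, c, d)" by (cases g)
  obtain a' b' c' d' where s: "s = (a', b', c', d')" by (cases s)
  have "(a * a' + b * c') * (c * b' + d * d') - (a * b' + b * d') * (c * a' + d * c') = (a * d - b * c) * (a' * d' - b' * c')"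
    by (simp add: algebra_simps)
  then show ?thesis using assms by (simp add: g s SL2Z_def mmul_def)
qed

text \<open>Euclid's algorithm on the first column.\<close>

lemma SL2Z_induct [consumes 1, case_names one S T]:
  assumes g: "g \<in> SL2Z"
    and one: "Q (1, 0, 0, 1)"
    and S: "\<And>g. g \<in> SL2Z \<Longrightarrow> Q g \<Longrightarrow> Q (mmul Smat g)"
    and T: "\<And>g n. g \<in> SL2Z \<Longrightarrow> Q g \<Longrightarrow> Q (mmul (1, n, 0, 1) g)"
  shows "Q g"
  using g
proof (induction "nat \<bar>lower_left g\<bar>" arbitrary: g rule: less_induct)
  case less
  obtain a b c d where g: "g = (a, b, c, d)" by (cases g)
  have det: "a * d - b * c = 1" using less.prems by (simp add: g SL2Z_def)
  have "(1, 0, 0, 1) \<in> SL2Z" by (simp add: SL2Z_def)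
  show ?case
  proof (cases "c = 0")
    case True
    then have "a * d = 1" using det by simp
    then consider "a = 1" "d = 1" | "a = -1" "d = -1" by (auto simp: zmult_eq_1_iff)
    then show ?thesis
    proof cases
      case 1
      then show ?thesis using T[OF \<open>(1, 0, 0, 1) \<in> SL2Z\<close> one, of b] True by (simp add: g mmul_def)
    next
      case 2
      have "Q (mmul Smat (mmul Smat (1, 0, 0, 1)))"
        using S[OF mmul_in_SL2Z[OF Smat_in \<open>(1, 0, 0, 1) \<in> SL2Z\<close>] S[OF \<open>(1, 0, 0, 1) \<in> SL2Z\<close> one]] .
      then have "Q (-1, 0, 0, -1)" by (simp add: mmul_def Smat_def)
      from T[OF _ this, of "-b"] show ?thesis using 2 True by (simp add: g mmul_def SL2Z_def)
    qed
  next
    case False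
    define q r where "q = a div c" and "r = a mod c"
    have a: "a = q * c + r" by (simp add: q_def r_def)
    have "\<bar>r\<bar> < \<bar>c\<bar>" using False by (simp add: r_def abs_mod_less)
    \<comment> \<open>This is \<open>Smat\<close> times the translation by \<open>- q\<close> times
      \<open>g\<close>. The induction rule offers no inverse of \<open>Smat\<close>, so it is undone
      by applying \<open>Smat\<close> three more times, \<open>Smat\<close> having order 4.\<close>
    define g1 where "g1 = (- c, - d, r, b - q * d)"
    have g1: "g1 \<in> SL2Z" using det by (simp add: g1_def SL2Z_def a algebra_simps)
    have "Q g1"
      by (rule less.hyps[OF _ g1]) (use \<open>\<bar>r\<bar> < \<bar>c\<bar>\<close> in \<open>simp add: g g1_def\<close>)
    have s1: "mmul Smat g1 \<in> SL2Z" "Q (mmul Smat g1)"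
      using g1 \<open>Q g1\<close> S mmul_in_SL2Z Smat_in by auto
    then have s2: "mmul Smat (mmul Smat g1) \<in> SL2Z" "Q (mmul Smat (mmul Smat g1))"
      using S mmul_in_SL2Z Smat_in by auto
    then have s3: "mmul Smat (mmul Smat (mmul Smat g1)) \<in> SL2Z" "Q (mmul Smat (mmul Smat (mmul Smat g1)))"
      using S mmul_in_SL2Z Smat_in by auto
    have "mmul (1, q, 0, 1) (mmul Smat (mmul Smat (mmul Smat g1))) = g"
      by (simp add: g g1_def mmul_def Smat_def a algebra_simps)
    then show ?thesis using T[OF s3, of q] by simp
  qed
qed

text \<open>Dirichlet approximation of \<open>Re z\<close> with denominators up to about \<open>1 / sqrt (Im z)\<close>.\<close>

lemma SL2Z_reduction:
  assumes z: "z \<in> HH"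
  obtains g where "g \<in> SL2Z" "Im (moeb g z) \<ge> 1 / 5"
proof (cases "Im z \<ge> 1")
  case True
  show ?thesis
    by (rule that[of "(1, 0, 0, 1)"]) (use True in \<open>auto simp: SL2Z_def moeb_def\<close>)
next
  case False
  define y where "y = Im z"
  have y: "0 < y" "y < 1" using z False by (auto simp: y_def HH_def)
  define s where "s = sqrt y"
  have s: "0 < s" "s < 1" "s\<^sup>2 = y" using y by (auto simp: s_def)
  \<comment> \<open>As \<open>N\<close> lies between \<open>1 / s\<close> and \<open>2 / s\<close>,
    the approximation \<open>h / k\<close> satisfies \<open>\<bar>k * Re z - h\<bar> \<le> s\<close>
    and \<open>k * y \<le> 2 * s\<close>. Their squares add up to at most \<open>5 * y\<close>,
    which is the origin of the bound 1/5.\<close>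
  define N where "N = nat \<lceil>1 / s\<rceil>"
  have "1 / s > 1" using s by simp
  then have N: "real N \<ge> 1 / s" "real N < 1 / s + 1" "N > 0"
    unfolding N_def by linarith+
  have "real N * s < 2" using N(2) s by (simp add: field_simps)
  obtain h k where hk: "coprime h k" "0 < k" "k \<le> int N" "\<bar>of_int k * Re z - of_int h\<bar> < 1 / real N"
    using Dirichlet_approx_coprime[OF N(3), of "Re z"] by blast
  obtain u w where "u * h + w * k = 1"
    using bezout_int[of h k] hk(1) by auto
  then have g: "(- u, - w, k, - h) \<in> SL2Z" by (simp add: SL2Z_def algebra_simps)
  have "1 / real N \<le> s" using N s by (simp add: field_simps)
  then have "\<bar>of_int k * Re z - of_int h\<bar> \<le> s" using hk(4) by linarith
  then have 1: "(of_int k * Re z - of_int h)\<^sup>2 \<le> y"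
    using s power_mono[of "\<bar>of_int k * Re z - of_int h\<bar>" s 2] by simp
  have "of_int k \<le> real N" using hk(3) by linarith
  then have "of_int k * s \<le> real N * s" using s by simp
  also have "real N * s < 2" by fact
  finally have "(of_int k * s)\<^sup>2 \<le> 2\<^sup>2"
    using hk(2) s by (intro power_mono) auto
  then have "(of_int k)\<^sup>2 * y \<le> 4" using s by (simp add: power_mult_distrib)
  then have 2: "(of_int k * y)\<^sup>2 \<le> 4 * y"
    using y mult_right_mono[of "(of_int k)\<^sup>2 * y" 4 y] by (simp add: power2_eq_square mult_ac)
  have "(norm (jfac (- u, - w, k, - h) z))\<^sup>2 = (of_int k * Re z - of_int h)\<^sup>2 + (of_int k * y)\<^sup>2"
    by (simp add: jfac_def cmod_power2 y_def)
  also have "\<dots> \<le> 5 * y" using 1 2 by simp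
  finally have le: "(norm (jfac (- u, - w, k, - h) z))\<^sup>2 \<le> 5 * y" .
  have "norm (jfac (- u, - w, k, - h) z) > 0" using jfac_nonzero[OF g z] by simp
  then have "1 / 5 \<le> Im (moeb (- u, - w, k, - h) z)"
    unfolding Im_moeb[OF g z] y_def[symmetric] using le by (simp add: field_simps)
  then show ?thesis using that g by blast
qed

section \<open>Constant terms and the maximum principle in weight 0\<close>

lemma q_expansion_continuous_at_0:
  assumes "q_expansion f g"
  shows "isCont g 0"
proof -
  have "g holomorphic_on ball 0 1" using assms by (simp add: q_expansion_def)
  then have "continuous_on (ball 0 1) g" by (rule holomorphic_on_imp_continuous_on)
  then show ?thesis by (simp add: continuous_on_eq_continuous_at)
qed

lemma q_expansion_zero:
  assumes "q_expansion f g" "\<And>z. z \<in> HH \<Longrightarrow> f z = 0"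
  shows "g 0 = 0"
proof -
  have "(\<lambda>n. norm (qexp (\<i> * of_nat (Suc n)))) \<longlonglongrightarrow> 0"
    unfolding norm_qexp by simp real_asymp
  then have "(\<lambda>n. qexp (\<i> * of_nat (Suc n))) \<longlonglongrightarrow> 0"
    by (rule tendsto_norm_zero_cancel)
  then have "(\<lambda>n. g (qexp (\<i> * of_nat (Suc n)))) \<longlonglongrightarrow> g 0"
    using q_expansion_continuous_at_0[OF assms(1)] isCont_tendsto_compose by blast
  moreover have "g (qexp (\<i> * of_nat (Suc n))) = 0" for n
  proof -
    have "\<i> * of_nat (Suc n) \<in> HH" by (simp add: HH_def)
    then show ?thesis using assms by (simp add: q_expansion_def)
  qed
  ultimately show ?thesis by (simp add: LIMSEQ_const_iff)
qed

lemma q_expansion_small_at_infinity: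
  assumes "q_expansion f g" "g 0 = 0" "\<epsilon> > 0"
  obtains Y where "Y \<ge> 1" "\<And>z. Im z > Y \<Longrightarrow> norm (f z) < \<epsilon>"
proof -
  obtain \<delta> where \<delta>: "\<delta> > 0" "\<And>w. norm w < \<delta> \<Longrightarrow> norm (g w) < \<epsilon>"
    using q_expansion_continuous_at_0[OF assms(1)] assms(2,3)
    unfolding continuous_at_eps_delta dist_norm by fastforce
  define Y where "Y = max 1 (- ln \<delta> / (2 * pi))"
  show ?thesis
  proof (rule that[of Y])
    fix z assume z: "Y < Im z"
    then have "- ln \<delta> < 2 * pi * Im z" by (simp add: Y_def field_simps)
    then have "norm (qexp z) < exp (ln \<delta>)" unfolding norm_qexp by (subst exp_less_cancel_iff) simp
    then have "norm (g (qexp z)) < \<epsilon>" using \<delta> by simp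
    moreover have "z \<in> HH" using z by (simp add: Y_def HH_def)
    ultimately show "norm (f z) < \<epsilon>" using assms(1) by (simp add: q_expansion_def)
  qed (simp add: Y_def)
qed

text \<open>Invariance moves every point into the compact box \<open>K\<close> or above height
  \<open>Y\<close>, where the modulus is already below its value at \<open>z\<close>. So the maximum
  of the modulus is attained, \<open>f\<close> is constant, and this contradicts the decay at
  infinity.\<close>

lemma MF_0_vanishing:
  assumes f: "f \<in> MF 0" and g: "q_expansion f g" "g 0 = 0"
  shows "f z = 0"
proof (rule ccontr)
  assume nz: "f z \<noteq> 0"
  then have z: "z \<in> HH" using MF_D(3)[OF f] by blast
  obtain Y where Y: "Y \<ge> 1" "\<And>w. Im w > Y \<Longrightarrow> norm (f w) < norm (f z)"
    using q_expansion_small_at_infinity[OF g, of "norm (f z)"] nz by auto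
  define K where "K = cbox (Complex (-1) (1/5)) (Complex 1 Y)"
  have K: "w \<in> K \<longleftrightarrow> \<bar>Re w\<bar> \<le> 1 \<and> 1/5 \<le> Im w \<and> Im w \<le> Y" for w
    by (auto simp: K_def in_cbox_complex_iff)
  have "K \<subseteq> HH" using K by (auto simp: HH_def)
  then have "continuous_on K f"
    using MF_D(1)[OF f] holomorphic_on_imp_continuous_on holomorphic_on_subset by blast
  then have cont: "continuous_on K (\<lambda>w. norm (f w))" by (rule continuous_on_norm)
  have "\<i> \<in> K" using Y(1) by (simp add: K)
  then obtain \<xi> where \<xi>: "\<xi> \<in> K" "\<And>w. w \<in> K \<Longrightarrow> norm (f w) \<le> norm (f \<xi>)"
    using continuous_attains_sup[OF _ _ cont] by (auto simp: K_def)
  have main: "norm (f w) \<le> norm (f \<xi>) \<or> norm (f w) < norm (f z)" if w: "w \<in> HH" for w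
  proof -
    obtain h where h: "h \<in> SL2Z" "Im (moeb h w) \<ge> 1 / 5" using SL2Z_reduction[OF w] .
    define u where "u = moeb h w + of_int (- \<lfloor>Re (moeb h w)\<rfloor>)"
    have "f (moeb h w) = f w" using MF_D(4)[OF f h(1) w] by simp
    moreover have "f u = f (moeb h w)"
      unfolding u_def
    proof (rule periodic_int[OF _ moeb_in_HH[OF h(1) w]])
      show "f (z + 1) = f z" if "z \<in> HH" for z
        using MF_D(4)[OF f Tmat_in that] by (simp add: moeb_T jfac_T)
    qed
    moreover have "norm (f u) \<le> norm (f \<xi>) \<or> norm (f u) < norm (f z)"
    proof (cases "Im u \<le> Y")
      case True
      have "\<bar>Re u\<bar> \<le> 1" unfolding u_def by simp linarith
      moreover have "1 / 5 \<le> Im u" using h(2) by (simp add: u_def)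
      ultimately have "u \<in> K" using True by (simp add: K)
      then show ?thesis using \<xi> by blast
    qed (use Y in auto)
    ultimately show ?thesis by simp
  qed
  have "norm (f z) \<le> norm (f \<xi>)" using main[OF z] by auto
  then have "norm (f w) \<le> norm (f \<xi>)" if "w \<in> HH" for w using main[OF that] by auto
  then have "f constant_on HH"
    using \<xi>(1) \<open>K \<subseteq> HH\<close>
    by (intro maximum_modulus_principle[OF MF_D(1)[OF f] open_HH connected_HH open_HH subset_refl]) auto
  then obtain c where c: "\<And>w. w \<in> HH \<Longrightarrow> f w = c" by (auto simp: constant_on_def)
  have "Im (\<i> * of_real (Y + 1)) > Y" by simp
  from Y(2)[OF this] have "norm (f (\<i> * of_real (Y + 1))) < norm (f z)" .
  moreover have "\<i> * of_real (Y + 1) \<in> HH" using Y(1) by (simp add: HH_def)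
  ultimately show False using c z by simp
qed

text \<open>With P = -E_2/12 this is Ramanujan's q dE_2/dq = (E_2^2 - E_4)/12 solved for E_4. The
  factor 144 makes the constant term 1.\<close>

definition E4 :: "complex \<Rightarrow> complex" where
  "E4 z = (if z \<in> HH then 144 * (deriv Pfun z / (2 * of_real pi * \<i>) + (Pfun z)\<^sup>2) else 0)"

definition E4_exp :: "complex \<Rightarrow> complex" where
  "E4_exp w = 144 * (w * deriv P_exp w + P_exp w ^ 2)"

text \<open>Ramanujan's q dE_4/dq = (E_2 E_4 - E_6)/3 solved for E_6; the factor -3 again normalises
  the constant term to 1.\<close>

definition E6 :: "complex \<Rightarrow> complex" where
  "E6 z = - 3 * Dsc 4 E4 z"

definition Delta :: "complex \<Rightarrow> complex" where
  "Delta z = (if z \<in> HH then eta z ^ 24 else 0)"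

definition Delta_exp :: "complex \<Rightarrow> complex" where
  "Delta_exp w = w * exp (24 * log_phi w)"

lemma E4_expansion: "q_expansion E4 E4_exp"
proof -
  have "q_expansion (\<lambda>z. 144 * (deriv Pfun z / (2 * of_real pi * \<i>) + (Pfun z)\<^sup>2)) E4_exp"
    unfolding E4_exp_def [abs_def]
    by (intro q_expansion_cmult q_expansion_add q_expansion_deriv q_expansion_power Pfun_expansion)
  then show ?thesis by (simp add: q_expansion_def E4_def)
qed

lemma E4_exp_0: "E4_exp 0 = 1"
  by (simp add: E4_exp_def P_exp_0 power2_eq_square)

lemma Delta_exp_holomorphic: "Delta_exp holomorphic_on ball 0 1"
  unfolding Delta_exp_def [abs_def] using log_phi(1) by (intro holomorphic_intros)

lemma Delta_eq: "z \<in> HH \<Longrightarrow> Delta z = Delta_exp (qexp z)"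
  by (simp add: Delta_def eta_eq_exp Delta_exp_def qexp_def exp_add power_mult_distrib
      flip: exp_of_nat_mult) (simp add: mult_ac)

lemma Delta_expansion: "q_expansion Delta Delta_exp"
  by (simp add: q_expansion_def Delta_eq Delta_exp_holomorphic)

lemma Delta_nonzero: "z \<in> HH \<Longrightarrow> Delta z \<noteq> 0"
  by (simp add: Delta_eq Delta_exp_def)

text \<open>In other words \<open>D Delta = 0\<close> in weight 12, by the definition of P as a
  logarithmic derivative of eta.\<close>

lemma Delta_has_derivative:
  assumes "z \<in> HH"
  shows "(Delta has_field_derivative - (2 * of_real pi * \<i>) * (12 * Pfun z) * Delta z) (at z)"
proof -
  have eta: "eta z \<noteq> 0" using assms by (simp add: eta_eq_exp)
  have P: "Pfun z = \<i> / of_real pi * deriv eta z / eta z" by (simp add: Pfun_def)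
  have "(eta has_field_derivative deriv eta z) (at z)"
    using eta_has_derivative[OF assms] DERIV_imp_deriv by fastforce
  then have "((\<lambda>z. eta z ^ 24) has_field_derivative 24 * eta z ^ 23 * deriv eta z) (at z)"
    by (auto intro!: derivative_eq_intros)
  also have "24 * eta z ^ 23 * deriv eta z = - (2 * of_real pi * \<i>) * (12 * Pfun z) * Delta z"
    unfolding P Delta_def using eta assms by (simp add: field_simps eval_nat_numeral)
  finally show ?thesis
    by (rule has_field_derivative_transform_within_open[OF _ open_HH assms]) (simp add: Delta_def)
qed

subsection \<open>The ring of modular forms\<close>

text \<open>The transformation law is assumed here so that the scalar theory can be developed in
  general; \<open>pull_eq_self\<close>, applied to \<open>F0\<close>, discharges it in the final
  theorem.\<close>

locale quasi_modular =
  assumes pull_Pfun: "\<And>g z. g \<in> SL2Z \<Longrightarrow> z \<in> HH \<Longrightarrow> pull g Pfun z = Pfun z"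
begin

lemma MF_Dsc:
  assumes f: "f \<in> MF k" "q_expansion f g"
  shows "Dsc (of_int k) f \<in> MF (k + 2)"
    and "q_expansion (Dsc (of_int k) f) (\<lambda>w. w * deriv g w + of_int k * (P_exp w * g w))"
proof -
  have "q_expansion (\<lambda>z. deriv f z / (2 * of_real pi * \<i>) + of_int k * (Pfun z * f z))
      (\<lambda>w. w * deriv g w + of_int k * (P_exp w * g w))"
    by (intro q_expansion_add q_expansion_deriv q_expansion_cmult q_expansion_mult Pfun_expansion f)
  then show exp: "q_expansion (Dsc (of_int k) f) (\<lambda>w. w * deriv g w + of_int k * (P_exp w * g w))"
    by (simp add: q_expansion_def Dsc_def mult.assoc)
  show "Dsc (of_int k) f \<in> MF (k + 2)"
  proof (rule MF_I[OF exp])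
    fix s z assume s: "s \<in> SL2Z" and z: "z \<in> HH"
    have "conn Pfun (of_int k) f (moeb s z) =
        jfac s z powr of_real (of_int k + 2) * conn (pull s Pfun) (of_int k) f z"
      by (rule conn_slash[OF s z]) (use MF_D[OF f(1)] jfac_powr_int s in auto)
    also have "of_real (of_int k + 2) = (of_int (k + 2) :: complex)" by simp
    also have "conn (pull s Pfun) (of_int k) f z = conn Pfun (of_int k) f z"
      by (simp add: conn_def pull_Pfun[OF s z])
    finally show "Dsc (of_int k) f (moeb s z) = jfac s z powi (k + 2) * Dsc (of_int k) f z"
      by (simp only: Dsc_eq_conn z moeb_in_HH[OF s z] jfac_powr_int[OF s z])
  qed (simp add: Dsc_def)
qed

lemma Pfun_moeb:
  assumes "g \<in> SL2Z" "z \<in> HH"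
  shows "Pfun (moeb g z) = (jfac g z)\<^sup>2 * Pfun z - of_int (lower_left g) * jfac g z / (2 * of_real pi * \<i>)"
  using pull_Pfun[OF assms] jfac_nonzero[OF assms]
  by (simp add: pull_def field_simps power2_eq_square)

text \<open>The non-modular terms in the transformation laws of \<open>Pfun'\<close> and \<open>Pfun\<^sup>2\<close> cancel.\<close>

lemma E4_MF: "E4 \<in> MF 4"
proof (rule MF_I[OF E4_expansion])
  fix g z assume g: "g \<in> SL2Z" and z: "z \<in> HH"
  define p :: complex where "p = 2 * of_real pi * \<i>"
  define c :: complex where "c = of_int (lower_left g)"
  let ?J = "jfac g z"
  have p: "p \<noteq> 0" by (simp add: p_def)
  have J: "?J \<noteq> 0" using jfac_nonzero[OF g z] .
  have P: "Pfun (moeb g w) = (jfac g w)\<^sup>2 * Pfun w - c * jfac g w / p" if "w \<in> HH" for w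
    using Pfun_moeb[OF g that] by (simp add: p_def c_def)
  have dJ: "(jfac g has_field_derivative c) (at z)" unfolding c_def by (rule jfac_has_derivative)
  note [derivative_intros] = dJ holomorphic_HH_deriv[OF Pfun_holomorphic z]
  have "((\<lambda>w. (jfac g w)\<^sup>2 * Pfun w - c * jfac g w / p) has_field_derivative
      (2 * c * ?J * Pfun z + ?J\<^sup>2 * deriv Pfun z - c * c / p)) (at z)"
    by (auto intro!: derivative_eq_intros simp: p)
  then have d1: "((\<lambda>w. Pfun (moeb g w)) has_field_derivative
      (2 * c * ?J * Pfun z + ?J\<^sup>2 * deriv Pfun z - c * c / p)) (at z)"
    by (rule has_field_derivative_transform_within_open[OF _ open_HH z]) (simp add: P)
  have d2: "((\<lambda>w. Pfun (moeb g w)) has_field_derivative deriv Pfun (moeb g z) * (1 / ?J\<^sup>2)) (at z)"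
    by (rule DERIV_chain2[OF holomorphic_HH_deriv[OF Pfun_holomorphic moeb_in_HH[OF g z]] moeb_has_derivative[OF g z]])
  have dP: "deriv Pfun (moeb g z) = ?J\<^sup>2 * (2 * c * ?J * Pfun z + ?J\<^sup>2 * deriv Pfun z - c * c / p)"
    using DERIV_unique[OF d1 d2] J by (simp add: field_simps)
  have "deriv Pfun (moeb g z) / p + (Pfun (moeb g z))\<^sup>2 = ?J ^ 4 * (deriv Pfun z / p + (Pfun z)\<^sup>2)"
    unfolding P[OF z] dP using p by (simp add: field_simps power2_eq_square power4_eq_xxxx)
  then show "E4 (moeb g z) = ?J powi 4 * E4 z"
    using z moeb_in_HH[OF g z] by (simp add: E4_def p_def power_int_def)
qed (simp add: E4_def)

lemma E6_MF: "E6 \<in> MF 6"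
  and E6_expansion: "\<exists>g. q_expansion E6 g \<and> g 0 = 1"
proof -
  note D = MF_Dsc[OF E4_MF E4_expansion]
  show "E6 \<in> MF 6" using MF_cmult[OF D(1), of "-3"] by (simp add: E6_def [abs_def])
  show "\<exists>g. q_expansion E6 g \<and> g 0 = 1"
    using q_expansion_cmult[OF D(2), of "-3"]
    by (intro exI[of _ "\<lambda>w. - 3 * (w * deriv E4_exp w + of_int 4 * (P_exp w * E4_exp w))"])
       (simp add: E6_def [abs_def] E4_exp_0 P_exp_0)
qed

text \<open>\<open>Delta\<close> and its transform under \<open>Smat\<close> both solve
  \<open>D f = 0\<close> in weight 12, so their quotient is constant; at the fixed point
  \<open>\<i>\<close> it equals 1 because \<open>\<i> ^ 12 = 1\<close>. Translation invariance then
  gives the whole group.\<close>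

lemma Delta_MF: "Delta \<in> MF 12"
proof (rule MF_I[OF Delta_expansion])
  have S: "Delta (moeb Smat z) = jfac Smat z ^ 12 * Delta z" if z: "z \<in> HH" for z
  proof -
    define h where "h z = Delta (moeb Smat z) / jfac Smat z ^ 12" for z
    have holo: "Delta holomorphic_on HH" using Delta_expansion by (rule q_expansion_holomorphic)
    have "(Delta \<circ> moeb Smat) holomorphic_on HH"
      using moeb_in_HH[OF Smat_in] by (intro holomorphic_on_compose_gen[OF moeb_holomorphic[OF Smat_in] holo]) auto
    moreover have "jfac Smat holomorphic_on HH"
      using jfac_has_derivative holomorphic_on_open[OF open_HH] by blast
    ultimately have h: "h holomorphic_on HH"
      unfolding h_def [abs_def] using jfac_nonzero[OF Smat_in] by (intro holomorphic_intros) (auto simp: o_def)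
    have der: "((\<lambda>w. h w / Delta w) has_field_derivative 0) (at w)" if w: "w \<in> HH" for w
    proof -
      have "conn Pfun 12 Delta (moeb Smat w) = jfac Smat w powr of_real (12 + 2) * conn (pull Smat Pfun) 12 h w"
      proof (rule conn_slash[OF Smat_in w holo h])
        show "Delta (moeb Smat z) = jfac Smat z powr of_real 12 * h z" if "z \<in> HH" for z
          using jfac_powr_int[OF Smat_in that, of 12] jfac_nonzero[OF Smat_in that]
          by (simp add: h_def power_int_def)
      qed
      moreover have "conn Pfun 12 Delta (moeb Smat w) = 0"
        using DERIV_imp_deriv[OF Delta_has_derivative[OF moeb_in_HH[OF Smat_in w]]] by (simp add: conn_def)
      ultimately have "conn Pfun 12 h w = 0"
        using jfac_nonzero[OF Smat_in w] pull_Pfun[OF Smat_in w] by (simp add: conn_def)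
      then have dh: "deriv h w = - (2 * of_real pi * \<i>) * (12 * Pfun w) * h w"
        by (simp add: conn_def field_simps add_eq_0_iff)
      show ?thesis
        by (rule DERIV_cong[OF DERIV_divide[OF holomorphic_HH_deriv[OF h w] Delta_has_derivative[OF w] Delta_nonzero[OF w]]])
           (simp add: dh)
    qed
    have "\<exists>c. \<forall>w\<in>HH. h w / Delta w = c"
      by (rule has_field_derivative_zero_constant[OF convex_HH]) (rule has_field_derivative_at_within[OF der])
    then obtain c where c: "\<And>w. w \<in> HH \<Longrightarrow> h w / Delta w = c" by blast
    have i: "\<i> \<in> HH" by (simp add: HH_def)
    have "\<i> ^ 12 = 1" by (simp add: eval_nat_numeral)
    then have "c = 1" using c[OF i] Delta_nonzero[OF i] by (simp add: h_def moeb_S jfac_S)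
    then show ?thesis using c[OF z] Delta_nonzero[OF z] jfac_nonzero[OF Smat_in z] by (simp add: h_def field_simps)
  qed
  fix g z assume g: "g \<in> SL2Z" and z: "z \<in> HH"
  from g have "\<forall>z\<in>HH. Delta (moeb g z) = jfac g z ^ 12 * Delta z"
  proof (induction rule: SL2Z_induct)
    case one
    then show ?case by (simp add: moeb_def jfac_def)
  next
    case (S g)
    then show ?case using \<open>\<And>z. z \<in> HH \<Longrightarrow> Delta (moeb Smat z) = jfac Smat z ^ 12 * Delta z\<close>
      by (simp add: moeb_mmul Smat_in moeb_in_HH power_mult_distrib)
  next
    case (T g n)
    have t: "(1, n, 0, 1) \<in> SL2Z" by (simp add: SL2Z_def)
    have "Delta (w + 1) = Delta w" if "w \<in> HH" for w
      using Delta_eq[OF that] Delta_eq[of "w + 1"] that by (simp add: qexp_plus_1 HH_def)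
    then have "Delta (w + of_int n) = Delta w" if "w \<in> HH" for w
      using periodic_int[of Delta w n] that by blast
    then have "Delta (moeb (1, n, 0, 1) w) = Delta w" if "w \<in> HH" for w
      using that by (simp add: moeb_def)
    then show ?case using T t by (simp add: moeb_mmul moeb_in_HH) (simp add: jfac_def)
  qed
  then show "Delta (moeb g z) = jfac g z powi 12 * Delta z" using z by (simp add: power_int_def)
qed (simp add: Delta_def)

text \<open>The 12th power of \<open>f\<close> times \<open>Delta\<close> to the power
  \<open>- k\<close> has weight 0 and a zero at infinity, so it vanishes, while \<open>Delta\<close>
  has no zeros on \<open>HH\<close>. The exponents \<open>Suc 11\<close> and \<open>Suc n\<close>
  follow the shape of \<open>MF_power\<close>.\<close>

lemma MF_negative:
  assumes "k < 0" "f \<in> MF k"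
  shows "f z = 0"
proof -
  obtain g where g: "q_expansion f g" using MF_q_expansion[OF assms(2)] .
  define n where "n = nat (- k) - 1"
  have n: "int (Suc n) = - k" using assms(1) by (simp add: n_def)
  have "(\<lambda>z. f z ^ Suc 11 * Delta z ^ Suc n) \<in> MF (int (Suc 11) * k + int (Suc n) * 12)"
    by (intro MF_mult MF_power assms Delta_MF)
  then have "(\<lambda>z. f z ^ Suc 11 * Delta z ^ Suc n) \<in> MF 0" by (simp only: n) simp
  moreover have "q_expansion (\<lambda>z. f z ^ Suc 11 * Delta z ^ Suc n) (\<lambda>w. g w ^ Suc 11 * Delta_exp w ^ Suc n)"
    by (intro q_expansion_mult q_expansion_power g Delta_expansion)
  ultimately have "f z ^ Suc 11 * Delta z ^ Suc n = 0"
    by (rule MF_0_vanishing) (simp add: Delta_exp_def)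
  then show ?thesis using Delta_nonzero MF_D(3)[OF assms(2)] by auto
qed

lemma MF_cusp_divide:
  assumes f: "f \<in> MF k" and g: "q_expansion f g" "g 0 = 0"
  obtains h where "h \<in> MF (k - 12)" "\<And>z. f z = Delta z * h z"
proof -
  \<comment> \<open>The quotient \<open>g w / w\<close> with its removable singularity filled in. It
    suffices because \<open>Delta_exp w\<close> is \<open>w\<close> times an exponential.\<close>
  define g1 where "g1 w = (if w = 0 then deriv g 0 else (g w - g 0) / (w - 0))" for w
  have "g1 holomorphic_on ball 0 1"
    unfolding g1_def [abs_def] using g(1) by (intro pole_lemma) (auto simp: q_expansion_def interior_open)
  then have holo: "(\<lambda>w. g1 w * exp (- 24 * log_phi w)) holomorphic_on ball 0 1"
    using log_phi(1) by (intro holomorphic_intros)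
  define h where "h z = f z / Delta z" for z
  have "h z = g1 (qexp z) * exp (- 24 * log_phi (qexp z))" if "z \<in> HH" for z
    using that g by (simp add: h_def g1_def q_expansion_def Delta_eq Delta_exp_def exp_minus divide_inverse)
  then have "q_expansion h (\<lambda>w. g1 w * exp (- 24 * log_phi w))"
    using holo by (simp add: q_expansion_def)
  then have "h \<in> MF (k - 12)"
  proof (rule MF_I)
    fix s z assume sz: "s \<in> SL2Z" "z \<in> HH"
    then show "h (moeb s z) = jfac s z powi (k - 12) * h z"
      using MF_D(4)[OF f sz] MF_D(4)[OF Delta_MF sz] jfac_nonzero[OF sz]
      by (simp add: h_def power_int_diff)
  qed (simp add: h_def Delta_def)
  moreover have "f z = Delta z * h z" for z
    using Delta_nonzero[of z] MF_D(3)[OF f, of z] by (cases "z \<in> HH") (auto simp: h_def)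
  ultimately show ?thesis using that by blast
qed

text \<open>Comparing constant terms, \<open>a D f = - f\<^sup>2 / 6\<close> where \<open>a\<close> is the constant term of \<open>f\<close>. As \<open>f\<close> vanishes at
  \<open>\<i>\<close>, this differential equation gives \<open>f = 0\<close>.\<close>

lemma MF_2:
  assumes f: "f \<in> MF 2"
  shows "f z = 0"
proof -
  obtain g where g: "q_expansion f g" using MF_q_expansion[OF f] .
  define a where "a = g 0"
  note D = MF_Dsc[OF f g]
  show ?thesis
  proof (cases "a = 0")
    case True
    then obtain h where "h \<in> MF (2 - 12)" "\<And>z. f z = Delta z * h z"
      using MF_cusp_divide[OF f g] by (auto simp: a_def)
    then show ?thesis using MF_negative[of "2 - 12" h z] by simp
  next
    case False
    \<comment> \<open>Since \<open>P_exp 0 = - 1 / 12\<close>, the constant term of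
      \<open>Dsc 2 f\<close> is \<open>- a / 6\<close>, so the factor 1/6 yields a cusp form of
      weight 4. Divided by \<open>Delta\<close> it has weight -8 and is zero.\<close>
    let ?h = "\<lambda>z. a * Dsc 2 f z + 1 / 6 * (f z * f z)"
    have "?h \<in> MF 4"
      using MF_add[OF MF_cmult[OF D(1), of a] MF_cmult[OF MF_mult[OF f f], of "1/6"]] by simp
    moreover have "q_expansion ?h (\<lambda>w. a * (w * deriv g w + of_int 2 * (P_exp w * g w)) + 1 / 6 * (g w * g w))"
      using q_expansion_add[OF q_expansion_cmult[OF D(2), of a] q_expansion_cmult[OF q_expansion_mult[OF g g], of "1/6"]] by simp
    ultimately obtain h where h: "h \<in> MF (4 - 12)" "\<And>z. ?h z = Delta z * h z"
      by (rule MF_cusp_divide) (auto simp: P_exp_0 a_def)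
    have zero: "a * Dsc 2 f z + 1 / 6 * (f z * f z) = 0" for z
      using h(2)[of z] MF_negative[of "4 - 12" h z] h(1) by simp
    define X where "X z = 2 * of_real pi * \<i> * (- f z / (6 * a) - 2 * Pfun z)" for z
    have i: "\<i> \<in> HH" by (simp add: HH_def)
    have "f \<i> = - f \<i>"
      using MF_D(4)[OF f Smat_in i] by (simp add: moeb_S jfac_S power_int_def)
    then have fi: "f \<i> = 0" by simp
    have "deriv f w = X w * f w" if "w \<in> HH" for w
    proof -
      have "Dsc 2 f w = - (f w * f w) / (6 * a)"
        using zero[of w] False by (simp add: field_simps add_eq_0_iff)
      then have "deriv f w / (2 * of_real pi * \<i>) = - (f w * f w) / (6 * a) - 2 * Pfun w * f w"
        using that by (simp add: Dsc_def algebra_simps)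
      then have "deriv f w = 2 * of_real pi * \<i> * (- (f w * f w) / (6 * a) - 2 * Pfun w * f w)"
        by (simp add: field_simps)
      then show ?thesis by (simp add: X_def field_simps)
    qed
    moreover have "X holomorphic_on HH"
      unfolding X_def [abs_def] using False MF_D(1)[OF f] Pfun_holomorphic by (intro holomorphic_intros) auto
    ultimately have "f z = 0" if "z \<in> HH" for z
      using linear_ode_unique[of "\<lambda>_::unit. f" "\<lambda>_ _. X" \<i> z "()"] MF_D(1)[OF f] i fi that by simp
    then show ?thesis using MF_D(3)[OF f] by blast
  qed
qed

section \<open>Bases of the spaces of scalar modular forms\<close>

lemma MF_unit_constant_term:
  assumes "n \<noteq> 1"
  shows "\<exists>f\<in>MF (2 * int n). \<exists>g. q_expansion f g \<and> g 0 = 1"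
  using assms
proof (induction n rule: less_induct)
  case (less n)
  consider "n = 0" | "n = 2" | "n = 3" | "n \<ge> 4" using less.prems by linarith
  then show ?case
  proof cases
    case 1
    then show ?thesis using one_HH_MF one_HH_expansion by (intro bexI[of _ one_HH] exI[of _ "\<lambda>_. 1"]) auto
  next
    case 2
    then show ?thesis using E4_MF E4_expansion E4_exp_0 by (intro bexI[of _ E4] exI[of _ E4_exp]) auto
  next
    \<comment> \<open>The descent by 2 would land on the excluded case \<open>n = 1\<close>, so
      weight 6 needs its own generator.\<close>
    case 3
    then show ?thesis using E6_MF E6_expansion by (intro bexI[of _ E6]) auto
  next
    case 4
    then have "n - 2 < n" "n - 2 \<noteq> 1" by auto
    then obtain f g where f: "f \<in> MF (2 * int (n - 2))" "q_expansion f g" "g 0 = 1"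
      using less.IH[of "n - 2"] by blast
    have "(\<lambda>z. E4 z * f z) \<in> MF (2 * int n)"
      using MF_mult[OF E4_MF f(1)] 4 by (simp add: of_nat_diff algebra_simps)
    moreover have "q_expansion (\<lambda>z. E4 z * f z) (\<lambda>w. E4_exp w * g w)"
      by (intro q_expansion_mult E4_expansion f)
    moreover have "E4_exp 0 * g 0 = 1" by (simp add: E4_exp_0 f)
    ultimately show ?thesis by blast
  qed
qed

definition MF_basis :: "int \<Rightarrow> nat \<Rightarrow> (nat \<Rightarrow> complex \<Rightarrow> complex) \<Rightarrow> bool" where
  "MF_basis k d e \<longleftrightarrow> (\<forall>i<d. e i \<in> MF k) \<and>
     (\<forall>f\<in>MF k. \<exists>c. f = (\<lambda>z. \<Sum>i<d. c i * e i z)) \<and>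
     (\<forall>c. (\<forall>z\<in>HH. (\<Sum>i<d. c i * e i z) = 0) \<longrightarrow> (\<forall>i<d. c i = 0))"

lemma MF_basis_empty:
  assumes "\<And>f z. f \<in> MF k \<Longrightarrow> f z = 0"
  shows "MF_basis k 0 e"
  using assms by (auto simp: MF_basis_def)

text \<open>The constant term maps M_k to the complex numbers with kernel \<open>Delta\<close> times
  M_(k-12), and \<open>G\<close> splits this map. It takes index 0, and the old basis moves up by
  one.\<close>

lemma MF_basis_step:
  assumes G: "G \<in> MF k" "q_expansion G \<gamma>" "\<gamma> 0 = 1" and e: "MF_basis (k - 12) d e"
  shows "MF_basis k (Suc d) (\<lambda>i. case i of 0 \<Rightarrow> G | Suc i \<Rightarrow> (\<lambda>z. Delta z * e i z))"
proof -
  let ?e = "\<lambda>i. case i of 0 \<Rightarrow> G | Suc i \<Rightarrow> (\<lambda>z. Delta z * e i z)"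
  have sum: "(\<Sum>i<Suc d. c i * ?e i z) = c 0 * G z + Delta z * (\<Sum>i<d. c (Suc i) * e i z)" for c z
    by (simp add: sum.lessThan_Suc_shift sum_distrib_left mult_ac del: sum.lessThan_Suc)
  have "?e i \<in> MF k" if "i < Suc d" for i
  proof (cases i)
    case (Suc j)
    then have "e j \<in> MF (k - 12)" using that e by (simp add: MF_basis_def)
    from MF_mult[OF Delta_MF this] show ?thesis using Suc by simp
  qed (simp add: G)
  moreover have "\<exists>c. f = (\<lambda>z. \<Sum>i<Suc d. c i * ?e i z)" if f: "f \<in> MF k" for f
  proof -
    obtain g where g: "q_expansion f g" using MF_q_expansion[OF f] .
    have "(\<lambda>z. f z + (- g 0) * G z) \<in> MF k" by (intro MF_add MF_cmult f G)
    moreover have "q_expansion (\<lambda>z. f z + (- g 0) * G z) (\<lambda>w. g w + (- g 0) * \<gamma> w)"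
      by (intro q_expansion_add q_expansion_cmult g G)
    ultimately obtain h where h: "h \<in> MF (k - 12)" "\<And>z. f z + (- g 0) * G z = Delta z * h z"
      by (rule MF_cusp_divide) (use G in auto)
    obtain c where "h = (\<lambda>z. \<Sum>i<d. c i * e i z)" using e h(1) by (auto simp: MF_basis_def)
    moreover have "f z = g 0 * G z + Delta z * h z" for z using h(2)[of z] by (simp add: algebra_simps)
    ultimately have "f = (\<lambda>z. \<Sum>i<Suc d. (case i of 0 \<Rightarrow> g 0 | Suc i \<Rightarrow> c i) * ?e i z)"
      unfolding sum by auto
    then show ?thesis by blast
  qed
  moreover have "\<forall>i<Suc d. c i = 0" if c: "\<forall>z\<in>HH. (\<Sum>i<Suc d. c i * ?e i z) = 0" for c
  proof -
    let ?s = "\<lambda>z. \<Sum>i<d. c (Suc i) * e i z"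
    have "?s \<in> MF (k - 12)" using e by (intro MF_sum MF_cmult) (auto simp: MF_basis_def)
    then obtain s where s: "q_expansion ?s s" by (rule MF_q_expansion)
    have eq: "c 0 * G z + Delta z * ?s z = 0" if "z \<in> HH" for z
      using c that unfolding sum by blast
    have "c 0 * \<gamma> 0 + Delta_exp 0 * s 0 = 0"
      by (rule q_expansion_zero[OF q_expansion_add[OF q_expansion_cmult[OF G(2), of "c 0"]
            q_expansion_mult[OF Delta_expansion s]] eq])
    then have c0: "c 0 = 0" by (simp add: G Delta_exp_def)
    then have "\<forall>z\<in>HH. ?s z = 0" using eq Delta_nonzero by auto
    moreover have "(\<forall>z\<in>HH. (\<Sum>i<d. c' i * e i z) = 0) \<longrightarrow> (\<forall>i<d. c' i = 0)" for c'
      using e by (simp add: MF_basis_def)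
    from this[of "\<lambda>i. c (Suc i)"] have "(\<forall>z\<in>HH. ?s z = 0) \<longrightarrow> (\<forall>i<d. c (Suc i) = 0)" .
    ultimately have "\<forall>i<d. c (Suc i) = 0" by blast
    then show ?thesis using c0 by (metis less_Suc_eq_0_disj)
  qed
  ultimately show ?thesis unfolding MF_basis_def by blast
qed

text \<open>Below weight 12 the cuspidal part has negative weight and vanishes, so the dimension is
  1, or 0 in weight 2. Every further 12 in the weight adds one, which keeps the deficit for
  \<open>n mod 6 = 1\<close>.\<close>

lemma MF_basis_exists:
  "\<exists>e. MF_basis (2 * int n) (n div 6 + (if n mod 6 = 1 then 0 else 1)) e"
proof (induction n rule: less_induct)
  case (less n)
  show ?case
  proof (cases "n = 1")
    case True
    have "MF_basis 2 0 (\<lambda>_ _. 0)" by (rule MF_basis_empty) (rule MF_2)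
    then show ?thesis using True by auto
  next
    case False
    then obtain G \<gamma> where G: "G \<in> MF (2 * int n)" "q_expansion G \<gamma>" "\<gamma> 0 = 1"
      using MF_unit_constant_term by blast
    show ?thesis
    proof (cases "n < 6")
      case True
      then have "MF_basis (2 * int n - 12) 0 (\<lambda>_ _. 0)"
        by (intro MF_basis_empty MF_negative[of "2 * int n - 12"]) auto
      from MF_basis_step[OF G this] show ?thesis using True False by auto
    next
      case 2: False
      then obtain e where "MF_basis (2 * int (n - 6)) ((n - 6) div 6 + (if (n - 6) mod 6 = 1 then 0 else 1)) e"
        using less.IH[of "n - 6"] by auto
      then have "MF_basis (2 * int n - 12) ((n - 6) div 6 + (if (n - 6) mod 6 = 1 then 0 else 1)) e"
        using 2 by (simp add: of_nat_diff algebra_simps)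
      note step = MF_basis_step[OF G this]
      have "n div 6 = Suc ((n - 6) div 6)" using 2 by (simp add: le_div_geq)
      moreover have "(n - 6) mod 6 = n mod 6" using 2 by (simp add: le_mod_geq)
      ultimately have "Suc ((n - 6) div 6 + (if (n - 6) mod 6 = 1 then 0 else 1)) = n div 6 + (if n mod 6 = 1 then 0 else 1)"
        by simp
      then show ?thesis using step by metis
    qed
  qed
qed

end

subsection \<open>Vector-valued modular forms\<close>

lemma Hsp_iff:
  assumes v: "\<forall>g\<in>SL2Z. v g \<noteq> 0"
  shows "F \<in> Hsp k r v \<longleftrightarrow> vholo F \<and> (\<forall>i. moderate_growth (\<lambda>z. F z $ i)) \<and> (\<forall>z. z \<notin> HH \<longrightarrow> F z = 0) \<and>
    (\<forall>g\<in>SL2Z. \<forall>z\<in>HH. F (moeb g z) = (v g * jfac g z powr of_real k) *s (r g *v F z))"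
proof -
  have "(inverse (v g) * jfac g z powr (- of_real k)) *s x = y \<longleftrightarrow> x = (v g * jfac g z powr of_real k) *s y"
    if "g \<in> SL2Z" "z \<in> HH" for g z and x y :: "complex^'a"
  proof -
    have nz: "v g * jfac g z powr of_real k \<noteq> 0" using v jfac_nonzero that by simp
    have "inverse (v g) * jfac g z powr (- of_real k) = inverse (v g * jfac g z powr of_real k)"
      by (simp add: powr_minus)
    moreover have "inverse q *s x = y \<longleftrightarrow> x = q *s y" if "q \<noteq> 0" for q
      using that by (auto simp: vec_eq_iff field_simps)
    ultimately show ?thesis using nz by metis
  qed
  then show ?thesis unfolding Hsp_def vholo_def by auto
qed

context
  fixes r :: "sl2 \<Rightarrow> complex^'n^'n" and v :: "sl2 \<Rightarrow> complex"
  assumes v: "\<forall>g\<in>SL2Z. v g \<noteq> 0"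
begin

lemma HspD:
  assumes "F \<in> Hsp k r v"
  shows "vholo F" "\<And>i. moderate_growth (\<lambda>z. F z $ i)" "\<And>z. z \<notin> HH \<Longrightarrow> F z = 0"
    "\<And>g z. g \<in> SL2Z \<Longrightarrow> z \<in> HH \<Longrightarrow> F (moeb g z) = (v g * jfac g z powr of_real k) *s (r g *v F z)"
  using assms Hsp_iff[of v F k r, OF v] by auto

lemma Hsp_mult:
  assumes "M \<in> MF j" "F \<in> Hsp k r v"
  shows "(\<lambda>z. M z *s F z) \<in> Hsp (k + of_int j) r v"
proof -
  have "(\<lambda>z. M z *s F z) (moeb g z) = (v g * jfac g z powr of_real (k + of_int j)) *s (r g *v (M z *s F z))"
    if "g \<in> SL2Z" "z \<in> HH" for g z
    using MF_D(4)[OF assms(1) that] HspD(4)[OF assms(2) that] jfac_powr_int[OF that, of j]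
    by (simp add: powr_add vector_smult_assoc vector_scalar_commute mult_ac)
  then show ?thesis
    using MF_D[OF assms(1)] HspD[OF assms(2)] Hsp_iff[of v _ _ r, OF v]
    by (auto simp: vholo_def intro!: holomorphic_intros moderate_growth_mult)
qed

lemma Hsp_zero: "(\<lambda>z. 0) \<in> Hsp k r v"
proof -
  have "moderate_growth (\<lambda>z. 0)"
    by (rule bounded_at_infinity_imp_moderate_growth[of 0 _ 0]) simp
  then show ?thesis using Hsp_iff[of v _ _ r, OF v] by (simp add: vholo_def)
qed

lemma Hsp_add:
  assumes "F \<in> Hsp k r v" "G \<in> Hsp k r v"
  shows "(\<lambda>z. F z + G z) \<in> Hsp k r v"
proof -
  have "F (moeb g z) + G (moeb g z) = (v g * jfac g z powr of_real k) *s (r g *v (F z + G z))"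
    if "g \<in> SL2Z" "z \<in> HH" for g z
    using HspD(4)[OF assms(1) that] HspD(4)[OF assms(2) that]
    by (simp add: matrix_vector_right_distrib vector_add_ldistrib)
  then show ?thesis
    using HspD[OF assms(1)] HspD[OF assms(2)] Hsp_iff[of v _ _ r, OF v]
    by (auto simp: vholo_def intro!: holomorphic_intros moderate_growth_add)
qed

lemma Hsp_det_slash:
  fixes X :: "'n \<Rightarrow> complex \<Rightarrow> complex^'n"
  assumes X: "\<And>i. X i \<in> Hsp (kk i) r v" and g: "g \<in> SL2Z" and z: "z \<in> HH"
  shows "det (\<chi> i. X i (moeb g z)) =
    (\<Prod>i\<in>UNIV. v g * jfac g z powr of_real (kk i)) * det (r g) * det (\<chi> i. X i z)"
  using HspD(4)[OF X g z] det_rows_image[of "\<lambda>i. v g * jfac g z powr of_real (kk i)" "r g" "\<lambda>i. X i z"] by simp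

text \<open>The exponents are shifted into \<open>[0, 1)\<close>, so moderate growth gives the best possible vanishing order
  of each eigencomponent at infinity.\<close>

lemma Hsp_component_expansion:
  assumes F: "F \<in> Hsp k r v"
    and Q: "\<And>x. (Q *v (r Tmat *v x)) $ i = mu * (Q *v x) $ i"
    and mu: "v Tmat * mu = ee l" and l: "l < 1"
  obtains g where "q_expansion (\<lambda>z. qexp (- of_real l * z) * (Q *v F z) $ i) g"
proof -
  let ?f = "\<lambda>z. (Q *v F z) $ i"
  have f: "?f = (\<lambda>z. \<Sum>j\<in>UNIV. Q $ i $ j * F z $ j)" by (simp add: matrix_vector_mult_def)
  have holo: "?f holomorphic_on HH"
    unfolding f using HspD(1)[OF F] by (intro holomorphic_intros) (auto simp: vholo_def)
  have "moderate_growth ?f"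
    unfolding f using HspD(2)[OF F] by (intro moderate_growth_sum moderate_growth_cmult)
  then obtain c N where c: "\<forall>z. Im z > c \<longrightarrow> norm (?f z) \<le> Im z ^ N"
    using moderate_growth_ex by blast
  show ?thesis
  proof (rule periodic_imp_q_expansion[of "\<lambda>z. qexp (- of_real l * z) * (Q *v F z) $ i" c N l])
    show "(\<lambda>z. qexp (- of_real l * z) * ?f z) holomorphic_on HH"
      using holo by (intro holomorphic_intros)
    show "qexp (- of_real l * (z + 1)) * ?f (z + 1) = qexp (- of_real l * z) * ?f z" if z: "z \<in> HH" for z
    proof -
      have "?f (z + 1) = (Q *v (v Tmat *s (r Tmat *v F z))) $ i"
        using HspD(4)[OF F Tmat_in z] by (simp add: moeb_T jfac_T)
      also have "\<dots> = v Tmat * (Q *v (r Tmat *v F z)) $ i"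
        by (simp add: vector_scalar_commute)
      also have "\<dots> = ee l * ?f z" by (simp add: Q mu[symmetric])
      finally have "?f (z + 1) = ee l * ?f z" .
      moreover have "qexp (- of_real l * (z + 1)) * ee l = qexp (- of_real l * z)"
        by (simp add: qexp_def ee_def ring_distribs flip: exp_add)
      ultimately show ?thesis by (metis mult.assoc)
    qed
    show "norm (qexp (- of_real l * z) * ?f z) \<le> Im z ^ N * exp (2 * pi * l * Im z)" if "c < Im z" for z
      using c that by (simp add: norm_mult norm_qexp mult.commute mult_ac mult_left_mono)
  qed (use l that in auto)
qed

text \<open>After multiplication by \<open>Q\<close> and transposition, row \<open>i\<close>
  consists of the eigencomponents with exponent \<open>lam i\<close>, so the powers of the nome
  leave the determinant row by row. The weights \<open>kk i\<close> do not affect the exponents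
  because \<open>jfac Tmat\<close> is 1.\<close>

lemma Hsp_det_expansion:
  fixes X :: "'n \<Rightarrow> complex \<Rightarrow> complex^'n" and Q :: "complex^'n^'n"
  assumes X: "\<And>i. X i \<in> Hsp (kk i) r v"
    and Q: "\<And>x i. (Q *v (r Tmat *v x)) $ i = mu i * (Q *v x) $ i" and inv: "invertible Q"
    and mu: "\<And>i. v Tmat * mu i = ee (lam i)" and lam: "\<And>i. lam i < 1"
  obtains g where "q_expansion (\<lambda>z. qexp (- of_real (\<Sum>i\<in>UNIV. lam i) * z) * det (\<chi> i. X i z)) g"
proof -
  have "\<exists>g. q_expansion (\<lambda>z. qexp (- of_real (lam i) * z) * (Q *v X j z) $ i) g" for i j
    using Hsp_component_expansion[OF X Q mu lam] by metis
  then obtain g where g: "\<And>i j. q_expansion (\<lambda>z. qexp (- of_real (lam i) * z) * (Q *v X j z) $ i) (g i j)"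
    by metis
  define G where "G w = det (\<chi> i j. g i j w) / det Q" for w
  have Qnz: "det Q \<noteq> 0" using inv by (simp add: invertible_det_nz)
  have "G holomorphic_on ball 0 1"
    unfolding G_def [abs_def] det_def using Qnz g
    by (intro holomorphic_intros) (auto simp: q_expansion_def det_def)
  moreover have "qexp (- of_real (\<Sum>i\<in>UNIV. lam i) * z) * det (\<chi> i. X i z) = G (qexp z)" if "z \<in> HH" for z
  proof -
    have "det (\<chi> i j. g i j (qexp z)) = det (\<chi> i. qexp (- of_real (lam i) * z) *s (\<chi> j. (Q *v X j z) $ i))"
      using g that by (intro arg_cong[where f = det]) (simp add: vec_eq_iff q_expansion_def)
    also have "\<dots> = (\<Prod>i\<in>UNIV. qexp (- of_real (lam i) * z)) * det (\<chi> i. \<chi> j. (Q *v X j z) $ i)"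
      by (rule det_rows_mul)
    also have "(\<Prod>i\<in>UNIV. qexp (- of_real (lam i) * z)) = qexp (- of_real (\<Sum>i\<in>UNIV. lam i) * z)"
      by (simp add: qexp_def exp_sum[symmetric] sum_distrib_left sum_distrib_right sum_negf)
    also have "(\<chi> i. \<chi> j. (Q *v X j z) $ i) = Q ** transpose (\<chi> i. X i z)"
      by (simp add: vec_eq_iff matrix_matrix_mult_def matrix_vector_mult_def transpose_def)
    finally show ?thesis using Qnz by (simp add: G_def det_mul det_transpose)
  qed
  ultimately show ?thesis using that[of G] by (simp add: q_expansion_def)
qed

end

section \<open>Derivatives of vector-valued forms and the Wronskian frame\<close>

lemma (in quasi_modular) Hsp_Dv:
  assumes v: "\<forall>g\<in>SL2Z. v g \<noteq> 0" and F: "F \<in> Hsp k r v"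
  shows "Dv k F \<in> Hsp (k + 2) r v"
proof -
  note FD = HspD[of v, OF v F]
  have D: "Dv k F z = conn_pow Pfun k 1 F z" if "z \<in> HH" for z
    using Dvpow_eq_conn_pow[OF that, of k 1 F] by simp
  have "vholo (Dv k F)"
    unfolding vholo_def
  proof
    fix i
    have "(\<lambda>z. conn_pow Pfun k 1 F z $ i) holomorphic_on HH"
      using conn_pow_vholo[OF FD(1) Pfun_holomorphic, of k 1] unfolding vholo_def by blast
    then show "(\<lambda>z. Dv k F z $ i) holomorphic_on HH"
      by (rule holomorphic_transform) (simp add: D)
  qed
  moreover have "moderate_growth (\<lambda>z. Dv k F z $ i)" for i
  proof (rule moderate_growth_cong)
    have "(\<lambda>z. F z $ i) holomorphic_on HH" using FD(1) by (simp add: vholo_def)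
    then show "moderate_growth (\<lambda>z. 1 / (2 * of_real pi * \<i>) * deriv (\<lambda>z. F z $ i) z + of_real k * (Pfun z * F z $ i))"
      by (intro moderate_growth_add moderate_growth_cmult moderate_growth_mult moderate_growth_deriv FD
          q_expansion_moderate_growth[OF Pfun_expansion])
  qed (simp add: Dv_def Dsc_def)
  moreover have "Dv k F z = 0" if "z \<notin> HH" for z
    using that by (simp add: Dv_def Dsc_def vec_eq_iff)
  moreover have "Dv k F (moeb g z) = (v g * jfac g z powr of_real (k + 2)) *s (r g *v Dv k F z)"
    if g: "g \<in> SL2Z" and z: "z \<in> HH" for g z
  proof -
    have "conn_pow (pull g Pfun) k 1 F z = conn_pow Pfun k 1 F z"
      by (simp add: vec_eq_iff conn_def pull_Pfun[OF g z])
    then show ?thesis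
      using conn_pow_slash[OF g Pfun_holomorphic FD(1) FD(1) FD(4)[OF g] z, of 1] moeb_in_HH[OF g z]
      by (simp add: D z del: conn_pow.simps)
  qed
  ultimately show ?thesis using Hsp_iff[of v, OF v] by blast
qed

lemma (in quasi_modular) Hsp_Dvpow:
  assumes v: "\<forall>g\<in>SL2Z. v g \<noteq> 0" and F: "F \<in> Hsp k r v"
  shows "Dvpow k n F \<in> Hsp (k + 2 * real n) r v"
proof (induction n)
  case (Suc n)
  from Hsp_Dv[of v, OF v Suc] show ?case by (simp add: algebra_simps)
qed (simp add: F)

text \<open>\<open>Q\<close> diagonalises \<open>rho Tmat\<close>, and \<open>lam\<close> lists the
  exponents including the multiplier. The equation \<open>weight\<close> makes the order of the
  Wronskian at infinity equal to the order guaranteed for every Cramer numerator.\<close>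

locale mlde_frame = quasi_modular +
  fixes rho :: "sl2 \<Rightarrow> complex^'n^'n" and v :: "sl2 \<Rightarrow> complex" and k0 :: real
    and h :: "'n \<Rightarrow> nat" and C :: "nat \<Rightarrow> complex \<Rightarrow> complex" and F0 :: "complex \<Rightarrow> complex^'n"
    and Q :: "complex^'n^'n" and mu :: "'n \<Rightarrow> complex" and lam :: "'n \<Rightarrow> real"
  assumes v: "\<forall>g\<in>SL2Z. v g \<noteq> 0"
    and rho: "\<And>g. g \<in> SL2Z \<Longrightarrow> invertible (rho g)"
    and F0: "F0 \<in> Hsp k0 rho v"
    and h: "bij_betw h UNIV {..<CARD('n)}"
    and sys: "mlde_system Pfun k0 C F0"
    and indep: "\<And>c. (\<And>z. z \<in> HH \<Longrightarrow> (\<Sum>i\<in>UNIV. c i * F0 z $ i) = 0) \<Longrightarrow> (\<forall>i. c i = 0)"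
    and Q: "\<And>x i. (Q *v (rho Tmat *v x)) $ i = mu i * (Q *v x) $ i" and Q_inv: "invertible Q"
    and mu: "\<And>i. v Tmat * mu i = ee (lam i)" and lam: "\<And>i. lam i < 1"
    and weight: "(\<Sum>j\<in>UNIV. k0 + 2 * real (h j)) = 12 * (\<Sum>i\<in>UNIV. lam i)"
begin

abbreviation "W \<equiv> wmat Pfun k0 h F0"

lemma W_rows: "z \<in> HH \<Longrightarrow> W z $ j = Dvpow k0 (h j) F0 z"
  by (simp add: wmat_def Dvpow_eq_conn_pow)

lemma W_nonzero: "z \<in> HH \<Longrightarrow> det (W z) \<noteq> 0"
  by (rule wmat_det_nonzero[OF h sys indep])

lemma W_formula:
  obtains c where "c \<noteq> 0"
    "\<And>z. z \<in> HH \<Longrightarrow> det (W z) = c * (qexp (of_real (\<Sum>i\<in>UNIV. lam i) * z) * exp (24 * of_real (\<Sum>i\<in>UNIV. lam i) * log_phi (qexp z)))"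
proof -
  define l where "l = complex_of_real (\<Sum>i\<in>UNIV. lam i)"
  \<comment> \<open>The power of eta with exponent \<open>24 * l\<close>, on the branch given by
    \<open>log_phi\<close>. It solves the same first order equation as \<open>det (W z)\<close>,
    whose weight is \<open>12 * l\<close>.\<close>
  define E where "E z = exp (24 * l * (2 * of_real pi * \<i> * z / 24 + log_phi (qexp z)))" for z
  have E: "E z = qexp (l * z) * exp (24 * l * log_phi (qexp z))" for z
    by (simp add: E_def qexp_def ring_distribs exp_add mult_ac)
  have "((\<lambda>w. det (W w) / E w) has_field_derivative 0) (at z)" if z: "z \<in> HH" for z
  proof -
    have "q_expansion (\<lambda>z. log_phi (qexp z)) log_phi" by (simp add: q_expansion_def log_phi)
    note [derivative_intros] = q_expansion_has_derivative[OF this z]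
    have "(E has_field_derivative (24 * l * (2 * of_real pi * \<i> * (1 / 24 + qexp z * deriv log_phi (qexp z)))) * E z) (at z)"
      unfolding E_def [abs_def] by (auto intro!: derivative_eq_intros simp: algebra_simps)
    also have "24 * l * (2 * of_real pi * \<i> * (1 / 24 + qexp z * deriv log_phi (qexp z)))
        = - (2 * of_real pi * \<i> * (12 * l) * Pfun z)"
    proof -
      have P: "Pfun z = - 1 / 12 - 2 * qexp z * deriv log_phi (qexp z)"
        using Pfun_expansion z by (simp add: q_expansion_def P_exp_def)
      show ?thesis unfolding P by (simp add: algebra_simps)
    qed
    finally have dE: "(E has_field_derivative - (2 * of_real pi * \<i> * (12 * l) * Pfun z) * E z) (at z)" .
    have dW: "((\<lambda>w. det (W w)) has_field_derivative - (2 * of_real pi * \<i> * (12 * l) * Pfun z) * det (W z)) (at z)"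
      using wmat_det_ode[OF h sys z] by (simp add: weight l_def)
    show ?thesis
      by (rule DERIV_cong[OF DERIV_divide[OF dW dE]]) (simp_all add: E_def)
  qed
  note der = this
  have "\<exists>c. \<forall>z\<in>HH. det (W z) / E z = c"
    by (rule has_field_derivative_zero_constant[OF convex_HH]) (rule has_field_derivative_at_within[OF der])
  then obtain c where c: "\<And>z. z \<in> HH \<Longrightarrow> det (W z) / E z = c" by blast
  have eq: "det (W z) = c * E z" if "z \<in> HH" for z
    using c[OF that] by (simp add: E_def field_simps)
  have "\<i> \<in> HH" by (simp add: HH_def)
  then have "c \<noteq> 0" using W_nonzero[of \<i>] eq by auto
  then show ?thesis using that[of c] eq E by (simp add: l_def)
qed

text \<open>Cramer's quotient for the rows of \<open>W\<close>, extended by 0 outside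
  \<open>HH\<close> so that it can be an element of \<open>MF\<close>.\<close>

definition coord :: "(complex \<Rightarrow> complex^'n) \<Rightarrow> 'n \<Rightarrow> complex \<Rightarrow> complex" where
  "coord F j z = (if z \<in> HH then det (\<chi> i. if i = j then F z else W z $ i) / det (W z) else 0)"

lemma coord_sum:
  assumes "z \<in> HH"
  shows "F z = (\<Sum>j\<in>UNIV. coord F j z *s Dvpow k0 (h j) F0 z)"
proof -
  have "det (\<chi> i j'. if j' = j then F z $ i else transpose (W z) $ i $ j') = det (\<chi> i. if i = j then F z else W z $ i)" for j
    by (subst det_transpose[symmetric], rule arg_cong[where f = det]) (simp add: vec_eq_iff transpose_def)
  then have "transpose (W z) *v (\<chi> j. coord F j z) = F z"
    using assms W_nonzero[OF assms] by (subst cramer) (simp_all add: coord_def det_transpose)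
  then have "F z $ i = (\<Sum>j\<in>UNIV. W z $ j $ i * coord F j z)" for i
    by (simp add: vec_eq_iff matrix_vector_mult_def transpose_def)
  then show ?thesis
    by (simp add: vec_eq_iff W_rows[OF assms] mult.commute)
qed

text \<open>Numerator and denominator differ only in row \<open>j\<close>, so the multiplier and
  \<open>det (rho s)\<close> cancel and the weight is the difference of the two row weights. At
  infinity the factors \<open>qexp (?l * z)\<close> cancel, and what remains of
  \<open>det (W z)\<close> is an exponential without zeros on the disc.\<close>

lemma coord_MF:
  assumes F: "F \<in> Hsp (k0 + of_int n) rho v"
  shows "coord F j \<in> MF (n - 2 * int (h j))"
proof -
  define X where "X i = (if i = j then F else Dvpow k0 (h i) F0)" for i
  define kk where "kk i = (if i = j then k0 + of_int n else k0 + 2 * real (h i))" for i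
  note D = Hsp_Dvpow[of v, OF v F0]
  have X: "X i \<in> Hsp (kk i) rho v" for i
    using F D[of "h i"] by (simp add: X_def kk_def)
  have eq: "coord F j z = det (\<chi> i. X i z) / det (W z)" if "z \<in> HH" for z
  proof -
    have "(\<chi> i. if i = j then F z else W z $ i) = (\<chi> i. X i z)"
      by (simp add: vec_eq_iff X_def W_rows[OF that])
    then show ?thesis using that by (simp add: coord_def)
  qed
  let ?l = "complex_of_real (\<Sum>i\<in>UNIV. lam i)"
  obtain g where g: "q_expansion (\<lambda>z. qexp (- ?l * z) * det (\<chi> i. X i z)) g"
    by (rule Hsp_det_expansion[of v, OF v X Q Q_inv mu lam])
  obtain c where c: "c \<noteq> 0" "\<And>z. z \<in> HH \<Longrightarrow> det (W z) = c * (qexp (?l * z) * exp (24 * ?l * log_phi (qexp z)))"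
    using W_formula by blast
  define G where "G w = g w * exp (- (24 * ?l * log_phi w)) / c" for w
  have "G holomorphic_on ball 0 1"
    unfolding G_def [abs_def] using g log_phi(1) c(1) by (intro holomorphic_intros) (auto simp: q_expansion_def)
  moreover have "coord F j z = G (qexp z)" if "z \<in> HH" for z
  proof -
    have "g (qexp z) = qexp (- ?l * z) * det (\<chi> i. X i z)" using g that by (simp add: q_expansion_def)
    moreover have "qexp (- ?l * z) = inverse (qexp (?l * z))" by (simp add: qexp_def exp_minus)
    ultimately show ?thesis
      unfolding eq[OF that] c(2)[OF that] G_def by (simp add: exp_minus divide_inverse mult_ac)
  qed
  ultimately have "q_expansion (coord F j) G" by (simp add: q_expansion_def)
  then show ?thesis
  proof (rule MF_I)
    fix s z assume s: "s \<in> SL2Z" and z: "z \<in> HH"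
    have J: "jfac s z \<noteq> 0" using jfac_nonzero[OF s z] .
    have num: "det (\<chi> i. X i (moeb s z)) = (\<Prod>i\<in>UNIV. v s * jfac s z powr of_real (kk i)) * det (rho s) * det (\<chi> i. X i z)"
      by (rule Hsp_det_slash[of v, OF v X s z])
    have W_eq: "W w = (\<chi> j. Dvpow k0 (h j) F0 w)" if "w \<in> HH" for w
      by (simp add: vec_eq_iff W_rows[OF that])
    have den: "det (W (moeb s z)) = (\<Prod>i\<in>UNIV. v s * jfac s z powr of_real (k0 + 2 * real (h i))) * det (rho s) * det (W z)"
      unfolding W_eq[OF z] W_eq[OF moeb_in_HH[OF s z]] by (rule Hsp_det_slash[of v, OF v D s z])
    have "(\<Prod>i\<in>UNIV. v s * jfac s z powr of_real (kk i))
        = jfac s z powi (n - 2 * int (h j)) * (\<Prod>i\<in>UNIV. v s * jfac s z powr of_real (k0 + 2 * real (h i)))"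
    proof -
      have "of_real (k0 + of_int n) = of_real (k0 + 2 * real (h j)) + (of_int (n - 2 * int (h j)) :: complex)" by simp
      then have "jfac s z powr of_real (k0 + of_int n)
          = jfac s z powr of_real (k0 + 2 * real (h j)) * jfac s z powi (n - 2 * int (h j))"
        by (simp only: powr_add jfac_powr_int[OF s z])
      moreover have "(\<Prod>i\<in>UNIV - {j}. v s * jfac s z powr of_real (kk i))
          = (\<Prod>i\<in>UNIV - {j}. v s * jfac s z powr of_real (k0 + 2 * real (h i)))"
        by (rule prod.cong) (auto simp: kk_def)
      ultimately show ?thesis
        by (simp add: prod.remove[of UNIV j] kk_def mult_ac)
    qed
    moreover have "(\<Prod>i\<in>UNIV. v s * jfac s z powr of_real (k0 + 2 * real (h i))) * det (rho s) \<noteq> 0"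
      using bspec[OF v s] J rho[OF s] by (simp add: invertible_det_nz)
    ultimately show "coord F j (moeb s z) = jfac s z powi (n - 2 * int (h j)) * coord F j z"
      unfolding eq[OF z] eq[OF moeb_in_HH[OF s z]] num den by simp
  qed (simp add: coord_def)
qed

lemma frame_expansion:
  assumes F: "F \<in> Hsp (k0 + of_int n) rho v"
  shows "\<exists>M. (\<forall>j<CARD('n). M j \<in> MF (n - 2 * int j)) \<and> F = (\<lambda>z. \<Sum>j<CARD('n). M j z *s Dvpow k0 j F0 z)"
proof (intro exI[of _ "\<lambda>j. coord F (inv h j)"] conjI allI impI)
  have inv: "h (inv h j) = j" if "j < CARD('n)" for j
    using h that by (auto simp: bij_betw_def intro!: f_inv_into_f)
  have inv2: "inv h (h i) = i" for i
    using h by (auto simp: bij_betw_def intro!: inv_into_f_f)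
  show "coord F (inv h j) \<in> MF (n - 2 * int j)" if "j < CARD('n)" for j
    using coord_MF[OF F, of "inv h j"] inv[OF that] by simp
  show "F = (\<lambda>z. \<Sum>j<CARD('n). coord F (inv h j) z *s Dvpow k0 j F0 z)"
  proof
    fix z
    show "F z = (\<Sum>j<CARD('n). coord F (inv h j) z *s Dvpow k0 j F0 z)"
    proof (cases "z \<in> HH")
      case True
      have "F z = (\<Sum>j\<in>UNIV. coord F (inv h (h j)) z *s Dvpow k0 (h j) F0 z)"
        using coord_sum[OF True, of F] by (simp add: inv2)
      also have "\<dots> = (\<Sum>j<CARD('n). coord F (inv h j) z *s Dvpow k0 j F0 z)"
        by (rule sum.reindex_bij_betw[OF h])
      finally show ?thesis .
    next
      case False
      then show ?thesis using HspD(3)[of v, OF v F] by (simp add: coord_def)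
    qed
  qed
qed

text \<open>The rows of the invertible matrix \<open>W z\<close> are independent at every single
  point. Being pointwise, the statement serves both freeness over \<open>Mring\<close> and the
  dimension count.\<close>

lemma frame_independent:
  assumes z: "z \<in> HH" and 0: "(\<Sum>j<CARD('n). c j *s Dvpow k0 j F0 z) = 0" and j: "j < CARD('n)"
  shows "c j = 0"
proof -
  have "(\<Sum>j\<in>UNIV. c (h j) *s Dvpow k0 (h j) F0 z) = 0"
    using sum.reindex_bij_betw[OF h, of "\<lambda>j. c j *s Dvpow k0 j F0 z"] 0 by simp
  then have "(\<Sum>j\<in>UNIV. W z $ j $ i * c (h j)) = 0" for i
    using W_rows[OF z] by (simp add: vec_eq_iff mult.commute)
  then have "transpose (W z) *v (\<chi> j. c (h j)) = 0"
    by (simp add: vec_eq_iff matrix_vector_mult_def transpose_def)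
  moreover have "invertible (transpose (W z))"
    using W_nonzero[OF z] by (simp add: invertible_det_nz det_transpose)
  ultimately have "(\<chi> j. c (h j)) = 0"
    using matrix_left_invertible_ker[of "transpose (W z)"] invertible_left_inverse by blast
  then have "c (h i) = 0" for i by (simp add: vec_eq_iff)
  moreover have "j \<in> h ` UNIV" using h j by (simp add: bij_betw_def)
  ultimately show ?thesis by auto
qed

end

subsection \<open>The graded ring and module\<close>

lemma MF_subset_Mring: "f \<in> MF k \<Longrightarrow> f \<in> Mring"
  unfolding Mring_def by (intro CollectI exI[of _ "{k}"] exI[of _ "\<lambda>_. f"]) auto

lemma Mring_add:
  assumes "f \<in> Mring" "g \<in> Mring"
  shows "(\<lambda>z. f z + g z) \<in> Mring"
proof -
  obtain S F where f: "finite S" "\<And>k. k \<in> S \<Longrightarrow> F k \<in> MF k" "f = (\<lambda>z. \<Sum>k\<in>S. F k z)"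
    using assms(1) unfolding Mring_def by blast
  obtain S' G where g: "finite S'" "\<And>k. k \<in> S' \<Longrightarrow> G k \<in> MF k" "g = (\<lambda>z. \<Sum>k\<in>S'. G k z)"
    using assms(2) unfolding Mring_def by blast
  let ?H = "\<lambda>k z. (if k \<in> S then F k z else 0) + (if k \<in> S' then G k z else 0)"
  have "?H k \<in> MF k" for k
  proof (rule MF_add)
    show "(\<lambda>z. if k \<in> S then F k z else 0) \<in> MF k" using f(2) MF_0 by (cases "k \<in> S") auto
    show "(\<lambda>z. if k \<in> S' then G k z else 0) \<in> MF k" using g(2) MF_0 by (cases "k \<in> S'") auto
  qed
  moreover have "f z + g z = (\<Sum>k\<in>S \<union> S'. ?H k z)" for z
  proof -
    have "(\<Sum>k\<in>S. F k z) = (\<Sum>k\<in>S \<union> S'. if k \<in> S then F k z else 0)"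
      "(\<Sum>k\<in>S'. G k z) = (\<Sum>k\<in>S \<union> S'. if k \<in> S' then G k z else 0)"
      using f(1) g(1) by (auto intro!: sum.mono_neutral_cong_left)
    then show ?thesis by (simp add: f g sum.distrib)
  qed
  ultimately show ?thesis
    unfolding Mring_def using f(1) g(1) by (intro CollectI exI[of _ "S \<union> S'"] exI[of _ ?H]) auto
qed

lemma Mring_sum: "(\<And>i. i \<in> A \<Longrightarrow> f i \<in> Mring) \<Longrightarrow> (\<lambda>z. \<Sum>i\<in>A. f i z) \<in> Mring"
  by (induction A rule: infinite_finite_induct) (auto intro: MF_subset_Mring[OF MF_0] Mring_add)

lemma Mring_outside: "f \<in> Mring \<Longrightarrow> z \<notin> HH \<Longrightarrow> f z = 0"
  unfolding Mring_def by (auto intro!: sum.neutral simp: MF_D(3))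

lemma Hsp_subset_Htot: "F \<in> Hsp (k + of_int n) r v \<Longrightarrow> F \<in> Htot k r v"
  unfolding Htot_def by (intro CollectI exI[of _ "{n}"] exI[of _ "\<lambda>_. F"]) auto

context
  fixes r :: "sl2 \<Rightarrow> complex^'n^'n" and v :: "sl2 \<Rightarrow> complex"
  assumes v: "\<forall>g\<in>SL2Z. v g \<noteq> 0"
begin

lemma Htot_add:
  assumes "F \<in> Htot k r v" "G \<in> Htot k r v"
  shows "(\<lambda>z. F z + G z) \<in> Htot k r v"
proof -
  obtain S f where f: "finite S" "\<And>n. n \<in> S \<Longrightarrow> f n \<in> Hsp (k + of_int n) r v" "F = (\<lambda>z. \<Sum>n\<in>S. f n z)"
    using assms(1) unfolding Htot_def by blast
  obtain S' g where g: "finite S'" "\<And>n. n \<in> S' \<Longrightarrow> g n \<in> Hsp (k + of_int n) r v" "G = (\<lambda>z. \<Sum>n\<in>S'. g n z)"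
    using assms(2) unfolding Htot_def by blast
  let ?H = "\<lambda>n z. (if n \<in> S then f n z else 0) + (if n \<in> S' then g n z else 0)"
  have "?H n \<in> Hsp (k + of_int n) r v" for n
  proof (rule Hsp_add[OF v])
    show "(\<lambda>z. if n \<in> S then f n z else 0) \<in> Hsp (k + of_int n) r v"
      using f(2) Hsp_zero[OF v] by (cases "n \<in> S") auto
    show "(\<lambda>z. if n \<in> S' then g n z else 0) \<in> Hsp (k + of_int n) r v"
      using g(2) Hsp_zero[OF v] by (cases "n \<in> S'") auto
  qed
  moreover have "F z + G z = (\<Sum>n\<in>S \<union> S'. ?H n z)" for z
  proof -
    have "(\<Sum>n\<in>S. f n z) = (\<Sum>n\<in>S \<union> S'. if n \<in> S then f n z else 0)"
      "(\<Sum>n\<in>S'. g n z) = (\<Sum>n\<in>S \<union> S'. if n \<in> S' then g n z else 0)"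
      using f(1) g(1) by (auto intro!: sum.mono_neutral_cong_left)
    then show ?thesis by (simp add: f g sum.distrib)
  qed
  ultimately show ?thesis
    unfolding Htot_def using f(1) g(1) by (intro CollectI exI[of _ "S \<union> S'"] exI[of _ ?H]) auto
qed

lemma Htot_sum: "(\<And>i. i \<in> A \<Longrightarrow> F i \<in> Htot k r v) \<Longrightarrow> (\<lambda>z. \<Sum>i\<in>A. F i z) \<in> Htot k r v"
  by (induction A rule: infinite_finite_induct)
     (auto intro: Hsp_subset_Htot[of _ _ 0] Hsp_zero[OF v] Htot_add)

lemma Htot_mult:
  assumes "M \<in> Mring" "F \<in> Htot k r v"
  shows "(\<lambda>z. M z *s F z) \<in> Htot k r v"
proof -
  obtain S m where m: "finite S" "\<And>j. j \<in> S \<Longrightarrow> m j \<in> MF j" "M = (\<lambda>z. \<Sum>j\<in>S. m j z)"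
    using assms(1) unfolding Mring_def by blast
  obtain S' f where f: "finite S'" "\<And>n. n \<in> S' \<Longrightarrow> f n \<in> Hsp (k + of_int n) r v" "F = (\<lambda>z. \<Sum>n\<in>S'. f n z)"
    using assms(2) unfolding Htot_def by blast
  have "(\<lambda>z. \<Sum>j\<in>S. \<Sum>n\<in>S'. m j z *s f n z) \<in> Htot k r v"
  proof (intro Htot_sum)
    fix j n assume "j \<in> S" "n \<in> S'"
    then have "(\<lambda>z. m j z *s f n z) \<in> Hsp (k + of_int n + of_int j) r v"
      by (intro Hsp_mult[OF v] m f)
    then show "(\<lambda>z. m j z *s f n z) \<in> Htot k r v"
      by (intro Hsp_subset_Htot[of _ _ "n + j"]) (simp add: add.assoc)
  qed
  then show ?thesis
    unfolding m(3) f(3) vec.scale_sum_left unfolding vec.scale_sum_right .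
qed

end

context mlde_frame
begin

lemma Dvpow_Hsp: "Dvpow k0 j F0 \<in> Hsp (k0 + of_int (2 * int j)) rho v"
  using Hsp_Dvpow[OF v F0, of j] by simp

lemma combination_in_Htot:
  "(\<And>j. j < N \<Longrightarrow> M j \<in> Mring) \<Longrightarrow> (\<lambda>z. \<Sum>j<N. M j z *s Dvpow k0 j F0 z) \<in> Htot k0 rho v"
  by (intro Htot_sum[OF v] Htot_mult[OF v] Hsp_subset_Htot[OF Dvpow_Hsp]) auto

lemma Htot_expansion:
  assumes "F \<in> Htot k0 rho v"
  shows "\<exists>M. (\<forall>j<CARD('n). M j \<in> Mring) \<and> F = (\<lambda>z. \<Sum>j<CARD('n). M j z *s Dvpow k0 j F0 z)"
proof -
  obtain S G where G: "finite S" "\<And>n. n \<in> S \<Longrightarrow> G n \<in> Hsp (k0 + of_int n) rho v" "F = (\<lambda>z. \<Sum>n\<in>S. G n z)"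
    using assms unfolding Htot_def by blast
  have "\<forall>n\<in>S. \<exists>M. (\<forall>j<CARD('n). M j \<in> MF (n - 2 * int j)) \<and> G n = (\<lambda>z. \<Sum>j<CARD('n). M j z *s Dvpow k0 j F0 z)"
    by (intro ballI frame_expansion G(2))
  from bchoice[OF this] obtain M where M: "\<forall>n\<in>S. (\<forall>j<CARD('n). M n j \<in> MF (n - 2 * int j)) \<and>
      G n = (\<lambda>z. \<Sum>j<CARD('n). M n j z *s Dvpow k0 j F0 z)"
    by (elim exE) (rule that)
  have ring: "(\<lambda>z. \<Sum>n\<in>S. M n j z) \<in> Mring" if "j < CARD('n)" for j
    using M that MF_subset_Mring by (intro Mring_sum) blast
  have "F = (\<lambda>z. \<Sum>j<CARD('n). (\<Sum>n\<in>S. M n j z) *s Dvpow k0 j F0 z)"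
  proof
    fix z
    have "F z = (\<Sum>n\<in>S. \<Sum>j<CARD('n). M n j z *s Dvpow k0 j F0 z)"
      unfolding G(3) by (rule sum.cong) (use M in \<open>auto simp: fun_eq_iff\<close>)
    also have "\<dots> = (\<Sum>j<CARD('n). (\<Sum>n\<in>S. M n j z) *s Dvpow k0 j F0 z)"
      by (subst sum.swap) (simp add: vec.scale_sum_left)
    finally show "F z = (\<Sum>j<CARD('n). (\<Sum>n\<in>S. M n j z) *s Dvpow k0 j F0 z)" .
  qed
  then show ?thesis
    by (intro exI[of _ "\<lambda>j z. \<Sum>n\<in>S. M n j z"] conjI allI impI ring)
qed

lemma Mring_independent:
  assumes M: "\<forall>j<CARD('n). M j \<in> Mring" and 0: "(\<lambda>z. \<Sum>j<CARD('n). M j z *s Dvpow k0 j F0 z) = (\<lambda>z. 0)"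
    and j: "j < CARD('n)"
  shows "M j = (\<lambda>z. 0)"
proof
  fix z
  show "M j z = 0"
  proof (cases "z \<in> HH")
    case True
    show ?thesis by (rule frame_independent[OF True fun_cong[OF 0] j])
  next
    case False
    then show ?thesis using Mring_outside M j by blast
  qed
qed

end

subsection \<open>Dimensions\<close>

lemma (in vector_space) dim_eq_card_family:
  assumes I: "finite I" and b: "\<And>i. i \<in> I \<Longrightarrow> b i \<in> V"
    and spanning: "\<And>x. x \<in> V \<Longrightarrow> \<exists>c. x = (\<Sum>i\<in>I. scale (c i) (b i))"
    and indep: "\<And>c i. (\<Sum>i\<in>I. scale (c i) (b i)) = 0 \<Longrightarrow> i \<in> I \<Longrightarrow> c i = 0"
  shows "dim V = card I"
proof -
  have inj: "inj_on b I"
  proof (rule inj_onI, rule ccontr)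
    fix x y assume xy: "x \<in> I" "y \<in> I" "b x = b y" "x \<noteq> y"
    \<comment> \<open>The relation \<open>b x - b y = 0\<close>: independence of the family already
      forces distinct indices to have distinct vectors.\<close>
    let ?c = "\<lambda>i. (if i = x then 1 else 0) - (if i = y then 1 else 0) :: 'a"
    have "(\<Sum>i\<in>I. scale (?c i) (b i)) = (\<Sum>i\<in>I. if i = x then b x else 0) - (\<Sum>i\<in>I. if i = y then b y else 0)"
      unfolding sum_subtractf[symmetric] by (intro sum.cong) (auto simp: scale_left_diff_distrib)
    also have "\<dots> = 0" using I xy by simp
    finally have "?c x = 0" by (rule indep[of ?c x, OF _ xy(1)])
    then show False using xy by simp
  qed
  show ?thesis
  proof (rule dim_unique)
    show "b ` I \<subseteq> V" using b by blast
    show "V \<subseteq> span (b ` I)"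
    proof
      fix x assume "x \<in> V"
      then obtain c where x: "x = (\<Sum>i\<in>I. scale (c i) (b i))" using spanning by blast
      show "x \<in> span (b ` I)" unfolding x by (intro span_sum span_scale span_base imageI)
    qed
    show "independent (b ` I)"
    proof (rule independent_if_scalars_zero)
      fix f x assume f: "(\<Sum>x\<in>b ` I. scale (f x) x) = 0" and x: "x \<in> b ` I"
      then have "(\<Sum>i\<in>I. scale (f (b i)) (b i)) = 0" by (simp add: sum.reindex[OF inj])
      from indep[OF this] show "f x = 0" using x by blast
    qed (use I in simp)
    show "card (b ` I) = card I" by (rule card_image[OF inj])
  qed
qed

lemma vector_space_vscale: "vector_space (vscale :: complex \<Rightarrow> (complex \<Rightarrow> complex^'n) \<Rightarrow> _)"
  by unfold_locales
     (auto simp: vscale_def fun_eq_iff vec_eq_iff algebra_simps plus_fun_def)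

lemma sum_fun_apply: "(\<Sum>i\<in>A. f i) z = (\<Sum>i\<in>A. f i z :: 'a::comm_monoid_add)"
  by (induction A rule: infinite_finite_induct) (auto simp: zero_fun_def plus_fun_def)

text \<open>The space is the direct sum over \<open>j\<close> of M_(2k-2j) times
  \<open>D^j F0\<close>. For \<open>j > k\<close> the weight is negative and the summand is zero;
  the guard is needed because truncated subtraction would count a constant there.\<close>

lemma (in mlde_frame) dim_Hsp:
  "vector_space.dim vscale (Hsp (k0 + 2 * real k) rho v) =
     (\<Sum>j<CARD('n). if j \<le> k then (k - j) div 6 + (if (k - j) mod 6 = 1 then 0 else 1) else 0)"
proof -
  interpret vs: vector_space "vscale :: complex \<Rightarrow> (complex \<Rightarrow> complex^'n) \<Rightarrow> _"
    by (rule vector_space_vscale)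
  define d :: "nat \<Rightarrow> nat" where "d j = (if j \<le> k then (k - j) div 6 + (if (k - j) mod 6 = 1 then 0 else 1) else 0)" for j
  have "\<exists>e. MF_basis (2 * int k - 2 * int j) (d j) e" for j
  proof (cases "j \<le> k")
    case True
    then have "2 * int k - 2 * int j = 2 * int (k - j)" by (simp add: of_nat_diff)
    then show ?thesis using MF_basis_exists[of "k - j"] True by (simp add: d_def)
  next
    case False
    then have "MF_basis (2 * int k - 2 * int j) 0 (\<lambda>_ _. 0)"
      by (intro MF_basis_empty MF_negative[of "2 * int k - 2 * int j"]) auto
    then show ?thesis using False by (auto simp: d_def)
  qed
  then obtain e where e: "\<And>j. MF_basis (2 * int k - 2 * int j) (d j) (e j)" by metis
  define I where "I = (SIGMA j:{..<CARD('n)}. {..<d j})"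
  define b where "b x = (\<lambda>z. e (fst x) (snd x) z *s Dvpow k0 (fst x) F0 z)" for x
  have sum_I: "(\<Sum>x\<in>I. vscale (c x) (b x)) = (\<lambda>z. \<Sum>j<CARD('n). (\<Sum>i<d j. c (j, i) * e j i z) *s Dvpow k0 j F0 z)" for c
    unfolding I_def
    by (rule ext) (simp add: sum_fun_apply sum.Sigma vscale_def b_def vec.scale_sum_left split_def)
  have "vs.dim (Hsp (k0 + 2 * real k) rho v) = card I"
  proof (rule vs.dim_eq_card_family[where b = b])
    show "finite I" by (simp add: I_def)
    show "b x \<in> Hsp (k0 + 2 * real k) rho v" if "x \<in> I" for x
    proof -
      obtain j i where x: "x = (j, i)" by (cases x)
      then have "i < d j" using that by (simp add: I_def)
      then have "e j i \<in> MF (2 * int k - 2 * int j)" using e by (simp add: MF_basis_def)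
      from Hsp_mult[OF v this Dvpow_Hsp[of j]] show ?thesis by (simp add: b_def x)
    qed
    show "\<exists>c. F = (\<Sum>x\<in>I. vscale (c x) (b x))" if F: "F \<in> Hsp (k0 + 2 * real k) rho v" for F
    proof -
      have "F \<in> Hsp (k0 + of_int (2 * int k)) rho v" using F by simp
      from frame_expansion[OF this] obtain M where M: "\<forall>j<CARD('n). M j \<in> MF (2 * int k - 2 * int j)"
        "F = (\<lambda>z. \<Sum>j<CARD('n). M j z *s Dvpow k0 j F0 z)" by (elim exE conjE) (rule that)
      have "\<forall>j\<in>{..<CARD('n)}. \<exists>c. M j = (\<lambda>z. \<Sum>i<d j. c i * e j i z)"
      proof
        fix j assume "j \<in> {..<CARD('n)}"
        then have "M j \<in> MF (2 * int k - 2 * int j)" using M(1) by simp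
        moreover have "\<forall>f\<in>MF (2 * int k - 2 * int j). \<exists>c. f = (\<lambda>z. \<Sum>i<d j. c i * e j i z)"
          using e[of j] by (simp add: MF_basis_def)
        ultimately show "\<exists>c. M j = (\<lambda>z. \<Sum>i<d j. c i * e j i z)" by (rule bspec[rotated])
      qed
      from bchoice[OF this] obtain c where "\<forall>j\<in>{..<CARD('n)}. M j = (\<lambda>z. \<Sum>i<d j. c j i * e j i z)"
        by (elim exE) (rule that)
      then have c: "M j = (\<lambda>z. \<Sum>i<d j. c j i * e j i z)" if "j < CARD('n)" for j using that by simp
      have "F = (\<Sum>x\<in>I. vscale ((\<lambda>(j, i). c j i) x) (b x))"
        unfolding sum_I M(2) by (rule ext, rule sum.cong) (auto simp: c)
      then show ?thesis by (rule exI[of _ "\<lambda>(j, i). c j i"])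
    qed
    show "c x = 0" if 0: "(\<Sum>x\<in>I. vscale (c x) (b x)) = 0" and x: "x \<in> I" for c x
    proof -
      obtain j i where eq: "x = (j, i)" by (cases x)
      then have ji: "x = (j, i)" "j < CARD('n)" "i < d j" using x by (simp_all add: I_def)
      have "(\<Sum>i<d j. c (j, i) * e j i z) = 0" if "z \<in> HH" for z
        by (rule frame_independent[where c = "\<lambda>j. \<Sum>i<d j. c (j, i) * e j i z", OF that _ ji(2)])
           (use 0 in \<open>simp add: sum_I fun_eq_iff\<close>)
      moreover have "(\<forall>z\<in>HH. (\<Sum>i<d j. c' i * e j i z) = 0) \<longrightarrow> (\<forall>i<d j. c' i = 0)" for c'
        using e[of j] by (simp add: MF_basis_def)
      from this[of "\<lambda>i. c (j, i)"]
      have "(\<forall>z\<in>HH. (\<Sum>i<d j. c (j, i) * e j i z) = 0) \<longrightarrow> (\<forall>i<d j. c (j, i) = 0)" .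
      ultimately show ?thesis using ji by blast
    qed
  qed
  also have "card I = (\<Sum>j<CARD('n). d j)" by (simp add: I_def)
  finally show ?thesis by (simp add: d_def)
qed

text \<open>Raising \<open>k\<close> by 6 adds 1 to each of the five summands and 5 to the
  right-hand side. The first period is treated apart because only there can a guard
  \<open>j \<le> k\<close> fail.\<close>

lemma dim_sum_five:
  fixes k :: nat
  shows "(\<Sum>j<5. if j \<le> k then (k - j) div 6 + (if (k - j) mod 6 = 1 then 0 else 1) else 0)
    = (if k mod 6 = 5 then 5 * k div 6 else 5 * k div 6 + 1)"
proof -
  define q b where "q = k div 6" and "b = k mod 6"
  have k: "k = 6 * q + b" by (simp add: q_def b_def)
  have "b < 6" by (simp add: b_def)
  then consider "b = 0" | "b = 1" | "b = 2" | "b = 3" | "b = 4" | "b = 5" by linarith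
  note b_cases = this
  have five: "(\<Sum>j<5. f j) = f 0 + f 1 + f 2 + f 3 + f 4" for f :: "nat \<Rightarrow> nat"
    by (simp add: eval_nat_numeral)
  show ?thesis
  proof (cases q)
    case 0
    show ?thesis unfolding five k 0 by (rule b_cases) simp_all
  next
    case (Suc p)
    show ?thesis unfolding five k Suc by (rule b_cases; simp; presburger)
  qed
qed

subsection \<open>Diagonalisation\<close>

lemma matrix_vector_mult_sum:
  fixes A :: "'a::comm_ring_1^'n^'m"
  shows "A *v (\<Sum>i\<in>S. f i) = (\<Sum>i\<in>S. A *v f i)"
  by (induction S rule: infinite_finite_induct) (simp_all add: matrix_vector_right_distrib)

lemma eigenvectors_independent:
  fixes A :: "complex^'n^'n"
  assumes "finite S" "inj_on mu S" "\<And>i. i \<in> S \<Longrightarrow> A *v w i = mu i *s w i" "\<And>i. i \<in> S \<Longrightarrow> w i \<noteq> 0"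
    and "(\<Sum>i\<in>S. c i *s w i) = 0"
  shows "\<forall>i\<in>S. c i = 0"
  using assms
proof (induction S arbitrary: c rule: finite_induct)
  case (insert a S)
  have eq: "c a *s w a + (\<Sum>i\<in>S. c i *s w i) = 0" using insert by simp
  have "A *v (c a *s w a + (\<Sum>i\<in>S. c i *s w i)) = (c a * mu a) *s w a + (\<Sum>i\<in>S. (c i * mu i) *s w i)"
    using insert.prems(2)
    by (simp add: matrix_vector_right_distrib matrix_vector_mult_sum vector_scalar_commute)
  then have eq2: "(c a * mu a) *s w a + (\<Sum>i\<in>S. (c i * mu i) *s w i) = 0" using eq by simp
  have "(\<Sum>i\<in>S. (c i * (mu i - mu a)) *s w i) = (\<Sum>i\<in>S. (c i * mu i) *s w i) - mu a *s (\<Sum>i\<in>S. c i *s w i)"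
    by (simp add: vec.scale_sum_right sum_subtractf[symmetric] right_diff_distrib vec.scale_left_diff_distrib mult_ac)
  also have "(\<Sum>i\<in>S. c i *s w i) = - (c a *s w a)" using eq by (simp add: add_eq_0_iff2)
  also have "(\<Sum>i\<in>S. (c i * mu i) *s w i) = - ((c a * mu a) *s w a)" using eq2 by (simp add: add_eq_0_iff2)
  finally have "(\<Sum>i\<in>S. (c i * (mu i - mu a)) *s w i) = 0"
    by (simp add: vec_eq_iff mult_ac)
  then have "\<forall>i\<in>S. c i * (mu i - mu a) = 0"
    using insert.prems by (intro insert.IH) auto
  moreover have "mu i \<noteq> mu a" if "i \<in> S" for i using insert.prems(1) insert.hyps(2) that by (auto simp: inj_on_def)
  ultimately have S: "\<forall>i\<in>S. c i = 0" by auto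
  then have "c a *s w a = 0" using eq by simp
  then have "c a = 0" using insert.prems(3)[of a] by (simp add: vec_eq_iff) blast
  then show ?case using S by simp
qed simp

text \<open>\<open>Q\<close> inverts the matrix whose columns are the eigenvectors. The conclusion
  is phrased by components because each component of \<open>Q *v F z\<close> is to be expanded with
  its own exponent.\<close>

lemma diagonalizable_distinct:
  fixes A :: "complex^'n^'n"
  assumes "inj mu" "\<And>i. A *v w i = mu i *s w i" "\<And>i::'n. w i \<noteq> 0"
  shows "\<exists>Q. invertible Q \<and> (\<forall>x i. (Q *v (A *v x)) $ i = mu i * (Q *v x) $ i)"
proof -
  define P :: "complex^'n^'n" where "P = (\<chi> a i. w i $ a)"
  have P: "P *v y = (\<Sum>i\<in>UNIV. y $ i *s w i)" for y
    by (simp add: P_def vec_eq_iff matrix_vector_mult_def mult.commute)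
  have "y = 0" if "P *v y = 0" for y
  proof -
    have "(\<Sum>i\<in>UNIV. y $ i *s w i) = 0" using that by (simp only: P)
    then have "\<forall>i\<in>UNIV. y $ i = 0"
      by (rule eigenvectors_independent[OF finite_class.finite_UNIV assms])
    then show ?thesis by (simp add: vec_eq_iff)
  qed
  then have "invertible P"
    using matrix_left_invertible_ker[of P] invertible_left_inverse by blast
  then obtain Q where Q: "P ** Q = mat 1" "Q ** P = mat 1" by (auto simp: invertible_def)
  have "A *v (P *v y) = P *v (\<chi> i. mu i * y $ i)" for y
    by (simp add: P matrix_vector_mult_sum vector_scalar_commute assms(2) mult.commute vector_smult_assoc)
  then have "Q *v (A *v (P *v (Q *v x))) = Q *v (P *v (\<chi> i. mu i * (Q *v x) $ i))" for x
    by simp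
  then have "(Q *v (A *v x)) = (\<chi> i. mu i * (Q *v x) $ i)" for x
    by (simp add: matrix_vector_mul_assoc Q)
  then show ?thesis using Q by (intro exI[of _ Q]) (auto simp: invertible_def)
qed

subsection \<open>The five-dimensional case\<close>

lemma Dscpow_component: "Dscpow k n (\<lambda>z. F z $ i) = (\<lambda>z. Dvpow k n F z $ i)"
  by (induction n) (simp_all add: Dv_def [abs_def])

lemma MLDE5_system:
  fixes F :: "complex \<Rightarrow> complex^5"
  assumes "fundamental_system_MLDE5 k F" "vholo F"
  shows "\<exists>C. mlde_system Pfun k C F"
proof -
  obtain M where M: "M 4 \<in> MF 4" "M 6 \<in> MF 6" "M 8 \<in> MF 8" "M 10 \<in> MF 10"
    and sol: "\<And>i. (\<lambda>z. F z $ i) \<in> MLDE5_sols k M"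
    using assms(1) unfolding fundamental_system_MLDE5_def by blast
  define C where "C m = (if m = 0 then \<lambda>z. - M 10 z else if m = 1 then \<lambda>z. - M 8 z
     else if m = 2 then \<lambda>z. - M 6 z else if m = 3 then \<lambda>z. - M 4 z else (\<lambda>z. 0))" for m :: nat
  have "C m holomorphic_on HH" for m
    unfolding C_def using M[THEN MF_D(1)] by (auto intro!: holomorphic_intros)
  moreover have "conn_pow Pfun k 5 F z = (\<Sum>m<5. C m z *s conn_pow Pfun k m F z)" if z: "z \<in> HH" for z
  proof -
    have eq: "Dvpow k 5 F z $ i + M 4 z * Dvpow k 3 F z $ i + M 6 z * Dvpow k 2 F z $ i
        + M 8 z * Dvpow k 1 F z $ i + M 10 z * F z $ i = 0" for i
      using sol[of i] z unfolding MLDE5_sols_def mem_Collect_eq Dscpow_component by blast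
    have solve: "a = - x - y - u - t" if "a + t + u + y + x = 0" for a t u x y :: complex
      using that by algebra
    have five: "(\<Sum>m<5. f m) = f 0 + f 1 + f 2 + f 3 + f 4" for f :: "nat \<Rightarrow> complex^5"
      by (simp add: eval_nat_numeral)
    show ?thesis
    proof (rule vec_eq_iff[THEN iffD2], rule allI)
      fix i
      show "conn_pow Pfun k 5 F z $ i = (\<Sum>m<5. C m z *s conn_pow Pfun k m F z) $ i"
        using solve[OF eq[of i]] unfolding five Dvpow_eq_conn_pow[OF z]
        by (simp add: C_def del: conn_pow.simps(2))
    qed
  qed
  ultimately have "mlde_system Pfun k C F"
    using assms(2) Pfun_holomorphic by (simp add: mlde_system_def C_def)
  then show ?thesis by blast
qed

lemma ee_add: "ee (x + y) = ee x * ee y"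
  by (simp add: ee_def ring_distribs exp_add)

lemma ee_of_int: "ee (of_int n) = 1"
  using exp_integer_2pi[of "of_int n"] by (simp add: ee_def mult_ac)

lemma ee_frac: "ee (frac x) = ee x"
  using ee_add[of "frac x" "of_int \<lfloor>x\<rfloor>"] by (simp add: ee_of_int frac_def)

lemma ee_eq_imp:
  assumes "ee x = ee y" "\<bar>x - y\<bar> < 1"
  shows "x = y"
proof -
  obtain n where "2 * of_real pi * \<i> * of_real x = 2 * of_real pi * \<i> * of_real y + of_real (real_of_int (2 * n) * pi) * \<i>"
    using assms(1) unfolding ee_def exp_eq by blast
  then have "2 * of_real pi * \<i> * (of_real x - of_real y - of_int n) = 0" by (simp add: algebra_simps)
  then have "complex_of_real (x - y - of_int n) = 0" by simp
  then have n: "x - y = of_int n" by (simp only: of_real_eq_0_iff)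
  have "\<bar>real_of_int n\<bar> < 1" using assms(2) by (simp only: n)
  then have "n = 0" by linarith
  then show ?thesis using n by simp
qed

theorem theorem4p22:
  fixes rho :: "sl2 \<Rightarrow> complex^5^5"
    and v :: "sl2 \<Rightarrow> complex"
    and kv m :: real
    and r :: "nat \<Rightarrow> real"
    and F0 :: "complex \<Rightarrow> complex^5"
  assumes rep: "representation rho"
    and Tunit: "T_unitarizable rho"
    and Tdet: "T_determined rho"
    and mult: "multiplier_system kv v"
    and m_range: "0 \<le> m" "m < 12"
    and cusp: "v Tmat = ee (m / 12)"
    and r_range: "0 \<le> r 1" "r 1 < r 2" "r 2 < r 3" "r 3 < r 4" "r 4 < r 5" "r 5 < 1"
    and eig: "eigenvalues (rho Tmat) = {ee (r j) | j. j \<in> {1..5}}"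
    and integral: "12 * (\<Sum>j=1..5. frac (r j + m / 12)) / 5 - m \<in> \<int>"
    and F0_mem: "F0 \<in> Hsp (12 / 5 * (\<Sum>j=1..5. frac (r j + m / 12)) - 4) rho v"
    and F0_nz: "F0 \<noteq> (\<lambda>z. 0)"
    and F0_fund: "fundamental_system_MLDE5 (12 / 5 * (\<Sum>j=1..5. frac (r j + m / 12)) - 4) F0"
  shows
    "(let k0 = 12 / 5 * (\<Sum>j=1..5. frac (r j + m / 12)) - 4 in
       (\<forall>j<5. Dvpow k0 j F0 \<in> Htot k0 rho v) \<and>
       (\<forall>M. (\<forall>j<5. M j \<in> Mring) \<longrightarrow> (\<lambda>z. \<Sum>j<5. M j z *s Dvpow k0 j F0 z) \<in> Htot k0 rho v) \<and>
       (\<forall>F\<in>Htot k0 rho v. \<exists>M. (\<forall>j<5. M j \<in> Mring) \<and>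
            F = (\<lambda>z. \<Sum>j<5. M j z *s Dvpow k0 j F0 z)) \<and>
       (\<forall>M. (\<forall>j<5. M j \<in> Mring) \<and> (\<lambda>z. \<Sum>j<5. M j z *s Dvpow k0 j F0 z) = (\<lambda>z. 0)
            \<longrightarrow> (\<forall>j<5. M j = (\<lambda>z. 0))) \<and>
       (\<forall>k::nat. vector_space.dim vscale (Hsp (k0 + 2 * real k) rho v)
            = (if k mod 6 = 5 then 5 * k div 6 else 5 * k div 6 + 1)) \<and>
       Htot k0 rho v = {F. \<exists>N M. (\<forall>j<N. M j \<in> Mring) \<and>
            F = (\<lambda>z. \<Sum>j<N. M j z *s Dvpow k0 j F0 z)})"
proof -
  define L where "L = (\<Sum>j=1..5. frac (r j + m / 12))"
  define k0 where "k0 = 12 / 5 * L - 4"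
  have v: "\<forall>g\<in>SL2Z. v g \<noteq> 0" using mult by (force simp: multiplier_system_def)
  have rho: "\<And>g. g \<in> SL2Z \<Longrightarrow> invertible (rho g)" using rep by (simp add: representation_def)
  have F0: "F0 \<in> Hsp k0 rho v" using F0_mem by (simp add: k0_def L_def)
  have fund: "fundamental_system_MLDE5 k0 F0" using F0_fund by (simp add: k0_def L_def)
  note F0D = HspD[OF v F0]
  obtain C where sys: "mlde_system Pfun k0 C F0" using MLDE5_system[OF fund F0D(1)] by blast
  have indep: "\<forall>i. c i = 0" if "\<And>z. z \<in> HH \<Longrightarrow> (\<Sum>i\<in>UNIV. c i * F0 z $ i) = 0" for c
    using fund that unfolding fundamental_system_MLDE5_def by blast
  obtain h :: "5 \<Rightarrow> nat" where h: "bij_betw h UNIV {..<CARD(5)}"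
    using ex_bij_betw_finite_nat[of "UNIV :: 5 set"] by (auto simp: atLeast0LessThan)
  \<comment> \<open>Attaches the exponents \<open>r 1\<close>, ..., \<open>r 5\<close> to the
    coordinates of the eigenbasis, as \<open>h\<close> attaches the orders 0 to 4 to the
    rows.\<close>
  obtain \<tau> :: "5 \<Rightarrow> nat" where \<tau>: "bij_betw \<tau> UNIV {1..5}"
    using finite_same_card_bij[of "UNIV :: 5 set" "{1..5::nat}"] by auto
  have \<tau>_in: "\<tau> i \<in> {1..5}" for i using \<tau> by (auto simp: bij_betw_def)
  define lam where "lam i = frac (r (\<tau> i) + m / 12)" for i
  define mu where "mu i = ee (r (\<tau> i))" for i
  have sum_lam: "(\<Sum>i\<in>UNIV. lam i) = L"
    unfolding L_def lam_def by (rule sum.reindex_bij_betw[OF \<tau>])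
  have r_bounds: "0 \<le> r a \<and> r a < 1" if "a \<in> {1..5}" for a
  proof -
    have "a = 1 \<or> a = 2 \<or> a = 3 \<or> a = 4 \<or> a = 5" using that by auto
    then show ?thesis using r_range by auto
  qed
  have r_inj: "a = b" if "a \<in> {1..5}" "b \<in> {1..5}" "r a = r b" for a b
  proof -
    have "a = 1 \<or> a = 2 \<or> a = 3 \<or> a = 4 \<or> a = 5" "b = 1 \<or> b = 2 \<or> b = 3 \<or> b = 4 \<or> b = 5"
      using that by auto
    then show ?thesis using r_range that(3) by (elim disjE) simp_all
  qed
  have mu_inj: "inj mu"
  proof (rule injI)
    fix i j assume "mu i = mu j"
    then have "r (\<tau> i) = r (\<tau> j)"
      unfolding mu_def by (rule ee_eq_imp) (use r_bounds[OF \<tau>_in[of i]] r_bounds[OF \<tau>_in[of j]] in linarith)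
    then have "\<tau> i = \<tau> j" using r_inj \<tau>_in by blast
    then show "i = j" using \<tau> by (auto simp: bij_betw_def inj_def)
  qed
  have "\<exists>w. w \<noteq> 0 \<and> rho Tmat *v w = mu i *s w" for i
  proof -
    have "mu i \<in> eigenvalues (rho Tmat)" unfolding eig mu_def using \<tau>_in by blast
    then show ?thesis by (auto simp: eigenvalues_def)
  qed
  then obtain w where w: "\<And>i. w i \<noteq> 0" "\<And>i. rho Tmat *v w i = mu i *s w i" by metis
  obtain Q where Q: "invertible Q" "\<And>x i. (Q *v (rho Tmat *v x)) $ i = mu i * (Q *v x) $ i"
    using diagonalizable_distinct[OF mu_inj w(2) w(1)] by blast
  have weight: "(\<Sum>j\<in>UNIV. k0 + 2 * real (h j)) = 12 * (\<Sum>i\<in>UNIV. lam i)"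
  proof -
    have "(\<Sum>j\<in>UNIV. k0 + 2 * real (h j)) = (\<Sum>j<CARD(5). k0 + 2 * real j)"
      by (rule sum.reindex_bij_betw[OF h])
    also have "\<dots> = 5 * k0 + 20" by (simp add: eval_nat_numeral)
    finally show ?thesis by (simp add: sum_lam k0_def)
  qed
  \<comment> \<open>A zero sum of fractional parts would make both \<open>r 1 + m / 12\<close> and
    \<open>r 2 + m / 12\<close> integers, although they differ by a positive number below 1.\<close>
  have "L \<noteq> 0"
  proof
    assume "L = 0"
    then have "\<forall>j\<in>{1..5}. frac (r j + m / 12) = 0"
      unfolding L_def by (subst (asm) sum_nonneg_eq_0_iff) auto
    then have "frac (r 1 + m / 12) = 0" "frac (r 2 + m / 12) = 0" by auto
    then have "ee (r 1 + m / 12) = ee (r 2 + m / 12)" by (metis ee_frac)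
    then have "r 1 + m / 12 = r 2 + m / 12" by (rule ee_eq_imp) (use r_range in linarith)
    then show False using r_range by simp
  qed
  then have \<kappa>: "(\<Sum>j\<in>UNIV. k0 + 2 * real (h j)) \<noteq> 0" by (simp add: weight sum_lam)
  \<comment> \<open>\<open>F0\<close> itself yields the law of \<open>Pfun\<close>, with the
    constants \<open>v g\<close> and \<open>rho g\<close>; from here on the theory of modular forms
    is available.\<close>
  have qm: "pull g Pfun z = Pfun z" if "g \<in> SL2Z" "z \<in> HH" for g z
    by (rule pull_eq_self[OF h sys indep that \<kappa> F0D(4)[OF that(1)] bspec[OF v that(1)] rho[OF that(1)]])
  interpret mlde_frame rho v k0 h C F0 Q mu lam
  proof unfold_locales
    show "v Tmat * mu i = ee (lam i)" for i
      by (simp add: cusp mu_def lam_def ee_frac ee_add mult.commute)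
    show "lam i < 1" for i by (simp add: lam_def frac_lt_1)
  qed (use qm v rho F0 h sys indep Q weight in auto)
  have five: "CARD(5) = 5" by simp
  \<comment> \<open>Operators of any order \<open>N\<close> occur on the right. One inclusion takes
    \<open>N = 5\<close> from the expansion, the other is closure of the module under D and under
    multiplication by modular forms.\<close>
  have "Htot k0 rho v = {F. \<exists>N M. (\<forall>j<N. M j \<in> Mring) \<and> F = (\<lambda>z. \<Sum>j<N. M j z *s Dvpow k0 j F0 z)}"
    using Htot_expansion combination_in_Htot by blast
  moreover have "\<forall>k::nat. vector_space.dim vscale (Hsp (k0 + 2 * real k) rho v)
      = (if k mod 6 = 5 then 5 * k div 6 else 5 * k div 6 + 1)"
    using dim_Hsp unfolding five dim_sum_five by blast
  moreover have "\<forall>j<5. Dvpow k0 j F0 \<in> Htot k0 rho v"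
    using Hsp_subset_Htot[OF Dvpow_Hsp] by blast
  ultimately show ?thesis
    unfolding Let_def L_def[symmetric] k0_def[symmetric]
    using combination_in_Htot[of 5] Htot_expansion[unfolded five] Mring_independent[unfolded five] by blast
qed

end
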